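(* Let $\Gamma=\hat\Gamma\times\hat\Gamma^\perp\subseteq\mathbb{R}^N$ with $\hat\Gamma\subseteq\mathbb{R}^m$, $m<N$. Let $b:\Gamma\to\mathbb{R}^N$ be globally Lipschitz and let $\mu_0$ be a probability measure on $\Gamma$ with finite second moment that is absolutely continuous with respect to Lebesgue measure. Let $X_t\in\Gamma$ solve $dX_t=b(X_t)\,dt$ with $X_0\sim\mu_0$, let $\mu_t$ be the law of $X_t$, and assume $b\in L^2(\Gamma,\mu_t)$ for all $t\ge0$. Let $\hat X=(X_1,\dots,X_m)$ be the resolved variables, $\hat b:=(b_1,\dots,b_m)$, and let $\hat\mu_t$ be the marginal of $\mu_t$ on $\hat\Gamma$. Assume that the conditional measures $\mu_{t|\hat X=x}$ exist and that for every $t\ge0$ there is $K_t\ge0$ such that $$\mathcal{W}_1\big(\mu_{t|\hat X=y},\mu_{t|\hat X=z}\big)\le K_t|y-z|\qquad\text{for all }y,z\in\hat\Gamma.$$ Let the $\hat\Gamma$-valued surrogate trajectories, again denoted $\hat X_t$, satisfy the reduced dynamics $$d\hat X_t=\mathbb{E}_{\mu_t}[\hat b(X)\mid\hat X=\hat X_t]\,dt,\qquad \hat X_0\sim\hat\mu_0 .$$ Then the surrogate trajectories preserve the marginal law: $\hat X_t\sim\hat\mu_t$ for all $t\ge0$. Moreover, at each $t\ge 0$ the function $x\mapsto\mathbb{E}_{\mu_t}[\hat b(X)\mid\hat X=x]$ is the optimal ($L^2$-orthogonal) projection of the vector field: for every $g\in L^2(\hat\Gamma,\hat\mu_t;\mathbb{R}^m)$,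 $$\mathbb{E}_{\mu_t}\Big[\big|\hat b(X)-\mathbb{E}_{\mu_t}[\hat b(X)\mid\hat X]\big|^2\Big]\le\mathbb{E}_{\mu_t}\Big[\big|\hat b(X)-g(\hat X)\big|^2\Big].$$
   Context: $\mathbb{E}_{\mu_t}$ denotes expectation when the full state $X=(\hat X,\hat X^\perp)$ is distributed according to $\mu_t$. The measures $\mu_{t|\hat X=x}$, $x\in\hat\Gamma$, are the conditional laws (on $\Gamma$) of $X\sim\mu_t$ given $\hat X=x$, and $\mathbb{E}_{\mu_t}[\hat b(X)\mid\hat X=x]=\int_\Gamma\hat b\,d\mu_{t|\hat X=x}$; in the reduced dynamics this function of $(t,x)$ is evaluated at $x=\hat X_t$. The law $\mu_t$ of the full system is a given time-dependent family; it is not the law of the surrogate. $\mathcal{W}_1$ is the 1-Wasserstein distance. The phase space $\Gamma$ is invariant under the dynamics.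
   Formalization: The preservation of the marginal law is proved under the added assumption that K_t is integrable in t on every interval [0,T]; with K_t only finite at each t the reduced dynamics can be non-unique and the claim fails. The projection claim needs no such assumption. *)

theory Defs
  imports "HOL-Probability.Probability"
begin

text \<open>
  A subset \<open>G\<close> of a Euclidean space with the Borel sigma-algebra of its subspace topology; no
  measurability of \<open>G\<close> is needed. ``A measure on \<open>G\<close>'' means a measure on this measurable space.
  Only its space and sets are used, never the values of the underlying measure.
\<close>
definition subspace_borel :: "'a::topological_space set \<Rightarrow> 'a measure" where
  "subspace_borel G = restrict_space borel G"

definition square_integrable :: "'a measure \<Rightarrow> ('a \<Rightarrow> 'b::euclidean_space) \<Rightarrow> bool" where
  "square_integrable M f \<longleftrightarrow> f \<in> borel_measurable M \<and> integrable M (\<lambda>z. (norm (f z))\<^sup>2)"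

text \<open>
  The vector field is only meaningful on the phase space, so trajectories are used together with
  the requirement that they stay there.
\<close>
definition is_trajectory :: "('a::real_normed_vector \<Rightarrow> 'a) \<Rightarrow> (real \<Rightarrow> 'a) \<Rightarrow> bool" where
  "is_trajectory b x \<longleftrightarrow> (\<forall>t\<ge>0. (x has_vector_derivative b (x t)) (at t within {0..}))"

definition invariant_under :: "('a::real_normed_vector \<Rightarrow> 'a) \<Rightarrow> 'a set \<Rightarrow> bool" where
  "invariant_under b G \<longleftrightarrow>
     (\<forall>z\<in>G. \<exists>x. x 0 = z \<and> is_trajectory b x \<and> (\<forall>t\<ge>0. x t \<in> G))"

text \<open>
  \<open>\<kappa>\<close> is a regular conditional distribution under \<open>M\<close> of the full state \<open>z\<close> given \<open>f z = x\<close>: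
  a Markov kernel from \<open>N\<close> to \<open>M\<close> that disintegrates \<open>M\<close> along \<open>f\<close>. As usual it is determined
  by this only up to null sets of the law of \<open>f\<close>.
\<close>
definition conditional_laws ::
    "'z measure \<Rightarrow> ('z \<Rightarrow> 'x) \<Rightarrow> 'x measure \<Rightarrow> ('x \<Rightarrow> 'z measure) \<Rightarrow> bool" where
  "conditional_laws M f N \<kappa> \<longleftrightarrow>
     \<kappa> \<in> N \<rightarrow>\<^sub>M prob_algebra M \<and>
     (\<forall>A\<in>sets M. \<forall>B\<in>sets N.
        emeasure M (A \<inter> {z \<in> space M. f z \<in> B})
          = (\<integral>\<^sup>+x\<in>B. emeasure (\<kappa> x) A \<partial>(distr M N f)))"

definition couplings :: "'a measure \<Rightarrow> 'a measure \<Rightarrow> ('a \<times> 'a) measure set" where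
  "couplings M N =
     {\<pi>. sets \<pi> = sets (M \<Otimes>\<^sub>M N) \<and> distr \<pi> M fst = M \<and> distr \<pi> N snd = N}"

text \<open>
  Extended-valued, so that an upper bound by a real number also asserts finiteness.
\<close>
definition wasserstein1 :: "'a::metric_space measure \<Rightarrow> 'a measure \<Rightarrow> ennreal" where
  "wasserstein1 M N = (INF \<pi>\<in>couplings M N. \<integral>\<^sup>+p. ennreal (dist (fst p) (snd p)) \<partial>\<pi>)"

text \<open>
  The reduced vector field: the conditional expectation of the resolved component of \<open>b\<close>, as a
  function of time and of the resolved state.
\<close>
definition reduced_field ::
    "('a \<times> 'c \<Rightarrow> 'a::euclidean_space \<times> 'c) \<Rightarrow> (real \<Rightarrow> 'a \<Rightarrow> ('a \<times> 'c) measure)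
      \<Rightarrow> real \<Rightarrow> 'a \<Rightarrow> 'a" where
  "reduced_field b \<kappa> t x = (\<integral>z. fst (b z) \<partial>(\<kappa> t x))"

text \<open>
  Solutions in the sense of Caratheodory (the integral form of the equation), since a
  time-dependent field \<open>v\<close> such as the reduced one need not be continuous in time.
\<close>
definition is_caratheodory_trajectory ::
    "(real \<Rightarrow> 'a::euclidean_space \<Rightarrow> 'a) \<Rightarrow> (real \<Rightarrow> 'a) \<Rightarrow> bool" where
  "is_caratheodory_trajectory v y \<longleftrightarrow>
     (\<forall>t\<ge>0. (\<lambda>s. v s (y s)) absolutely_integrable_on {0..t} \<and>
            y t = y 0 + integral {0..t} (\<lambda>s. v s (y s)))"

end

theory Submission
  imports Defs
begin

text \<open>
  The projection property is the usual orthogonality of \<open>b - E[b | f]\<close> to functions of \<open>f\<close>. For the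
  law, the Wasserstein bound makes the reduced field \<open>v s\<close> Lipschitz with constant \<open>L * K s\<close>. Both the
  resolved variables of the full system and the surrogate trajectories have mean velocity \<open>v s\<close> given
  the position, so their laws solve the same continuity equation. Uniqueness follows from a Gronwall
  estimate for the bounded Lipschitz distance of the two laws. A nearly optimal test function \<open>u\<close> is
  mollified; to first order in \<open>h\<close>, transporting the mollified \<open>u\<close> by \<open>v s\<close> is the same as mollifying
  the function \<open>u (p + h v s p)\<close>, which up to a factor \<open>1 + h * Lip (v s)\<close> is again a test function.
  Only the field at a single time enters, so no regularity of \<open>v\<close> in time is required.
\<close>

section \<open>Preliminaries\<close>

text \<open>A test function that is nearly optimal for the distance changes with time, so the
  supremum cannot be differentiated. One that is nearly optimal at the right end of a short interval
  is used on the whole interval; the loss at earlier times is of the order of the integral of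
  \<open>k\<close>, and after division by the Euler step \<open>h\<close> it contributes a term of
  second order in the interval. The limits have a fixed order: the intervals shrink with
  \<open>h\<close> and the mollification radius \<open>e\<close> fixed, which removes the second
  order terms, then \<open>h\<close> tends to 0, then \<open>e\<close>. The bound \<open>k\<close>
  is only integrable in time, so an Euler error of order h^2 k^2 may fail to be integrable;
  \<open>min k (h * k^2)\<close> is dominated by \<open>k\<close> and vanishes pointwise instead.
  Mollification evaluates the field outside \<open>\<Gamma>h\<close>, so the reduced field is first
  extended to the whole space. Processes are known path by path; Lipschitz dependence on the initial
  value yields the joint measurability that Fubini's theorem asks for.\<close>

lemma abs_int_subinterval:
  fixes k :: "real \<Rightarrow> 'a::euclidean_space"
  assumes "k absolutely_integrable_on {0..T}" "0 \<le> r" "t \<le> T"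
  shows "k absolutely_integrable_on {r..t}"
  by (rule absolutely_integrable_on_subinterval[OF assms(1)]) (use assms in auto)

lemma abs_int_subinterval_on:
  fixes k :: "real \<Rightarrow> 'a::euclidean_space"
  assumes "k absolutely_integrable_on {0..T}" "0 \<le> r" "t \<le> T"
  shows "k integrable_on {r..t}"
  using abs_int_subinterval[OF assms] set_lebesgue_integral_eq_integral(1) by auto

lemma le_one_plus_sq: "z \<le> 1 + z\<^sup>2" for z :: real
proof -
  have "0 \<le> (z - 1)\<^sup>2" by simp
  then have "2 * z \<le> 1 + z\<^sup>2" by (simp add: power2_eq_square algebra_simps)
  moreover have "0 \<le> z\<^sup>2" by simp
  ultimately show ?thesis by linarith
qed

lemma integral_combine_diff:
  fixes k :: "real \<Rightarrow> 'a::euclidean_space"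
  assumes "k absolutely_integrable_on {0..T}" "0 \<le> r" "r \<le> t" "t \<le> T"
  shows "integral {r..t} k = integral {0..t} k - integral {0..r} k"
proof -
  have "k integrable_on {0..t}"
    using abs_int_subinterval_on[OF assms(1), of 0 t] assms(4) by simp
  then show ?thesis
    using Henstock_Kurzweil_Integration.integral_combine[of 0 r t k] assms by (simp add: algebra_simps)
qed

section \<open>Short time steps and Gronwall's inequality\<close>

lemma small_integral_steps:
  fixes k :: "real \<Rightarrow> real"
  assumes k: "k absolutely_integrable_on {0..T}" and "e > 0"
  obtains d where "d > 0" "\<And>r t. 0 \<le> r \<Longrightarrow> r \<le> t \<Longrightarrow> t \<le> T \<Longrightarrow> t - r < d \<Longrightarrow> integral {r..t} k < e"
proof -
  have "k integrable_on {0..T}"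
    using abs_int_subinterval_on[OF k] by simp
  then have "uniformly_continuous_on {0..T} (\<lambda>t. integral {0..t} k)"
    by (intro compact_uniformly_continuous indefinite_integral_continuous_1) auto
  then obtain d where d: "d > 0"
    "\<And>r t. r \<in> {0..T} \<Longrightarrow> t \<in> {0..T} \<Longrightarrow> dist t r < d \<Longrightarrow> dist (integral {0..t} k) (integral {0..r} k) < e"
    using \<open>e > 0\<close> unfolding uniformly_continuous_on_def by meson
  show ?thesis
  proof (rule that[OF d(1)])
    fix r t assume rt: "0 \<le> r" "r \<le> t" "t \<le> T" "t - r < d"
    have "dist t r < d" using rt by (simp add: dist_real_def)
    then have "dist (integral {0..t} k) (integral {0..r} k) < e"
      using d(2)[of r t] rt by auto
    then show "integral {r..t} k < e"
      using integral_combine_diff[OF k rt(1-3)] by (simp add: dist_real_def)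
  qed
qed

lemma uniform_steps_obtain:
  fixes d T :: real
  assumes "d > 0"
  obtains n :: nat where "n > 0" "T / real n < d"
proof -
  obtain n :: nat where n: "T / d < real n" using reals_Archimedean2 by blast
  have "T / d < real (Suc n)" using n by simp
  then have "T / real (Suc n) < d"
    using assms by (simp add: field_simps del: of_nat_Suc)
  then show ?thesis using that[of "Suc n"] by simp
qed

text \<open>A form of Gronwall's inequality that needs no measurability of the function being bounded.\<close>
lemma gronwall_sup:
  fixes k :: "real \<Rightarrow> real"
  assumes k: "k absolutely_integrable_on {0..T}" and kpos: "\<And>s. s \<in> {0..T} \<Longrightarrow> 0 \<le> k s"
  obtains C where "1 \<le> C"
    "\<And>g t. (\<And>s. s \<in> {0..T} \<Longrightarrow> 0 \<le> g s) \<Longrightarrow> bdd_above (g ` {0..T}) \<Longrightarrow>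
      (\<And>r t S. 0 \<le> r \<Longrightarrow> r \<le> t \<Longrightarrow> t \<le> T \<Longrightarrow> (\<And>s. s \<in> {r..t} \<Longrightarrow> g s \<le> S) \<Longrightarrow>
        g t \<le> g r + S * integral {r..t} k) \<Longrightarrow>
      t \<in> {0..T} \<Longrightarrow> g t \<le> C * g 0"
proof -
  \<comment> \<open>On steps where the integral of \<open>k\<close> is below 1/2, the supremum
    \<open>S\<close> of \<open>g\<close> satisfies \<open>S \<le> g r + S / 2\<close>, so
    \<open>g\<close> at most doubles. The number \<open>n\<close> of steps is fixed by
    \<open>k\<close> and \<open>T\<close> alone, which makes the constant \<open>2^n\<close> uniform
    in \<open>g\<close>.\<close>
  obtain d where d: "d > 0" "\<And>r t. 0 \<le> r \<Longrightarrow> r \<le> t \<Longrightarrow> t \<le> T \<Longrightarrow> t - r < d \<Longrightarrow> integral {r..t} k < 1/2"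
    using small_integral_steps[OF k, of "1/2"] by auto
  obtain n where n: "n > 0" "T / real n < d" using uniform_steps_obtain[OF d(1)] by metis
  show ?thesis
  proof (rule that[of "2^n"])
    fix g :: "real \<Rightarrow> real" and t
    assume pos: "\<And>s. s \<in> {0..T} \<Longrightarrow> 0 \<le> g s" and bdd: "bdd_above (g ` {0..T})"
      and step: "\<And>r t S. 0 \<le> r \<Longrightarrow> r \<le> t \<Longrightarrow> t \<le> T \<Longrightarrow> (\<And>s. s \<in> {r..t} \<Longrightarrow> g s \<le> S) \<Longrightarrow>
        g t \<le> g r + S * integral {r..t} k"
      and t: "t \<in> {0..T}"
    have T: "T \<ge> 0" using t by simp
    have *: "\<forall>t\<in>{0..real j * (T/n)}. g t \<le> 2^j * g 0" if "j \<le> n" for j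
      using that
    proof (induction j)
      case 0 show ?case by simp
    next
      case (Suc j)
      define r where "r = real j * (T/n)"
      define e where "e = real (Suc j) * (T/n)"
      have er: "e = r + T/n" unfolding r_def e_def by (simp add: distrib_right add_divide_distrib)
      have re: "0 \<le> r" "r \<le> e" "e - r = T/n" using T unfolding er by (simp_all add: r_def)
      have "e \<le> real n * (T/n)" unfolding e_def using Suc.prems T by (intro mult_right_mono) auto
      then have eT: "e \<le> T" using n(1) by simp
      \<comment> \<open>Boundedness of \<open>g\<close> makes this a genuine upper bound, so that
        \<open>S / 2\<close> can be absorbed below.\<close>
      define S where "S = Sup (g ` {r..e})"
      have bdd': "bdd_above (g ` {r..e})" by (rule bdd_above_mono[OF bdd]) (use re eT in auto)
      have S: "g s \<le> S" if "s \<in> {r..e}" for s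
        unfolding S_def using bdd' that by (intro cSup_upper) auto
      have "0 \<le> g r" using pos re eT by auto
      then have S0: "S \<ge> 0" using S[of r] re by auto
      have "g s \<le> g r + S / 2" if s: "s \<in> {r..e}" for s
      proof -
        have "g s \<le> g r + S * integral {r..s} k"
        proof (rule step)
          show "g s' \<le> S" if "s' \<in> {r..s}" for s' using S that s by simp
        qed (use s re eT in auto)
        also have "S * integral {r..s} k \<le> S * (1/2)"
        proof (rule mult_left_mono[OF less_imp_le S0])
          have "s - r < d" using s re n(2) by auto
          then show "integral {r..s} k < 1/2" using d(2) s re eT by simp
        qed
        finally show ?thesis by simp
      qed
      then have "S \<le> g r + S / 2" unfolding S_def using re by (intro cSup_least) auto
      then have S2: "S \<le> 2 * g r" by simp
      have "r \<in> {0..real j * (T/n)}" using re(1) unfolding r_def by simp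
      then have gr: "g r \<le> 2^j * g 0" using Suc.IH Suc.prems by simp
      show ?case
      proof
        fix s assume s: "s \<in> {0..real (Suc j) * (T/n)}"
        have g0: "g 0 \<ge> 0" using pos T by auto
        show "g s \<le> 2 ^ Suc j * g 0"
        proof (cases "s \<le> r")
          case True
          then have "s \<in> {0..real j * (T/n)}" using s unfolding r_def by simp
          then have "g s \<le> 2^j * g 0" using Suc.IH Suc.prems by simp
          moreover have "0 \<le> 2^j * g 0" using g0 by simp
          ultimately show ?thesis by simp
        next
          case False
          then have "s \<in> {r..e}" using s unfolding e_def by simp
          then have "g s \<le> S" by (rule S)
          then show ?thesis using S2 gr by simp
        qed
      qed
    qed
    have "real n * (T/n) = T" using n(1) by simp
    then show "g t \<le> 2^n * g 0" using *[of n] t by simp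
  qed simp
qed

text \<open>Telescoping over a fine uniform partition: errors of the form \<open>e\<close> times an
  increment of \<open>M\<close> add up to \<open>e * (M b - M a)\<close>, and \<open>e\<close> is
  arbitrary. Later \<open>M\<close> is the indefinite integral of \<open>k\<close>.\<close>

lemma nonincreasing_of_small_increments:
  fixes F M :: "real \<Rightarrow> real"
  assumes ab: "a \<le> b"
    and small: "\<And>e::real. e > 0 \<Longrightarrow> \<exists>d>0. \<forall>r t. a \<le> r \<longrightarrow> r \<le> t \<longrightarrow> t \<le> b \<longrightarrow> t - r < d \<longrightarrow> F t - F r \<le> e * (M t - M r)"
  shows "F b \<le> F a"
proof -
  have main: "F b - F a \<le> e * (M b - M a)" if e: "e > 0" for e :: real
  proof -
    obtain d where d: "d > 0" "\<And>r t. a \<le> r \<Longrightarrow> r \<le> t \<Longrightarrow> t \<le> b \<Longrightarrow> t - r < d \<Longrightarrow> F t - F r \<le> e * (M t - M r)"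
      using small[OF e] by meson
    obtain n where n: "n > 0" "(b - a) / real n < d" using uniform_steps_obtain[OF d(1)] by metis
    define h where "h = (b - a) / n"
    have h: "0 \<le> h" unfolding h_def using ab by simp
    define p where "p i = a + real i * h" for i
    have p0: "p 0 = a" and pn: "p n = b" unfolding p_def h_def using n(1) by auto
    have "F (p i) - F a \<le> e * (M (p i) - M a)" if "i \<le> n" for i
      using that
    proof (induction i)
      case 0 then show ?case by (simp add: p0)
    next
      case (Suc i)
      have 1: "a \<le> p i" "p i \<le> p (Suc i)" "p (Suc i) - p i = h"
        using h unfolding p_def by (simp_all add: distrib_right)
      have "p (Suc i) \<le> p n"
        unfolding p_def using Suc.prems h by (intro add_left_mono mult_right_mono) auto
      then have "p (Suc i) \<le> b" using pn by simp
      then have "F (p (Suc i)) - F (p i) \<le> e * (M (p (Suc i)) - M (p i))"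
        using 1 n(2) d(2)[of "p i" "p (Suc i)"] by (simp add: h_def)
      then show ?case using Suc by (simp add: algebra_simps)
    qed
    from this[of n] show ?thesis by (simp add: pn)
  qed
  show ?thesis
  proof (rule field_le_epsilon)
    fix e :: real assume "e > 0"
    \<comment> \<open>The added 1 keeps the denominator positive when
      \<open>M a = M b\<close>.\<close>
    define e' where "e' = e / (\<bar>M b - M a\<bar> + 1)"
    have "e' > 0" using \<open>e > 0\<close> unfolding e'_def by (auto intro!: divide_pos_pos)
    have "F b - F a \<le> e' * (M b - M a)" by (rule main[OF \<open>e' > 0\<close>])
    also have "\<dots> \<le> e' * (\<bar>M b - M a\<bar> + 1)" using \<open>e' > 0\<close> by (intro mult_left_mono) auto
    also have "\<dots> = e" unfolding e'_def by (auto simp: field_simps)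
    finally show "F b \<le> F a + e" by simp
  qed
qed

section \<open>Extension of Lipschitz functions\<close>

lemma mcshane_extension:
  fixes f :: "'a::metric_space \<Rightarrow> real"
  assumes lip: "\<And>x y. x \<in> S \<Longrightarrow> y \<in> S \<Longrightarrow> \<bar>f x - f y\<bar> \<le> C * dist x y" and C: "C \<ge> 0"
  obtains g where "\<And>x. x \<in> S \<Longrightarrow> g x = f x" "\<And>x y. \<bar>g x - g y\<bar> \<le> C * dist x y"
proof (cases "S = {}")
  case True
  then show ?thesis using that[of "\<lambda>_. 0"] C by simp
next
  case False
  then obtain s0 where s0: "s0 \<in> S" by blast
  \<comment> \<open>McShane's formula, the lower envelope of cones of slope \<open>C\<close> with
    tips on the graph of \<open>f\<close>.\<close>
  define g where "g x = (INF z\<in>S. f z + C * dist x z)" for x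
  have bdd: "bdd_below ((\<lambda>z. f z + C * dist x z) ` S)" for x
  proof (rule bdd_belowI2[of _ "f s0 - C * dist x s0"])
    fix z assume z: "z \<in> S"
    have "f s0 - f z \<le> C * dist s0 z" using lip[OF s0 z] by simp
    also have "\<dots> \<le> C * (dist x s0 + dist x z)"
      using C dist_triangle3[of s0 z x] by (intro mult_left_mono) (auto simp: dist_commute)
    finally show "f s0 - C * dist x s0 \<le> f z + C * dist x z" by (simp add: algebra_simps)
  qed
  have half: "g x \<le> g y + C * dist x y" for x y
  proof -
    have "g x - C * dist x y \<le> f z + C * dist y z" if "z \<in> S" for z
    proof -
      have "g x \<le> f z + C * dist x z" unfolding g_def by (rule cINF_lower[OF bdd that])
      also have "\<dots> \<le> f z + C * (dist x y + dist y z)"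
        using C dist_triangle[of x z y] by (intro add_left_mono mult_left_mono) auto
      finally show ?thesis by (simp add: algebra_simps)
    qed
    then have "g x - C * dist x y \<le> g y" unfolding g_def[of y] by (intro cINF_greatest False) auto
    then show ?thesis by simp
  qed
  show ?thesis
  proof (rule that)
    fix x assume x: "x \<in> S"
    have "g x \<le> f x + C * dist x x" unfolding g_def by (rule cINF_lower[OF bdd x])
    moreover have "f x \<le> g x" unfolding g_def
    proof (rule cINF_greatest[OF False])
      fix z assume "z \<in> S"
      then show "f x \<le> f z + C * dist x z" using lip[OF x, of z] by simp
    qed
    ultimately show "g x = f x" by simp
  next
    fix x y show "\<bar>g x - g y\<bar> \<le> C * dist x y"
      using half[of x y] half[of y x] by (simp add: dist_commute abs_le_iff)
  qed
qed

text \<open>McShane's extension in each coordinate. The factor \<open>DIM('b)\<close> is harmless,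
  because of the Lipschitz constant of the extension only its integrability in time matters
  later.\<close>

lemma lipschitz_extension_euclidean:
  fixes f :: "'a::metric_space \<Rightarrow> 'b::euclidean_space" and C :: real
  assumes lip: "\<And>x y. x \<in> S \<Longrightarrow> y \<in> S \<Longrightarrow> norm (f x - f y) \<le> C * dist x y" and C: "C \<ge> 0"
  obtains g where "\<And>x. x \<in> S \<Longrightarrow> g x = f x" "\<And>x y. norm (g x - g y) \<le> (DIM('b) * C) * dist x y"
proof -
  have "\<exists>h. (\<forall>x\<in>S. h x = f x \<bullet> i) \<and> (\<forall>x y. \<bar>h x - h y\<bar> \<le> C * dist x y)" if i: "i \<in> Basis" for i
  proof -
    have "\<bar>f x \<bullet> i - f y \<bullet> i\<bar> \<le> C * dist x y" if "x \<in> S" "y \<in> S" for x y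
      using Basis_le_norm[OF i, of "f x - f y"] lip[OF that] by (simp add: inner_diff_left)
    then show ?thesis using mcshane_extension[of S "\<lambda>x. f x \<bullet> i" C] C by (metis (no_types, lifting))
  qed
  then obtain h where h: "\<And>i x. i \<in> Basis \<Longrightarrow> x \<in> S \<Longrightarrow> h i x = f x \<bullet> i"
     "\<And>i x y. i \<in> Basis \<Longrightarrow> \<bar>h i x - h i y\<bar> \<le> C * dist x y" by metis
  show ?thesis
  proof (rule that[of "\<lambda>x. \<Sum>i\<in>Basis. h i x *\<^sub>R i"])
    fix x assume "x \<in> S"
    then show "(\<Sum>i\<in>Basis. h i x *\<^sub>R i) = f x" using h(1) by (simp add: euclidean_representation)
  next
    fix x y
    have "norm ((\<Sum>i\<in>Basis. h i x *\<^sub>R i) - (\<Sum>i\<in>Basis. h i y *\<^sub>R i)) = norm (\<Sum>i\<in>Basis. (h i x - h i y) *\<^sub>R (i::'b))"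
      by (simp add: sum_subtractf scaleR_diff_left)
    also have "\<dots> \<le> (\<Sum>i\<in>(Basis::'b set). C * dist x y)"
      by (rule sum_norm_le) (use h(2) in auto)
    finally show "norm ((\<Sum>i\<in>Basis. h i x *\<^sub>R i) - (\<Sum>i\<in>Basis. h i y *\<^sub>R i)) \<le> (DIM('b) * C) * dist x y"
      by (simp add: algebra_simps)
  qed
qed

text \<open>The test class of the bounded Lipschitz (Dudley) metric. Its functions live on the whole
  space, so that translates stay in the class and compositions with Lipschitz maps do so up to a
  factor.\<close>

definition bl_unit :: "('a::metric_space \<Rightarrow> real) set" where
  "bl_unit = {u. (\<forall>x. \<bar>u x\<bar> \<le> 1) \<and> (\<forall>x y. \<bar>u x - u y\<bar> \<le> dist x y)}"

lemma bl_unit_zero: "(\<lambda>_. 0) \<in> bl_unit"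
  unfolding bl_unit_def by simp

lemma bl_unit_continuous: "u \<in> bl_unit \<Longrightarrow> continuous_on S u"
  unfolding bl_unit_def
  by (intro lipschitz_on_continuous_on[of 1] lipschitz_onI) (auto simp: dist_real_def)

lemma bl_unit_measurable: "u \<in> bl_unit \<Longrightarrow> u \<in> borel_measurable borel"
  by (intro borel_measurable_continuous_onI bl_unit_continuous)

text \<open>Indicators of closed sets are pointwise limits of multiples of \<open>bl_unit\<close>
  functions, so both measures agree on closed sets, a generating family stable under
  intersections.\<close>

lemma measure_eq_of_bl_unit:
  fixes M N :: "'a::metric_space measure"
  assumes "prob_space M" "prob_space N" and sM: "sets M = sets borel" and sN: "sets N = sets borel"
    and eq: "\<And>u. u \<in> bl_unit \<Longrightarrow> (\<integral>x. u x \<partial>M) = (\<integral>x. u x \<partial>N)"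
  shows "M = N"
proof -
  interpret M: prob_space M by fact
  interpret N: prob_space N by fact
  have spM: "space M = UNIV" and spN: "space N = UNIV"
    using sets_eq_imp_space_eq[OF sM] sets_eq_imp_space_eq[OF sN] by simp_all
  have ineq: "measure M A = measure N A" if A: "closed A" for A
  proof (cases "A = {}")
    case False
    \<comment> \<open>\<open>w n\<close> is n-Lipschitz with values in [0,1]; dividing by
      \<open>n + 1\<close> rather than \<open>n\<close> puts it into \<open>bl_unit\<close> for n =
      0 as well.\<close>
    define w where "w n x = max 0 (1 - real n * infdist x A)" for n x
    have wint: "(\<integral>x. w n x \<partial>M) = (\<integral>x. w n x \<partial>N)" for n
    proof -
      have "(\<lambda>x. w n x / (real n + 1)) \<in> bl_unit"
        unfolding bl_unit_def
      proof (intro CollectI conjI allI)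
        fix x
        have "0 \<le> w n x" "w n x \<le> 1" unfolding w_def using infdist_nonneg[of x A] by auto
        then show "\<bar>w n x / (real n + 1)\<bar> \<le> 1" by (simp add: divide_simps)
      next
        fix x y
        have "\<bar>w n x - w n y\<bar> \<le> real n * \<bar>infdist x A - infdist y A\<bar>"
        proof -
          have "\<bar>w n x - w n y\<bar> \<le> \<bar>real n * infdist x A - real n * infdist y A\<bar>" unfolding w_def by auto
          also have "\<dots> = real n * \<bar>infdist x A - infdist y A\<bar>"
            by (simp add: abs_mult flip: right_diff_distrib)
          finally show ?thesis .
        qed
        also have "\<bar>infdist x A - infdist y A\<bar> \<le> dist x y" by (rule infdist_triangle_abs)
        finally have "\<bar>w n x - w n y\<bar> \<le> real n * dist x y" by (simp add: mult_left_mono)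
        also have "\<dots> \<le> (real n + 1) * dist x y" by (simp add: mult_right_mono)
        finally have "\<bar>w n x - w n y\<bar> / (real n + 1) \<le> dist x y" by (simp add: field_simps)
        then show "\<bar>w n x / (real n + 1) - w n y / (real n + 1)\<bar> \<le> dist x y"
          by (simp flip: diff_divide_distrib)
      qed
      from eq[OF this] show ?thesis by simp
    qed
    have lim: "(\<lambda>n. w n x) \<longlonglongrightarrow> indicator A x" for x
    proof (cases "x \<in> A")
      case True
      then have "w n x = 1" for n unfolding w_def by simp
      then show ?thesis using True by simp
    next
      case x: False
      have pos: "infdist x A > 0"
        using in_closed_iff_infdist_zero[OF A False, of x] x infdist_nonneg[of x A] by linarith
      obtain n0 :: nat where n0: "1 / infdist x A < n0" using reals_Archimedean2 by blast
      have "w n x = 0" if "n \<ge> n0" for n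
      proof -
        have "1 / infdist x A < real n" using n0 that by linarith
        then have "1 < real n * infdist x A" using pos by (simp add: field_simps)
        then show ?thesis unfolding w_def by simp
      qed
      then show ?thesis using x
        by (intro tendsto_eventually eventually_sequentiallyI[of n0]) simp
    qed
    have wmeas: "w n \<in> borel_measurable borel" for n
      unfolding w_def by (intro borel_measurable_continuous_onI continuous_intros)
    have wb: "norm (w n x) \<le> 1" for n x unfolding w_def using infdist_nonneg[of x A] by auto
    have Am: "A \<in> sets borel" using A by simp
    have lM: "(\<lambda>n. \<integral>x. w n x \<partial>M) \<longlonglongrightarrow> (\<integral>x. indicator A x \<partial>M)"
      by (rule integral_dominated_convergence[where w="\<lambda>_. 1"])
         (use wmeas wb lim Am in \<open>auto simp: measurable_cong_sets[OF sM refl]\<close>)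
    have lN: "(\<lambda>n. \<integral>x. w n x \<partial>N) \<longlonglongrightarrow> (\<integral>x. indicator A x \<partial>N)"
      by (rule integral_dominated_convergence[where w="\<lambda>_. 1"])
         (use wmeas wb lim Am in \<open>auto simp: measurable_cong_sets[OF sN refl]\<close>)
    have "(\<integral>x. indicator A x \<partial>M) = (\<integral>x. indicator A x \<partial>N :: real)"
      using LIMSEQ_unique[OF lM] lN wint by simp
    then show ?thesis by (simp add: spM spN)
  qed simp
  show ?thesis
  proof (rule measure_eqI_generator_eq[where E="Collect closed" and \<Omega>=UNIV and A="\<lambda>_. UNIV"])
    show "Int_stable (Collect closed)" by (auto simp: Int_stable_def)
    show "\<And>X. X \<in> Collect closed \<Longrightarrow> emeasure M X = emeasure N X"
      using ineq by (simp add: M.emeasure_eq_measure N.emeasure_eq_measure)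
    show "sets M = sigma_sets UNIV (Collect closed)" "sets N = sigma_sets UNIV (Collect closed)"
      using sM sN by (simp_all add: borel_eq_closed)
  qed auto
qed

section \<open>A smoothing kernel\<close>

lemma lborel_reflect: "distr lborel borel (\<lambda>z. x - z) = (lborel :: 'a::euclidean_space measure)"
proof -
  have "lborel = density (distr lborel borel (\<lambda>z::'a. x + (-1) *\<^sub>R z)) (\<lambda>_. \<bar>-1::real\<bar>^DIM('a))"
    by (rule lborel_affine) simp
  then show ?thesis by (simp add: density_1)
qed

lemma lborel_integral_reflect:
  fixes g :: "'a::euclidean_space \<Rightarrow> real"
  assumes "g \<in> borel_measurable borel"
  shows "(\<integral>z. g (x - z) \<partial>lborel) = (\<integral>z. g z \<partial>lborel)"
  using integral_distr[of "\<lambda>z. x - z" lborel borel g] assms by (simp add: lborel_reflect)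

lemma lborel_integrable_reflect:
  fixes g :: "'a::euclidean_space \<Rightarrow> real"
  assumes "integrable lborel g"
  shows "integrable lborel (\<lambda>z. g (x - z))"
  using integrable_distr_eq[of "\<lambda>z. x - z" lborel borel g] assms by (simp add: lborel_reflect)

text \<open>The unnormalised smoothing kernel. The square of the truncated paraboloid has compact
  support and a Lipschitz gradient, which is the smoothness behind a quadratic Taylor
  remainder.\<close>

definition bump :: "real \<Rightarrow> 'a::euclidean_space \<Rightarrow> real" where
  "bump e y = (max 0 (e\<^sup>2 - (norm y)\<^sup>2))\<^sup>2"

text \<open>The gradient of \<open>bump e\<close>. It enters through the estimate
  \<open>bump_remainder\<close>, so differentiation itself never occurs.\<close>

definition bump_grad :: "real \<Rightarrow> 'a::euclidean_space \<Rightarrow> 'a" where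
  "bump_grad e y = (- 4 * max 0 (e\<^sup>2 - (norm y)\<^sup>2)) *\<^sub>R y"

lemma bump_outside:
  assumes "0 < e" "e \<le> norm y" shows "bump e y = 0" "bump_grad e y = 0"
proof -
  have "e\<^sup>2 \<le> (norm y)\<^sup>2" using assms by (intro power_mono) auto
  then show "bump e y = 0" "bump_grad e y = 0" unfolding bump_def bump_grad_def by simp_all
qed

lemma bump_pos: "norm y < e \<Longrightarrow> 0 < bump e y"
  unfolding bump_def using power_strict_mono[of "norm y" e 2] by auto

lemma bump_continuous: "continuous_on S (bump e)"
  unfolding bump_def by (intro continuous_intros)

lemma bump_grad_continuous: "continuous_on S (bump_grad e)"
  unfolding bump_grad_def by (intro continuous_intros)

lemma bump_integrable: "0 < e \<Longrightarrow> integrable lborel (bump e :: 'a::euclidean_space \<Rightarrow> real)"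
proof -
  assume e: "0 < e"
  have "integrable lborel (\<lambda>y::'a. indicator (cball 0 e) y *\<^sub>R bump e y)"
    by (intro borel_integrable_compact bump_continuous) auto
  moreover have "indicator (cball 0 e) y *\<^sub>R bump e y = bump e y" for y :: 'a
    using bump_outside[OF e, of y] by (auto split: split_indicator)
  then have "(\<lambda>y::'a. indicator (cball 0 e) y *\<^sub>R bump e y) = bump e" by (rule ext)
  ultimately show ?thesis by simp
qed

text \<open>A vanishing integral would turn the open ball of radius \<open>e\<close>, where
  \<open>bump e\<close> is positive, into a null set.\<close>

lemma bump_integral_pos:
  assumes e: "0 < e" shows "0 < (\<integral>y. bump e y \<partial>(lborel :: 'a::euclidean_space measure))"
proof -
  have "(\<integral>y. bump e y \<partial>(lborel :: 'a measure)) \<noteq> 0"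
  proof
    assume "(\<integral>y. bump e y \<partial>(lborel :: 'a measure)) = 0"
    then have "AE y in (lborel :: 'a measure). bump e y = 0"
      by (subst (asm) integral_nonneg_eq_0_iff_AE[OF bump_integrable[OF e]]) (auto simp: bump_def)
    then have "AE y in (lborel :: 'a measure). y \<notin> ball 0 e"
      using bump_pos by (force elim: eventually_mono)
    then have "ball (0::'a) e \<in> null_sets lborel"
      by (subst (asm) AE_iff_null_sets[symmetric]) auto
    then have "negligible (ball (0::'a) e)"
      by (simp add: negligible_iff_null_sets null_sets_completionI)
    moreover have "\<not> negligible (ball (0::'a) e)" using e by (intro open_not_negligible) auto
    ultimately show False by simp
  qed
  moreover have "0 \<le> (\<integral>y. bump e y \<partial>(lborel :: 'a measure))" by (simp add: bump_def)
  ultimately show ?thesis by simp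
qed

text \<open>The indicator carries the integrability of the remainder: for |w| \<le> 1, both z and z
  + w lie outside the support once z leaves the ball of radius e + 1.\<close>

lemma bump_remainder:
  fixes z w :: "'a::euclidean_space"
  assumes e: "0 < e" and w: "norm w \<le> 1"
  shows "\<bar>bump e (z + w) - bump e z - bump_grad e z \<bullet> w\<bar>
    \<le> ((2*e + 3)\<^sup>2 + 2*e\<^sup>2) * (norm w)\<^sup>2 * indicator (cball 0 (e + 1)) z"
proof (cases "z \<in> cball 0 (e + 1)")
  case False
  then have "e + 1 < norm z" by simp
  moreover have "norm z \<le> norm (z + w) + norm w" using norm_triangle_ineq4[of "z + w" w] by simp
  ultimately have "e \<le> norm (z + w)" "e \<le> norm z" using w by auto
  then show ?thesis using bump_outside[OF e, of z] bump_outside[OF e, of "z + w"] False by simp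
next
  case True
  define p where "p = max 0 (e\<^sup>2 - (norm z)\<^sup>2)"
  define q where "q = max 0 (e\<^sup>2 - (norm (z + w))\<^sup>2)"
  define s where "s = (norm (z + w))\<^sup>2 - (norm z)\<^sup>2"
  have s: "s = 2 * (z \<bullet> w) + (norm w)\<^sup>2"
    unfolding s_def by (simp add: power2_norm_eq_inner inner_add_left inner_add_right inner_commute)
  have "\<bar>s\<bar> \<le> (2*e + 3) * norm w"
  proof -
    have "\<bar>z \<bullet> w\<bar> \<le> norm z * norm w" by (rule Cauchy_Schwarz_ineq2)
    also have "\<dots> \<le> (e + 1) * norm w" using True by (intro mult_right_mono) auto
    finally have 1: "\<bar>z \<bullet> w\<bar> \<le> (e + 1) * norm w" .
    have "(norm w)\<^sup>2 \<le> norm w" using w by (simp add: power2_eq_square mult_left_le_one_le)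
    moreover have "0 \<le> (norm w)\<^sup>2" by simp
    moreover have "(2*e + 3) * norm w = 2 * ((e + 1) * norm w) + norm w" by (simp add: algebra_simps)
    ultimately show ?thesis using 1 unfolding s by linarith
  qed
  then have "\<bar>s\<bar>\<^sup>2 \<le> ((2*e + 3) * norm w)\<^sup>2" by (intro power_mono) auto
  then have s2: "s\<^sup>2 \<le> (2*e + 3)\<^sup>2 * (norm w)\<^sup>2" by (simp add: power_mult_distrib)
  have pe: "0 \<le> p" "p \<le> e\<^sup>2" unfolding p_def by auto
  \<comment> \<open>Taylor's formula for the square of the positive part: the lower bound is
    convexity, the upper bound reflects a second derivative of at most 2. Across the kink it is
    checked by cases.\<close>
  have conv: "0 \<le> q\<^sup>2 - p\<^sup>2 + 2 * p * s \<and> q\<^sup>2 - p\<^sup>2 + 2 * p * s \<le> s\<^sup>2"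
  proof -
    consider "0 \<le> e\<^sup>2 - (norm z)\<^sup>2" "0 \<le> e\<^sup>2 - (norm (z+w))\<^sup>2"
      | "0 \<le> e\<^sup>2 - (norm z)\<^sup>2" "e\<^sup>2 - (norm (z+w))\<^sup>2 \<le> 0"
      | "e\<^sup>2 - (norm z)\<^sup>2 \<le> 0" by linarith
    then show ?thesis
    proof cases
      case 1
      then have "q = p - s" unfolding p_def q_def s_def by auto
      then have "q\<^sup>2 - p\<^sup>2 + 2 * p * s = s\<^sup>2" by algebra
      then show ?thesis by simp
    next
      case 2
      then have q: "q = 0" and ps: "p \<le> s" unfolding p_def q_def s_def by auto
      have "0 \<le> p * (2 * s - p)" using pe ps by (intro mult_nonneg_nonneg) auto
      moreover have "0 \<le> (s - p)\<^sup>2" by simp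
      ultimately show ?thesis unfolding q by (simp add: power2_eq_square algebra_simps)
    next
      case 3
      then have p: "p = 0" unfolding p_def by simp
      have "q \<le> \<bar>s\<bar>" "0 \<le> q" using 3 unfolding q_def s_def by auto
      then have "q\<^sup>2 \<le> \<bar>s\<bar>\<^sup>2" by (intro power_mono) auto
      then show ?thesis unfolding p by simp
    qed
  qed
  \<comment> \<open>Passing from \<open>2 * p * s\<close> to the linear term
    \<open>4 * p * (z \<bullet> w)\<close> costs 2 p |w|^2, which accounts for the summand 2 e^2 of
    the constant.\<close>
  have "bump e (z + w) - bump e z - bump_grad e z \<bullet> w = q\<^sup>2 - p\<^sup>2 + 4 * p * (z \<bullet> w)"
    unfolding bump_def bump_grad_def p_def q_def by simp
  also have "\<dots> = (q\<^sup>2 - p\<^sup>2 + 2 * p * s) - 2 * p * (norm w)\<^sup>2" unfolding s by (simp add: algebra_simps)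
  finally have eq: "bump e (z + w) - bump e z - bump_grad e z \<bullet> w = (q\<^sup>2 - p\<^sup>2 + 2 * p * s) - 2 * p * (norm w)\<^sup>2" .
  have "2 * p * (norm w)\<^sup>2 \<le> 2 * e\<^sup>2 * (norm w)\<^sup>2" "0 \<le> 2 * p * (norm w)\<^sup>2"
    using pe by (auto intro!: mult_right_mono)
  then have "\<bar>bump e (z + w) - bump e z - bump_grad e z \<bullet> w\<bar> \<le> s\<^sup>2 + 2 * e\<^sup>2 * (norm w)\<^sup>2"
    unfolding eq using conv by linarith
  also have "\<dots> \<le> ((2*e + 3)\<^sup>2 + 2*e\<^sup>2) * (norm w)\<^sup>2" using s2 by (simp add: algebra_simps)
  finally show ?thesis using True by simp
qed

lemma bump_grad_bound:
  assumes e: "0 < e"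
  shows "norm (bump_grad e z) \<le> 4 * e^3 * indicator (cball 0 e) z"
proof (cases "z \<in> cball 0 e")
  case True
  have "norm (bump_grad e z) = 4 * max 0 (e\<^sup>2 - (norm z)\<^sup>2) * norm z"
    unfolding bump_grad_def by simp
  also have "\<dots> \<le> 4 * e\<^sup>2 * e" using True e by (intro mult_mono) auto
  finally show ?thesis using True by (simp add: power2_eq_square power3_eq_cube)
next
  case False
  then show ?thesis using bump_outside(2)[OF e, of z] by simp
qed

lemma indicator_cball_reflect_integrable:
  "integrable lborel (\<lambda>z. indicator (cball 0 r) (x - z) :: real)"
  by (intro lborel_integrable_reflect integrable_real_indicator emeasure_lborel_cball_finite) simp

lemma indicator_cball_reflect_integral:
  fixes x :: "'a::euclidean_space"
  shows "(\<integral>z. (indicator (cball 0 r) (x - z) :: real) \<partial>lborel) = (\<integral>z. indicator (cball 0 r) z \<partial>(lborel :: 'a measure))"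
  by (rule lborel_integral_reflect[of "indicator (cball 0 r)" x]) (intro borel_measurable_indicator borel_closed closed_cball)

text \<open>Convolution puts the increment on the kernel. Of \<open>u\<close> only the bound by 1
  enters, so one constant \<open>C\<close>, depending on \<open>e\<close>, serves the whole test
  class.\<close>

theorem mollifier_exists:
  fixes e :: real
  assumes e: "0 < e"
  obtains m :: "'a::euclidean_space measure" and C :: real
  where "prob_space m" "sets m = sets borel" "AE y in m. norm y \<le> e" "0 \<le> C"
    "\<And>u. u \<in> bl_unit \<Longrightarrow> \<exists>G. \<forall>x w.
        \<bar>(\<integral>y. u (x + w - y) \<partial>m) - (\<integral>y. u (x - y) \<partial>m) - G x \<bullet> w\<bar> \<le> C * (norm w)\<^sup>2"
proof -
  define N where "N = (\<integral>y. bump e y \<partial>(lborel :: 'a measure))"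
  have N: "0 < N" unfolding N_def by (rule bump_integral_pos[OF e])
  define m where "m = density (lborel :: 'a measure) (\<lambda>y. ennreal (bump e y / N))"
  have bm [measurable]: "(bump e :: 'a \<Rightarrow> real) \<in> borel_measurable borel" by (intro borel_measurable_continuous_onI bump_continuous)
  have bgm [measurable]: "(bump_grad e :: 'a \<Rightarrow> 'a) \<in> borel_measurable borel" by (intro borel_measurable_continuous_onI bump_grad_continuous)
  have b0: "0 \<le> bump e y" for y :: 'a unfolding bump_def by simp
  have sm: "sets m = sets borel" unfolding m_def by simp
  have pm: "prob_space m"
  proof
    have "emeasure m (space m) = (\<integral>\<^sup>+y. ennreal (bump e y / N) \<partial>(lborel :: 'a measure))"
      unfolding m_def using bm by (subst emeasure_density) auto
    also have "\<dots> = ennreal (\<integral>y. bump e y / N \<partial>(lborel :: 'a measure))"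
      using bump_integrable[OF e] N b0 by (intro nn_integral_eq_integral) auto
    also have "(\<integral>y. bump e y / N \<partial>(lborel :: 'a measure)) = 1" using N unfolding N_def by simp
    finally show "emeasure m (space m) = 1" by simp
  qed
  interpret m: prob_space m by fact
  have AEm: "AE y in m. norm y \<le> e"
  proof -
    have "norm y \<le> e" if "0 < ennreal (bump e y / N)" for y :: 'a
    proof (rule ccontr)
      assume "\<not> norm y \<le> e"
      then have "bump e y = 0" by (intro bump_outside(1)[OF e]) simp
      then show False using that by simp
    qed
    then show ?thesis unfolding m_def by (subst AE_density) (auto intro!: AE_I2)
  qed
  define V where "V = (\<integral>z. indicator (cball 0 (e + 1)) z \<partial>(lborel :: 'a measure) :: real)"
  define V' where "V' = (\<integral>z. indicator (cball 0 e) z \<partial>(lborel :: 'a measure) :: real)"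
  have V0: "0 \<le> V" "0 \<le> V'" unfolding V_def V'_def by simp_all
  define C1 where "C1 = ((2*e + 3)\<^sup>2 + 2*e\<^sup>2) / N * V"
  define C2 where "C2 = 4 * e^3 / N * V'"
  have C0: "0 \<le> C1" "0 \<le> C2" unfolding C1_def C2_def using V0 N e by auto
  show ?thesis
  \<comment> \<open>\<open>C1\<close> comes from the kernel remainder for |w| \<le> 1. For |w| > 1
    nothing is expanded: 2 bounds the difference of two values of the convolution, \<open>C2\<close>
    bounds \<open>G\<close>, and both 1 and |w| are at most |w|^2.\<close>
  proof (rule that[OF pm sm AEm, of "C1 + (2 + C2)"])
    show "0 \<le> C1 + (2 + C2)" using C0 by simp
    fix u :: "'a \<Rightarrow> real" assume u: "u \<in> bl_unit"
    have um [measurable]: "u \<in> borel_measurable borel" by (rule bl_unit_measurable[OF u])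
    have u1: "\<bar>u x\<bar> \<le> 1" for x using u unfolding bl_unit_def by auto
    define ph where "ph x = (\<integral>y. u (x - y) \<partial>m)" for x
    have ph: "ph x = (\<integral>z. u z * (bump e (x - z) / N) \<partial>lborel)" for x
    proof -
      have "ph x = (\<integral>y. (bump e y / N) *\<^sub>R u (x - y) \<partial>lborel)"
        unfolding ph_def m_def using um bm b0 N by (intro integral_density) auto
      also have "\<dots> = (\<integral>z. (bump e (x - z) / N) *\<^sub>R u (x - (x - z)) \<partial>lborel)"
        using um bm by (intro lborel_integral_reflect[symmetric]) auto
      finally show ?thesis by (simp add: mult.commute)
    qed
    have ph1: "\<bar>ph x\<bar> \<le> 1" for x
    proof -
      have "norm (ph x) \<le> (\<integral>y. 1 \<partial>m)" unfolding ph_def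
        by (rule Bochner_Integration.integral_norm_bound_integral)
          (use u1 um in \<open>auto intro!: m.integrable_const_bound[where B=1] simp: measurable_cong_sets[OF sm refl]\<close>)
      then show ?thesis by (simp add: m.prob_space)
    qed
    have ib: "integrable lborel (\<lambda>z. u z * (bump e (x - z) / N))" for x
    proof (rule Bochner_Integration.integrable_bound)
      show "integrable lborel (\<lambda>z. bump e (x - z) / N)"
        by (intro integrable_divide_zero lborel_integrable_reflect bump_integrable[OF e])
      show "AE z in lborel. norm (u z * (bump e (x - z) / N)) \<le> norm (bump e (x - z) / N)"
        using u1 N by (auto intro!: AE_I2 divide_right_mono mult_left_le_one_le simp: abs_mult b0)
    qed (use um bm in auto)
    \<comment> \<open>The gradient of the convolution, with the derivative falling on the
      kernel.\<close>
    define G where "G x = (\<integral>z. (u z / N) *\<^sub>R bump_grad e (x - z) \<partial>lborel)" for x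
    have gb: "norm ((u z / N) *\<^sub>R bump_grad e (x - z)) \<le> 4 * e^3 / N * indicator (cball 0 e) (x - z)" for x z
    proof -
      have "norm ((u z / N) *\<^sub>R bump_grad e (x - z)) = \<bar>u z\<bar> * norm (bump_grad e (x - z)) / N"
        using N by simp
      also have "\<dots> \<le> 1 * (4 * e^3 * indicator (cball 0 e) (x - z)) / N"
        using u1 N by (intro divide_right_mono mult_mono bump_grad_bound[OF e]) auto
      finally show ?thesis by simp
    qed
    have ii: "integrable lborel (\<lambda>z. 4 * e^3 / N * indicator (cball 0 e) (x - z))" for x :: 'a
      by (intro integrable_mult_right indicator_cball_reflect_integrable)
    have ig: "integrable lborel (\<lambda>z. (u z / N) *\<^sub>R bump_grad e (x - z))" for x
    proof (rule Bochner_Integration.integrable_bound[OF ii[of x]])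
      show "AE z in lborel. norm ((u z / N) *\<^sub>R bump_grad e (x - z)) \<le> norm (4 * e^3 / N * indicator (cball 0 e) (x - z))"
        using gb e N by (intro AE_I2) (smt (verit) real_norm_def)
    qed (use um bgm in auto)
    have Gb: "norm (G x) \<le> C2" for x
    proof -
      have "norm (G x) \<le> (\<integral>z. 4 * e^3 / N * indicator (cball 0 e) (x - z) \<partial>lborel)"
        unfolding G_def by (rule Bochner_Integration.integral_norm_bound_integral[OF ig ii gb])
      also have "\<dots> = C2" unfolding C2_def V'_def
        by (simp only: integral_mult_right_zero indicator_cball_reflect_integral)
      finally show ?thesis .
    qed
    show "\<exists>G. \<forall>x w. \<bar>(\<integral>y. u (x + w - y) \<partial>m) - (\<integral>y. u (x - y) \<partial>m) - G x \<bullet> w\<bar> \<le> (C1 + (2 + C2)) * (norm w)\<^sup>2"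
    proof (intro exI[of _ G] allI)
      fix x w
      show "\<bar>(\<integral>y. u (x + w - y) \<partial>m) - (\<integral>y. u (x - y) \<partial>m) - G x \<bullet> w\<bar> \<le> (C1 + (2 + C2)) * (norm w)\<^sup>2"
      proof (cases "norm w \<le> 1")
        case False
        have "1 * norm w \<le> norm w * norm w" using False by (intro mult_right_mono) auto
        then have "norm w \<le> (norm w)\<^sup>2" "1 \<le> (norm w)\<^sup>2"
          using False by (simp_all add: power2_eq_square)
        have "\<bar>G x \<bullet> w\<bar> \<le> C2 * norm w"
          using Cauchy_Schwarz_ineq2[of "G x" w] mult_right_mono[OF Gb[of x] norm_ge_zero[of w]] by linarith
        also have "\<dots> \<le> C2 * (norm w)\<^sup>2" using C0 \<open>norm w \<le> (norm w)\<^sup>2\<close> by (intro mult_left_mono) auto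
        finally have "\<bar>ph (x + w) - ph x - G x \<bullet> w\<bar> \<le> 2 * (norm w)\<^sup>2 + C2 * (norm w)\<^sup>2"
          using ph1[of "x + w"] ph1[of x] \<open>1 \<le> (norm w)\<^sup>2\<close> by linarith
        also have "\<dots> \<le> (C1 + (2 + C2)) * (norm w)\<^sup>2" using C0 by (simp add: distrib_right)
        finally show ?thesis unfolding ph_def .
      next
        case True
        define R where "R z = bump e (x - z + w) - bump e (x - z) - bump_grad e (x - z) \<bullet> w" for z
        have Rb: "norm (u z / N * R z) \<le> ((2*e + 3)\<^sup>2 + 2*e\<^sup>2) / N * (norm w)\<^sup>2 * indicator (cball 0 (e + 1)) (x - z)" for z
        proof -
          have "norm (u z / N * R z) = \<bar>u z\<bar> * \<bar>R z\<bar> / N" using N by (simp add: abs_mult)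
          also have "\<dots> \<le> 1 * (((2*e + 3)\<^sup>2 + 2*e\<^sup>2) * (norm w)\<^sup>2 * indicator (cball 0 (e + 1)) (x - z)) / N"
            unfolding R_def using u1 N by (intro divide_right_mono mult_mono bump_remainder[OF e True]) auto
          finally show ?thesis by simp
        qed
        have i1: "integrable lborel (\<lambda>z. u z * (bump e (x + w - z) / N))" by (rule ib)
        have ig': "integrable lborel (\<lambda>z. ((u z / N) *\<^sub>R bump_grad e (x - z)) \<bullet> w)"
          by (rule integrable_inner_left[OF ig])
        have Gw: "G x \<bullet> w = (\<integral>z. ((u z / N) *\<^sub>R bump_grad e (x - z)) \<bullet> w \<partial>lborel)"
          unfolding G_def by (rule integral_inner_left[OF ig, symmetric])
        have Req: "u z / N * R z = u z * (bump e (x + w - z) / N) - u z * (bump e (x - z) / N) - ((u z / N) *\<^sub>R bump_grad e (x - z)) \<bullet> w" for z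
          unfolding R_def by (simp add: algebra_simps diff_divide_distrib)
        have "ph (x + w) - ph x - G x \<bullet> w = (\<integral>z. u z / N * R z \<partial>lborel)"
          unfolding ph Gw Req using i1 ib[of x] ig' by simp
        also have "norm \<dots> \<le> (\<integral>z. ((2*e + 3)\<^sup>2 + 2*e\<^sup>2) / N * (norm w)\<^sup>2 * indicator (cball 0 (e + 1)) (x - z) \<partial>lborel)"
        proof (rule Bochner_Integration.integral_norm_bound_integral[OF _ _ Rb])
          show "integrable lborel (\<lambda>z. u z / N * R z)" unfolding Req using i1 ib[of x] ig' by simp
        qed (intro integrable_mult_right indicator_cball_reflect_integrable)
        also have "\<dots> = C1 * (norm w)\<^sup>2" unfolding C1_def V_def
          integral_mult_right_zero indicator_cball_reflect_integral by simp
        also have "\<dots> \<le> (C1 + (2 + C2)) * (norm w)\<^sup>2" using C0 by (intro mult_right_mono) auto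
        finally show ?thesis unfolding ph_def by simp
      qed
    qed
  qed
qed

section \<open>Processes with prescribed mean velocity\<close>

lemma norm_integral_le:
  fixes f :: "'w \<Rightarrow> 'b::{banach, second_countable_topology}"
  assumes "f \<in> borel_measurable M" "integrable M g" "\<And>w. w \<in> space M \<Longrightarrow> norm (f w) \<le> g w"
  shows "integrable M f" "norm (\<integral>w. f w \<partial>M) \<le> (\<integral>w. g w \<partial>M)"
proof -
  show i: "integrable M f"
    by (rule Bochner_Integration.integrable_bound[OF assms(2,1)]) (use assms(3) in \<open>force intro!: AE_I2\<close>)
  have "norm (\<integral>w. f w \<partial>M) \<le> (\<integral>w. norm (f w) \<partial>M)" by (rule integral_norm_bound)
  also have "\<dots> \<le> (\<integral>w. g w \<partial>M)" using i assms by (intro integral_mono) auto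
  finally show "norm (\<integral>w. f w \<partial>M) \<le> (\<integral>w. g w \<partial>M)" .
qed

text \<open>\<open>G\<close> is the gradient of \<open>ph\<close>. Both bounds come from a choice of
  the increment: a unit vector along \<open>G x\<close> for the first, a vector of length |x - y|
  along \<open>G x - G y\<close> for the second.\<close>

lemma quadratic_remainder_gradient:
  fixes ph :: "'a::euclidean_space \<Rightarrow> real" and G :: "'a \<Rightarrow> 'a"
  assumes lip: "\<And>x y. \<bar>ph x - ph y\<bar> \<le> dist x y"
    and rem: "\<And>x w. \<bar>ph (x + w) - ph x - G x \<bullet> w\<bar> \<le> C * (norm w)\<^sup>2" and C: "0 \<le> C"
  shows "norm (G x) \<le> 1 + C" "norm (G x - G y) \<le> 6 * C * norm (x - y)"
proof -
  show "norm (G x) \<le> 1 + C" for x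
  proof (cases "G x = 0")
    case False
    define w where "w = G x /\<^sub>R norm (G x)"
    have w: "norm w = 1" unfolding w_def using False by simp
    have "G x \<bullet> w = norm (G x)" unfolding w_def using False
      by (simp add: power2_norm_eq_inner[symmetric] power2_eq_square)
    moreover have "\<bar>ph (x + w) - ph x - G x \<bullet> w\<bar> \<le> C" using rem[of x w] w by simp
    moreover have "\<bar>ph (x + w) - ph x\<bar> \<le> 1" using lip[of "x + w" x] w by (simp add: dist_norm)
    ultimately show ?thesis by linarith
  qed (use C in auto)
  show "norm (G x - G y) \<le> 6 * C * norm (x - y)"
  proof (cases "G x = G y")
    case False
    define h where "h = x - y"
    have h0: "norm h > 0" using False unfolding h_def by auto
    define d where "d = G x - G y"
    have d0: "norm d > 0" using False unfolding d_def by simp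
    define w where "w = (norm h / norm d) *\<^sub>R d"
    have w: "norm w = norm h" unfolding w_def using d0 by simp
    have dw: "d \<bullet> w = norm d * norm h" unfolding w_def using d0
      by (simp add: power2_norm_eq_inner[symmetric] power2_eq_square)
    \<comment> \<open>Three expansions are compared: from x by w, from y by h, and from y by h + w,
      where |h + w| \<le> 2 |h|. Their errors C, C and 4 C times |h|^2 add up to the constant
      6.\<close>
    have 1: "\<bar>ph (x + w) - ph x - G x \<bullet> w\<bar> \<le> C * (norm h)\<^sup>2" using rem[of x w] w by simp
    have 2: "\<bar>ph x - ph y - G y \<bullet> h\<bar> \<le> C * (norm h)\<^sup>2" using rem[of y h] unfolding h_def by simp
    have "norm (h + w) \<le> 2 * norm h" using norm_triangle_ineq[of h w] w by simp
    then have "(norm (h + w))\<^sup>2 \<le> (2 * norm h)\<^sup>2" by (intro power_mono) auto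
    then have "C * (norm (h + w))\<^sup>2 \<le> C * (2 * norm h)\<^sup>2" using C by (intro mult_left_mono)
    then have 3: "\<bar>ph (x + w) - ph y - (G y \<bullet> h + G y \<bullet> w)\<bar> \<le> 4 * (C * (norm h)\<^sup>2)"
      using rem[of y "h + w"] unfolding h_def by (simp add: inner_add_right power_mult_distrib algebra_simps)
    have "d \<bullet> w = G x \<bullet> w - G y \<bullet> w" unfolding d_def by (simp add: inner_diff_left)
    then have "norm d * norm h \<le> 6 * (C * (norm h)\<^sup>2)" using 1 2 3 dw by linarith
    then have "norm d * norm h \<le> (6 * C * norm h) * norm h" by (simp add: power2_eq_square)
    then show ?thesis using h0 unfolding d_def h_def by simp
  qed (use C in auto)
qed

text \<open>
  A process whose velocity \<open>a\<close> has mean \<open>v s y\<close> given the position \<open>y\<close> at time \<open>s\<close>. Both the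
  resolved variables of the full system and the surrogate trajectories are of this kind, with the
  same \<open>v\<close>.
\<close>
locale dominated_process = prob_space M for M :: "'w measure" +
  fixes T :: real and k :: "real \<Rightarrow> real" and Z :: "'w \<Rightarrow> real"
    and x a :: "real \<Rightarrow> 'w \<Rightarrow> 'a::euclidean_space" and v :: "real \<Rightarrow> 'a \<Rightarrow> 'a"
  assumes k_int: "k absolutely_integrable_on {0..T}"
    and k_ge_1: "\<And>s. s \<in> {0..T} \<Longrightarrow> 1 \<le> k s"
    and Z_meas: "Z \<in> borel_measurable M" and Z_sq: "integrable M (\<lambda>w. (Z w)\<^sup>2)"
    and Z_nonneg: "\<And>w. w \<in> space M \<Longrightarrow> 0 \<le> Z w"
    and x_joint: "(\<lambda>(s,w). x s w) \<in> borel_measurable (lebesgue_on {0..T} \<Otimes>\<^sub>M M)"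
    and a_joint: "(\<lambda>(s,w). a s w) \<in> borel_measurable (lebesgue_on {0..T} \<Otimes>\<^sub>M M)"
    and a_dom: "\<And>s w. s \<in> {0..T} \<Longrightarrow> w \<in> space M \<Longrightarrow> norm (a s w) \<le> k s * Z w"
    and path: "\<And>r t w. 0 \<le> r \<Longrightarrow> r \<le> t \<Longrightarrow> t \<le> T \<Longrightarrow> w \<in> space M \<Longrightarrow>
        x t w = x r w + integral {r..t} (\<lambda>s. a s w)"
    and v_meas: "\<And>s. s \<in> {0..T} \<Longrightarrow> v s \<in> borel_measurable borel"
    and v_sq: "\<And>s. s \<in> {0..T} \<Longrightarrow> integrable M (\<lambda>w. (norm (v s (x s w)))\<^sup>2)"
    and v_sq_le: "\<And>s. s \<in> {0..T} \<Longrightarrow>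
        expectation (\<lambda>w. (norm (v s (x s w)))\<^sup>2) \<le> (k s)\<^sup>2 * expectation (\<lambda>w. (Z w)\<^sup>2)"
    and v_mean: "\<And>s \<psi> B. s \<in> {0..T} \<Longrightarrow> \<psi> \<in> borel_measurable borel \<Longrightarrow> (\<And>y. norm (\<psi> y) \<le> B) \<Longrightarrow>
        expectation (\<lambda>w. \<psi> (x s w) \<bullet> a s w) = expectation (\<lambda>w. \<psi> (x s w) \<bullet> v s (x s w))"
begin

lemma x_meas: assumes "s \<in> {0..T}" shows "x s \<in> borel_measurable M"
  using measurable_Pair2[OF x_joint, of s] assms by simp

lemma v_x_meas: assumes "s \<in> {0..T}" shows "(\<lambda>w. v s (x s w)) \<in> borel_measurable M"
  using measurable_compose[OF x_meas v_meas] assms by simp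

lemma a_path_integrable:
  assumes rt: "0 \<le> r" "t \<le> T" and w: "w \<in> space M"
  shows "(\<lambda>s. a s w) absolutely_integrable_on {r..t}"
proof -
  have m: "(\<lambda>s. a s w) \<in> borel_measurable (lebesgue_on {0..T})"
    using measurable_Pair1[OF a_joint w] by simp
  have "integrable (lebesgue_on {0..T}) (\<lambda>s. k s * Z w)"
    using absolutely_integrable_imp_integrable[OF k_int] by simp
  from norm_integral_le(1)[OF m this] have "integrable (lebesgue_on {0..T}) (\<lambda>s. a s w)"
    using a_dom w by simp
  then have "(\<lambda>s. a s w) absolutely_integrable_on {0..T}"
    unfolding set_integrable_def by (subst (asm) integrable_restrict_space) auto
  then show ?thesis by (rule abs_int_subinterval[OF _ rt])
qed

lemma k_integrable_on: assumes "0 \<le> r" "t \<le> T" shows "k integrable_on {r..t}"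
  by (rule abs_int_subinterval_on[OF k_int assms])

lemma increment_le:
  assumes rt: "0 \<le> r" "r \<le> t" "t \<le> T" and w: "w \<in> space M"
  shows "norm (x t w - x r w) \<le> integral {r..t} k * Z w"
proof -
  have "x t w - x r w = integral {r..t} (\<lambda>s. a s w)" using path[OF rt w] by simp
  also have "norm \<dots> \<le> integral {r..t} (\<lambda>s. k s * Z w)"
    by (rule Henstock_Kurzweil_Integration.integral_norm_bound_integral)
       (use a_path_integrable[OF rt(1,3) w] set_lebesgue_integral_eq_integral(1) k_integrable_on[OF rt(1,3)] a_dom w rt
        in \<open>auto intro!: integrable_on_mult_left\<close>)
  finally show ?thesis by simp
qed

lemma k_integral_nonneg: assumes rt: "0 \<le> r" "t \<le> T" shows "0 \<le> integral {r..t} k"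
proof (rule Henstock_Kurzweil_Integration.integral_nonneg[OF k_integrable_on[OF rt]])
  fix s assume "s \<in> {r..t}"
  then show "0 \<le> k s" using k_ge_1[of s] rt by simp
qed

lemma k_integral_mono:
  assumes "0 \<le> r" "r \<le> p" "p \<le> q" "q \<le> t" "t \<le> T"
  shows "integral {p..q} k \<le> integral {r..t} k"
proof (rule integral_subset_le)
  show "\<forall>s\<in>{r..t}. 0 \<le> k s"
  proof
    fix s assume "s \<in> {r..t}"
    then show "0 \<le> k s" using k_ge_1[of s] assms by simp
  qed
qed (use assms k_integrable_on in auto)

abbreviation D :: real where "D \<equiv> expectation (\<lambda>w. (Z w)\<^sup>2)"

lemma D_nonneg: "0 \<le> D" by simp

lemma Z_int: "integrable M Z" and Z_mean_le: "expectation Z \<le> 1 + D"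
proof -
  have i: "integrable M (\<lambda>w. 1 + (Z w)\<^sup>2)" using Z_sq by simp
  have b: "norm (Z w) \<le> 1 + (Z w)\<^sup>2" if "w \<in> space M" for w
    using le_one_plus_sq[of "Z w"] Z_nonneg[OF that] by simp
  show "integrable M Z" by (rule norm_integral_le(1)[OF Z_meas i b])
  have "norm (expectation Z) \<le> expectation (\<lambda>w. 1 + (Z w)\<^sup>2)" by (rule norm_integral_le(2)[OF Z_meas i b])
  also have "\<dots> = 1 + D" using Z_sq by (simp add: prob_space)
  finally show "expectation Z \<le> 1 + D" by simp
qed

lemma v_int: assumes s: "s \<in> {0..T}"
  shows "integrable M (\<lambda>w. norm (v s (x s w)))" "expectation (\<lambda>w. norm (v s (x s w))) \<le> k s * (1 + D)"
proof -
  have k: "1 \<le> k s" using k_ge_1[OF s] .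
  \<comment> \<open>The majorant uses z \<le> k + z^2 / k for z \<ge> 0. Compared with 1 + z^2 this
    scaling keeps the mean linear in \<open>k s\<close>, and it is \<open>k\<close> that is
    integrable in time.\<close>
  have i: "integrable M (\<lambda>w. k s + (norm (v s (x s w)))\<^sup>2 / k s)" using v_sq[OF s] by simp
  have m: "(\<lambda>w. norm (v s (x s w))) \<in> borel_measurable M" using v_x_meas[OF s] by simp
  have b: "norm (norm (v s (x s w))) \<le> k s + (norm (v s (x s w)))\<^sup>2 / k s" for w
  proof (cases "norm (v s (x s w)) \<le> k s")
    case True
    moreover have "0 \<le> (norm (v s (x s w)))\<^sup>2 / k s" using k by simp
    ultimately show ?thesis by simp
  next
    case False
    then have "norm (v s (x s w)) * k s \<le> norm (v s (x s w)) * norm (v s (x s w))"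
      by (intro mult_left_mono) auto
    then have "norm (v s (x s w)) \<le> (norm (v s (x s w)))\<^sup>2 / k s" using k by (simp add: field_simps power2_eq_square)
    then show ?thesis using k by simp
  qed
  show "integrable M (\<lambda>w. norm (v s (x s w)))" by (rule norm_integral_le(1)[OF m i b])
  have "expectation (\<lambda>w. norm (v s (x s w))) \<le> norm (expectation (\<lambda>w. norm (v s (x s w))))" by simp
  also have "\<dots> \<le> expectation (\<lambda>w. k s + (norm (v s (x s w)))\<^sup>2 / k s)" by (rule norm_integral_le(2)[OF m i b])
  also have "\<dots> = k s + expectation (\<lambda>w. (norm (v s (x s w)))\<^sup>2) / k s" using v_sq[OF s] by (simp add: prob_space)
  also have "\<dots> \<le> k s + ((k s)\<^sup>2 * D) / k s"
    using v_sq_le[OF s] k by (intro add_left_mono divide_right_mono) auto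
  also have "\<dots> = k s * (1 + D)" using k by (simp add: power2_eq_square distrib_left)
  finally show "expectation (\<lambda>w. norm (v s (x s w))) \<le> k s * (1 + D)" .
qed

lemma bl_int: assumes "u \<in> bl_unit" "f \<in> borel_measurable M"
  shows "integrable M (\<lambda>w. u (f w))"
proof (rule integrable_const_bound[where B=1])
  show "AE w in M. norm (u (f w)) \<le> 1" using assms(1) unfolding bl_unit_def by simp
  show "(\<lambda>w. u (f w)) \<in> borel_measurable M"
    using measurable_compose[OF assms(2) bl_unit_measurable[OF assms(1)]] .
qed

text \<open>The bound is uniform in \<open>u\<close>, so a test function chosen at one time loses
  little when it is used at a nearby time.\<close>

lemma bl_increment:
  assumes rt: "0 \<le> r" "r \<le> t" "t \<le> T" and u: "u \<in> bl_unit"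
  shows "\<bar>expectation (\<lambda>w. u (x t w)) - expectation (\<lambda>w. u (x r w))\<bar> \<le> (1 + D) * integral {r..t} k"
proof -
  have xt: "x t \<in> borel_measurable M" "x r \<in> borel_measurable M" using x_meas rt by auto
  have i: "integrable M (\<lambda>w. u (x t w))" "integrable M (\<lambda>w. u (x r w))" using bl_int[OF u] xt by auto
  have "expectation (\<lambda>w. u (x t w)) - expectation (\<lambda>w. u (x r w)) = expectation (\<lambda>w. u (x t w) - u (x r w))"
    using i by simp
  also have "norm \<dots> \<le> expectation (\<lambda>w. integral {r..t} k * Z w)"
  proof (rule norm_integral_le(2))
    show "norm (u (x t w) - u (x r w)) \<le> integral {r..t} k * Z w" if "w \<in> space M" for w
    proof -
      have "norm (u (x t w) - u (x r w)) \<le> dist (x t w) (x r w)" using u unfolding bl_unit_def by auto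
      then show ?thesis using increment_le[OF rt that] by (simp add: dist_norm)
    qed
  qed (use i Z_int in auto)
  also have "\<dots> = integral {r..t} k * expectation Z" by simp
  also have "\<dots> \<le> integral {r..t} k * (1 + D)"
    using k_integral_nonneg[OF rt(1,3)] Z_mean_le by (intro mult_left_mono) auto
  finally show ?thesis by (simp add: mult.commute)
qed

section \<open>Weak form of the continuity equation\<close>

context
  fixes ph :: "'a \<Rightarrow> real" and G :: "'a \<Rightarrow> 'a" and C :: real
  assumes ph: "ph \<in> bl_unit" and C: "0 \<le> C"
    and rem: "\<And>x w. \<bar>ph (x + w) - ph x - G x \<bullet> w\<bar> \<le> C * (norm w)\<^sup>2"
begin

lemma ph_lip: "\<bar>ph y - ph z\<bar> \<le> dist y z" using ph unfolding bl_unit_def by auto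

lemmas G_bound = quadratic_remainder_gradient(1)[OF ph_lip rem C]
lemmas G_lip = quadratic_remainder_gradient(2)[OF ph_lip rem C]

lemma G_meas: "G \<in> borel_measurable borel"
  using G_lip C by (intro borel_measurable_continuous_onI lipschitz_on_continuous_on[of "6 * C"] lipschitz_onI)
    (auto simp: dist_norm)

text \<open>Two estimates of one Euler step: the Lipschitz bounds give an error of order h k, the
  quadratic remainder one of order h^2 k^2. The minimum, divided by h, is dominated by a multiple of
  \<open>k\<close> and still vanishes as h tends to 0 at every fixed time.\<close>

lemma first_order:
  assumes s: "s \<in> {0..T}" and h: "0 < h" "h \<le> 1"
  shows "\<bar>expectation (\<lambda>w. ph (x s w + h *\<^sub>R v s (x s w))) - expectation (\<lambda>w. ph (x s w))
      - h * expectation (\<lambda>w. G (x s w) \<bullet> v s (x s w))\<bar> \<le> (2 + C) * (1 + D) * h * min (k s) (h * (k s)\<^sup>2)"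
proof -
  note [measurable] = x_meas[OF s] v_x_meas[OF s] G_meas bl_unit_measurable[OF ph]
  let ?n = "\<lambda>w. norm (v s (x s w))"
  let ?R = "\<lambda>w. ph (x s w + h *\<^sub>R v s (x s w)) - ph (x s w) - h * (G (x s w) \<bullet> v s (x s w))"
  have Gv: "\<bar>G (x s w) \<bullet> v s (x s w)\<bar> \<le> (1 + C) * ?n w" for w
    using Cauchy_Schwarz_ineq2[of "G (x s w)" "v s (x s w)"]
      mult_right_mono[OF G_bound[of "x s w"] norm_ge_zero[of "v s (x s w)"]] by simp
  have iG: "integrable M (\<lambda>w. G (x s w) \<bullet> v s (x s w))"
  proof (rule norm_integral_le(1))
    show "integrable M (\<lambda>w. (1 + C) * ?n w)" using v_int(1)[OF s] by simp
    show "norm (G (x s w) \<bullet> v s (x s w)) \<le> (1 + C) * ?n w" for w using Gv[of w] by simp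
  qed measurable
  have i: "integrable M (\<lambda>w. ph (x s w + h *\<^sub>R v s (x s w)))" "integrable M (\<lambda>w. ph (x s w))"
    by (intro bl_int[OF ph]; measurable)+
  have eq: "expectation (\<lambda>w. ph (x s w + h *\<^sub>R v s (x s w))) - expectation (\<lambda>w. ph (x s w))
      - h * expectation (\<lambda>w. G (x s w) \<bullet> v s (x s w)) = expectation ?R"
    using i iG by simp
  \<comment> \<open>The factor 2 + C collects 1 from the Lipschitz bound for \<open>ph\<close> and 1
    + C from the bound for \<open>G\<close>.\<close>
  have b1: "norm (?R w) \<le> (2 + C) * h * ?n w" for w
  proof -
    have "\<bar>ph (x s w + h *\<^sub>R v s (x s w)) - ph (x s w)\<bar> \<le> h * ?n w"
      using ph_lip[of "x s w + h *\<^sub>R v s (x s w)" "x s w"] h by (simp add: dist_norm)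
    moreover have "\<bar>h * (G (x s w) \<bullet> v s (x s w))\<bar> \<le> h * ((1 + C) * ?n w)"
      using mult_left_mono[OF Gv[of w], of h] h by (simp add: abs_mult)
    ultimately show ?thesis by (simp add: algebra_simps abs_le_iff)
  qed
  have b2: "norm (?R w) \<le> C * h\<^sup>2 * (?n w)\<^sup>2" for w
    using rem[of "x s w" "h *\<^sub>R v s (x s w)"] h by (simp add: power_mult_distrib)
  have m: "?R \<in> borel_measurable M" by measurable
  have k: "1 \<le> k s" by (rule k_ge_1[OF s])
  have "norm (expectation ?R) \<le> expectation (\<lambda>w. (2 + C) * h * ?n w)"
    by (rule norm_integral_le(2)[OF m _ b1]) (use v_int(1)[OF s] in simp)
  also have "\<dots> = (2 + C) * h * expectation ?n" by simp
  also have "\<dots> \<le> (2 + C) * h * (k s * (1 + D))" using v_int(2)[OF s] C h by (intro mult_left_mono) auto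
  finally have e1: "norm (expectation ?R) \<le> (2 + C) * (1 + D) * h * k s" by (simp add: mult_ac)
  have "norm (expectation ?R) \<le> expectation (\<lambda>w. C * h\<^sup>2 * (?n w)\<^sup>2)"
    by (rule norm_integral_le(2)[OF m _ b2]) (use v_sq[OF s] in simp)
  also have "\<dots> = C * h\<^sup>2 * expectation (\<lambda>w. (?n w)\<^sup>2)" by simp
  also have "\<dots> \<le> C * h\<^sup>2 * ((k s)\<^sup>2 * D)" using v_sq_le[OF s] C h by (intro mult_left_mono) auto
  also have "\<dots> \<le> (2 + C) * h\<^sup>2 * ((k s)\<^sup>2 * (1 + D))"
    using C by (intro mult_mono) (auto simp: D_nonneg)
  finally have e2: "norm (expectation ?R) \<le> (2 + C) * (1 + D) * h * (h * (k s)\<^sup>2)"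
    by (simp add: mult_ac power2_eq_square)
  show ?thesis unfolding eq using e1 e2 by (simp add: min_def)
qed

text \<open>Under the expectation \<open>v_mean\<close> replaces the velocity \<open>a\<close> by
  the field \<open>v\<close>. The expansion is made at the left end \<open>r\<close> only, which
  leaves an error quadratic in the integral of \<open>k\<close>; it disappears after summation over
  fine partitions.\<close>

lemma weak_equation:
  defines "g \<equiv> \<lambda>s. expectation (\<lambda>w. G (x s w) \<bullet> v s (x s w))"
  assumes rt: "0 \<le> r" "r \<le> t" "t \<le> T"
  shows "g integrable_on {r..t}"
    "\<bar>expectation (\<lambda>w. ph (x t w)) - expectation (\<lambda>w. ph (x r w)) - integral {r..t} g\<bar>
      \<le> 7 * C * D * (integral {r..t} k)\<^sup>2"
proof -
  let ?L = "lebesgue_on {r..t}"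
  let ?I = "integral {r..t} k"
  have lm: "{r..t} \<in> sets lebesgue" by simp
  have "finite_measure ?L" by (rule finite_measure_lebesgue_on) simp
  then interpret L: finite_measure ?L .
  interpret LM: pair_sigma_finite ?L M ..
  have sub: "(\<lambda>p. p) \<in> ?L \<Otimes>\<^sub>M M \<rightarrow>\<^sub>M lebesgue_on {0..T} \<Otimes>\<^sub>M M"
  proof -
    have "(\<lambda>s. s) \<in> ?L \<rightarrow>\<^sub>M lebesgue_on {0..T}"
      by (rule measurable_restrict_mono[of _ _ "{0..T}"]) (use rt in auto)
    then have "(\<lambda>p. (fst p, snd p)) \<in> ?L \<Otimes>\<^sub>M M \<rightarrow>\<^sub>M lebesgue_on {0..T} \<Otimes>\<^sub>M M"
      by (intro measurable_Pair measurable_snd measurable_compose[OF measurable_fst])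
    then show ?thesis by simp
  qed
  have xj: "(\<lambda>(s,w). x s w) \<in> borel_measurable (?L \<Otimes>\<^sub>M M)" using measurable_compose[OF sub x_joint] .
  have aj: "(\<lambda>(s,w). a s w) \<in> borel_measurable (?L \<Otimes>\<^sub>M M)" using measurable_compose[OF sub a_joint] .
  define H where "H s w = G (x s w) \<bullet> a s w" for s w
  have Hm: "case_prod H \<in> borel_measurable (?L \<Otimes>\<^sub>M M)"
    using borel_measurable_inner[OF measurable_compose[OF xj G_meas] aj] unfolding H_def by (simp add: split_beta')
  have kL: "integrable ?L k"
    by (rule absolutely_integrable_imp_integrable[OF abs_int_subinterval[OF k_int rt(1,3)] lm])
  have dom: "integrable (?L \<Otimes>\<^sub>M M) (\<lambda>(s,w). (1 + C) * (k s * Z w))"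
  proof (rule LM.Fubini_integrable)
    show "(\<lambda>(s, w). (1 + C) * (k s * Z w)) \<in> borel_measurable (?L \<Otimes>\<^sub>M M)"
      using kL Z_meas by measurable
    show "integrable ?L (\<lambda>s. \<integral>w. norm (case (s, w) of (s, w) \<Rightarrow> (1 + C) * (k s * Z w)) \<partial>M)"
      using kL by (simp add: abs_mult)
    show "AE s in ?L. integrable M (\<lambda>w. case (s, w) of (s, w) \<Rightarrow> (1 + C) * (k s * Z w))"
      using Z_int by simp
  qed
  have Hb: "\<bar>H s w\<bar> \<le> (1 + C) * (k s * Z w)" if "s \<in> {r..t}" "w \<in> space M" for s w
  proof -
    have "\<bar>H s w\<bar> \<le> norm (G (x s w)) * norm (a s w)" unfolding H_def by (rule Cauchy_Schwarz_ineq2)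
    also have "\<dots> \<le> (1 + C) * (k s * Z w)"
      using G_bound a_dom[of s w] that rt C by (intro mult_mono) auto
    finally show ?thesis .
  qed
  have Hi: "integrable (?L \<Otimes>\<^sub>M M) (case_prod H)"
    by (rule norm_integral_le(1)[OF Hm dom]) (use Hb in \<open>auto simp: space_pair_measure\<close>)
  \<comment> \<open>\<open>G\<close> is bounded and Borel, so it is admissible in
    \<open>v_mean\<close>.\<close>
  have gH: "g s = expectation (H s)" if "s \<in> {r..t}" for s
    unfolding g_def H_def by (rule v_mean[OF _ G_meas G_bound, symmetric]) (use that rt in auto)
  have gi: "integrable ?L (\<lambda>s. expectation (H s))" using LM.integrable_fst[OF Hi] .
  then have "(\<lambda>s. expectation (H s)) integrable_on {r..t}" using integrable_on_lebesgue_on[OF _ lm] by blast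
  then show "g integrable_on {r..t}" using gH by (subst integrable_cong) auto
  have "integral {r..t} g = integral {r..t} (\<lambda>s. expectation (H s))"
    using gH by (intro Henstock_Kurzweil_Integration.integral_cong) auto
  also have "\<dots> = (\<integral>s. expectation (H s) \<partial>?L)" by (rule lebesgue_integral_eq_integral[OF gi lm, symmetric])
  also have "\<dots> = expectation (\<lambda>w. \<integral>s. H s w \<partial>?L)"
    using LM.Fubini_integral[OF Hi] by simp
  finally have ig: "integral {r..t} g = expectation (\<lambda>w. \<integral>s. H s w \<partial>?L)" .
  have iH: "integrable M (\<lambda>w. \<integral>s. H s w \<partial>?L)" using LM.integrable_snd[OF Hi] .
  have i: "integrable M (\<lambda>w. ph (x t w))" "integrable M (\<lambda>w. ph (x r w))"
    using bl_int[OF ph] x_meas rt by auto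
  have "expectation (\<lambda>w. ph (x t w)) - expectation (\<lambda>w. ph (x r w)) - integral {r..t} g
      = expectation (\<lambda>w. ph (x t w) - ph (x r w) - (\<integral>s. H s w \<partial>?L))"
    unfolding ig using i iH by simp
  also have "norm \<dots> \<le> expectation (\<lambda>w. 7 * C * ?I\<^sup>2 * (Z w)\<^sup>2)"
  proof (rule norm_integral_le(2))
    show "(\<lambda>w. ph (x t w) - ph (x r w) - (\<integral>s. H s w \<partial>?L)) \<in> borel_measurable M"
      using i iH by auto
    show "integrable M (\<lambda>w. 7 * C * ?I\<^sup>2 * (Z w)\<^sup>2)" using Z_sq by simp
    fix w assume w: "w \<in> space M"
    have ai: "integrable ?L (\<lambda>s. a s w)"
      using absolutely_integrable_imp_integrable[OF a_path_integrable[OF rt(1,3) w] lm] .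
    have "x t w - x r w = (\<integral>s. a s w \<partial>?L)"
      using path[OF rt w] lebesgue_integral_eq_integral[OF ai lm] by simp
    then have Ga: "G (x r w) \<bullet> (x t w - x r w) = (\<integral>s. G (x r w) \<bullet> a s w \<partial>?L)"
      using ai by simp
    have Hsm: "(\<lambda>s. H s w) \<in> borel_measurable ?L" using measurable_Pair1[OF Hm w] by simp
    have Hsi: "integrable ?L (\<lambda>s. H s w)"
      by (rule norm_integral_le(1)[OF Hsm, of "\<lambda>s. (1 + C) * (k s * Z w)"]) (use kL Hb w in auto)
    \<comment> \<open>The gradient is frozen at time \<open>r\<close>: by \<open>G_lip\<close> and
      \<open>increment_le\<close> this costs 6 C times the square of \<open>?I * Z w\<close>. The
      Taylor remainder treated afterwards raises 6 to 7.\<close>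
    have "G (x r w) \<bullet> (x t w - x r w) - (\<integral>s. H s w \<partial>?L) = (\<integral>s. (G (x r w) \<bullet> a s w - H s w) \<partial>?L)"
      unfolding Ga using ai Hsi by simp
    also have "norm \<dots> \<le> (\<integral>s. 6 * C * (?I * Z w) * (k s * Z w) \<partial>?L)"
    proof (rule norm_integral_le(2))
      show "(\<lambda>s. G (x r w) \<bullet> a s w - H s w) \<in> borel_measurable ?L" using ai Hsm by measurable
      show "integrable ?L (\<lambda>s. 6 * C * (?I * Z w) * (k s * Z w))" using kL by simp
      fix s assume "s \<in> space ?L"
      then have s: "s \<in> {r..t}" by simp
      have "norm (x r w - x s w) \<le> integral {r..s} k * Z w"
        using increment_le[of r s w] s rt w by (simp add: norm_minus_commute)
      also have "integral {r..s} k \<le> ?I" using k_integral_mono[of r r s t] s rt by simp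
      finally have xs: "norm (x r w - x s w) \<le> ?I * Z w" using Z_nonneg[OF w] by (simp add: mult_right_mono)
      have "norm (G (x r w) \<bullet> a s w - H s w) = \<bar>(G (x r w) - G (x s w)) \<bullet> a s w\<bar>"
        unfolding H_def by (simp add: inner_diff_left)
      also have "\<dots> \<le> norm (G (x r w) - G (x s w)) * norm (a s w)" by (rule Cauchy_Schwarz_ineq2)
      also have "\<dots> \<le> (6 * C * (?I * Z w)) * (k s * Z w)"
      proof (rule mult_mono)
        have "norm (G (x r w) - G (x s w)) \<le> 6 * C * norm (x r w - x s w)" by (rule G_lip)
        also have "\<dots> \<le> 6 * C * (?I * Z w)" using xs C by (intro mult_left_mono) auto
        finally show "norm (G (x r w) - G (x s w)) \<le> 6 * C * (?I * Z w)" .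
        show "norm (a s w) \<le> k s * Z w" using a_dom s rt w by auto
        show "0 \<le> 6 * C * (?I * Z w)" using C k_integral_nonneg[OF rt(1,3)] Z_nonneg[OF w] by simp
      qed simp
      finally show "norm (G (x r w) \<bullet> a s w - H s w) \<le> 6 * C * (?I * Z w) * (k s * Z w)" .
    qed
    also have "\<dots> = 6 * C * ?I\<^sup>2 * (Z w)\<^sup>2"
      using lebesgue_integral_eq_integral[OF kL lm] by (simp add: power2_eq_square)
    finally have 1: "\<bar>G (x r w) \<bullet> (x t w - x r w) - (\<integral>s. H s w \<partial>?L)\<bar> \<le> 6 * C * ?I\<^sup>2 * (Z w)\<^sup>2" by simp
    have "\<bar>ph (x t w) - ph (x r w) - G (x r w) \<bullet> (x t w - x r w)\<bar> \<le> C * (norm (x t w - x r w))\<^sup>2"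
      using rem[of "x r w" "x t w - x r w"] by simp
    also have "\<dots> \<le> C * (?I * Z w)\<^sup>2"
      using increment_le[OF rt w] C by (intro mult_left_mono power_mono) auto
    finally have 2: "\<bar>ph (x t w) - ph (x r w) - G (x r w) \<bullet> (x t w - x r w)\<bar> \<le> C * ?I\<^sup>2 * (Z w)\<^sup>2"
      by (simp add: power_mult_distrib)
    show "norm (ph (x t w) - ph (x r w) - (\<integral>s. H s w \<partial>?L)) \<le> 7 * C * ?I\<^sup>2 * (Z w)\<^sup>2"
      using 1 2 by simp
  qed
  also have "\<dots> = 7 * C * D * ?I\<^sup>2" by simp
  finally show "\<bar>expectation (\<lambda>w. ph (x t w)) - expectation (\<lambda>w. ph (x r w)) - integral {r..t} g\<bar>
      \<le> 7 * C * D * ?I\<^sup>2" by simp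
qed

end

end

section \<open>Uniqueness of the law\<close>

locale two_dominated_processes =
  A: dominated_process M1 T k Z1 x a v + B: dominated_process M2 T k Z2 y b v
  for M1 :: "'w measure" and M2 :: "'v measure" and T :: real and k :: "real \<Rightarrow> real"
    and Z1 :: "'w \<Rightarrow> real" and Z2 :: "'v \<Rightarrow> real"
    and x a :: "real \<Rightarrow> 'w \<Rightarrow> 'a::euclidean_space" and y b :: "real \<Rightarrow> 'v \<Rightarrow> 'a"
    and v :: "real \<Rightarrow> 'a \<Rightarrow> 'a" +
  assumes v_lip: "\<And>s p q. s \<in> {0..T} \<Longrightarrow> norm (v s p - v s q) \<le> k s * dist p q"
begin

definition gap :: "('a \<Rightarrow> real) \<Rightarrow> real \<Rightarrow> real" where
  "gap u s = (\<integral>w. u (x s w) \<partial>M1) - (\<integral>w. u (y s w) \<partial>M2)"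

lemma gap_le_2:
  assumes "u \<in> bl_unit" "s \<in> {0..T}"
  shows "gap u s \<le> 2"
proof -
  have u: "\<And>p. \<bar>u p\<bar> \<le> 1" using assms(1) unfolding bl_unit_def by auto
  have "norm (\<integral>w. u (x s w) \<partial>M1) \<le> (\<integral>w. 1 \<partial>M1)"
    using A.bl_int[OF assms(1) A.x_meas[OF assms(2)]] u by (intro norm_integral_le(2)) auto
  moreover have "norm (\<integral>w. u (y s w) \<partial>M2) \<le> (\<integral>w. 1 \<partial>M2)"
    using B.bl_int[OF assms(1) B.x_meas[OF assms(2)]] u by (intro norm_integral_le(2)) auto
  ultimately show ?thesis unfolding gap_def by (simp add: A.prob_space B.prob_space)
qed

text \<open>The bounded Lipschitz distance of the two laws at time \<open>s\<close>. The absolute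
  value is implicit, since \<open>bl_unit\<close> is closed under negation.\<close>

definition bl_gap :: "real \<Rightarrow> real" where
  "bl_gap s = (SUP u\<in>bl_unit. gap u s)"

lemma gap_le_bl_gap: "u \<in> bl_unit \<Longrightarrow> s \<in> {0..T} \<Longrightarrow> gap u s \<le> bl_gap s"
  unfolding bl_gap_def using gap_le_2 by (intro cSUP_upper bdd_aboveI2[where M=2]) auto

lemma bl_gap_le: "(\<And>u. u \<in> bl_unit \<Longrightarrow> gap u s \<le> c) \<Longrightarrow> bl_gap s \<le> c"
  unfolding bl_gap_def using bl_unit_zero by (intro cSUP_least) auto

lemma bl_gap_bounds: assumes "s \<in> {0..T}" shows "0 \<le> bl_gap s" "bl_gap s \<le> 2"
proof -
  have "gap (\<lambda>_. 0) s = 0" unfolding gap_def by simp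
  then show "0 \<le> bl_gap s" using gap_le_bl_gap[OF bl_unit_zero assms] by simp
  show "bl_gap s \<le> 2" by (rule bl_gap_le) (rule gap_le_2[OF _ assms])
qed

text \<open>The sum of the constants \<open>1 + A.D\<close> and \<open>1 + B.D\<close> in the
  estimates of the two processes.\<close>

definition dom_const :: real where "dom_const = 2 + A.D + B.D"

lemma dom_const_nonneg: "0 \<le> dom_const"
  unfolding dom_const_def using A.D_nonneg B.D_nonneg by linarith

lemma gap_increment:
  assumes "0 \<le> r" "r \<le> t" "t \<le> T" "u \<in> bl_unit"
  shows "\<bar>gap u t - gap u r\<bar> \<le> dom_const * integral {r..t} k"
  using A.bl_increment[OF assms] B.bl_increment[OF assms]
  unfolding gap_def dom_const_def by (simp add: algebra_simps abs_le_iff)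

text \<open>The time profile of the Euler error in \<open>first_order\<close>, after division by
  \<open>h\<close>.\<close>

definition trunc :: "real \<Rightarrow> real \<Rightarrow> real" where
  "trunc h s = min (k s) (h * (k s)\<^sup>2)"

lemma trunc_bounds: "0 < h \<Longrightarrow> s \<in> {0..T} \<Longrightarrow> 0 \<le> trunc h s \<and> trunc h s \<le> k s"
  using A.k_ge_1[of s] unfolding trunc_def by auto

lemma k_lebesgue: "integrable (lebesgue_on {0..T}) k"
  using absolutely_integrable_imp_integrable[OF A.k_int] by simp

lemma trunc_lebesgue: assumes "0 < h" shows "integrable (lebesgue_on {0..T}) (trunc h)"
proof (rule norm_integral_le(1)[OF _ k_lebesgue])
  show "trunc h \<in> borel_measurable (lebesgue_on {0..T})"
    unfolding trunc_def using k_lebesgue by measurable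
qed (use trunc_bounds[OF assms] in auto)

lemma trunc_abs_int: assumes "0 < h" shows "trunc h absolutely_integrable_on {0..T}"
  using trunc_lebesgue[OF assms] unfolding set_integrable_def
  by (subst (asm) integrable_restrict_space) auto

text \<open>Dominated convergence with majorant \<open>k\<close>; at fixed \<open>s\<close> the
  branch \<open>h * (k s)^2\<close> tends to 0.\<close>

lemma trunc_integral_tendsto_0: "(\<lambda>n. integral {0..T} (trunc (1 / real (Suc n)))) \<longlonglongrightarrow> 0"
proof -
  have "(\<lambda>n. \<integral>s. trunc (1 / real (Suc n)) s \<partial>lebesgue_on {0..T}) \<longlonglongrightarrow> (\<integral>s. 0 \<partial>lebesgue_on {0..T})"
  proof (rule integral_dominated_convergence[where w=k])
    show "AE s in lebesgue_on {0..T}. (\<lambda>n. trunc (1 / real (Suc n)) s) \<longlonglongrightarrow> 0"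
    proof (rule AE_I2)
      fix s assume "s \<in> space (lebesgue_on {0..T})"
      then have s: "s \<in> {0..T}" by simp
      show "(\<lambda>n. trunc (1 / real (Suc n)) s) \<longlonglongrightarrow> 0"
      proof (rule tendsto_sandwich[where f="\<lambda>_. 0" and h="\<lambda>n. 1 / real (Suc n) * (k s)\<^sup>2"])
        have "(\<lambda>n. (k s)\<^sup>2 / real (Suc n)) \<longlonglongrightarrow> 0" by (rule LIMSEQ_Suc[OF lim_const_over_n])
        then show "(\<lambda>n. 1 / real (Suc n) * (k s)\<^sup>2) \<longlonglongrightarrow> 0" by simp
        show "\<forall>\<^sub>F n in sequentially. 0 \<le> trunc (1 / real (Suc n)) s"
          using trunc_bounds[OF _ s] by (intro always_eventually) simp
        show "\<forall>\<^sub>F n in sequentially. trunc (1 / real (Suc n)) s \<le> 1 / real (Suc n) * (k s)\<^sup>2"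
          unfolding trunc_def by (intro always_eventually) simp
      qed simp
    qed
    show "AE s in lebesgue_on {0..T}. norm (trunc (1 / real (Suc n)) s) \<le> k s" for n
      using trunc_bounds by (intro AE_I2) auto
    show "trunc (1 / real (Suc n)) \<in> borel_measurable (lebesgue_on {0..T})" for n
      using trunc_lebesgue[of "1 / real (Suc n)"] by auto
  qed (use k_lebesgue in auto)
  then show ?thesis
    using lebesgue_integral_eq_integral[OF trunc_lebesgue] by simp
qed

section \<open>The distance tested with mollified functions\<close>

context
  fixes m :: "'a measure" and e C :: real
  assumes m: "prob_space m" and m_sets: "sets m = sets borel" and e: "0 < e"
    and m_supp: "AE z in m. norm z \<le> e" and C: "0 \<le> C"
    and m_smooth: "\<And>u. u \<in> bl_unit \<Longrightarrow> \<exists>G. \<forall>p w.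
        \<bar>(\<integral>z. u (p + w - z) \<partial>m) - (\<integral>z. u (p - z) \<partial>m) - G p \<bullet> w\<bar> \<le> C * (norm w)\<^sup>2"
begin

interpretation m: prob_space m by (rule m)

definition smooth :: "('a \<Rightarrow> real) \<Rightarrow> 'a \<Rightarrow> real" where
  "smooth u p = (\<integral>z. u (p - z) \<partial>m)"

lemma m_meas: "f \<in> borel_measurable borel \<Longrightarrow> f \<in> borel_measurable m"
  by (simp add: measurable_cong_sets[OF m_sets refl])

lemma shift_integrable:
  assumes u: "u \<in> bl_unit" shows "integrable m (\<lambda>z. u (p - z))"
proof (rule m.integrable_const_bound[where B=1])
  show "AE z in m. norm (u (p - z)) \<le> 1" using u unfolding bl_unit_def by simp
  show "(\<lambda>z. u (p - z)) \<in> borel_measurable m"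
    by (intro m_meas measurable_compose[OF _ bl_unit_measurable[OF u]]) simp
qed

lemma smooth_diff_le:
  assumes u: "integrable m (\<lambda>z. f z)" "integrable m (\<lambda>z. g z)" and le: "AE z in m. \<bar>f z - g z\<bar> \<le> c"
  shows "\<bar>(\<integral>z. f z \<partial>m) - (\<integral>z. g z \<partial>m)\<bar> \<le> (c::real)"
proof -
  have "(\<integral>z. f z \<partial>m) - (\<integral>z. g z \<partial>m) = (\<integral>z. f z - g z \<partial>m)" using u by simp
  also have "\<bar>\<dots>\<bar> \<le> (\<integral>z. \<bar>f z - g z\<bar> \<partial>m)" by (rule integral_abs_bound)
  also have "\<dots> \<le> (\<integral>z. c \<partial>m)" using u le by (intro integral_mono_AE) auto
  finally show ?thesis by (simp add: m.prob_space)
qed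

lemma smooth_bl: assumes u: "u \<in> bl_unit" shows "smooth u \<in> bl_unit"
proof -
  have u1: "\<bar>u p\<bar> \<le> 1" "\<bar>u p - u q\<bar> \<le> dist p q" for p q using u unfolding bl_unit_def by auto
  show ?thesis unfolding bl_unit_def
  proof (intro CollectI conjI allI)
    fix p
    show "\<bar>smooth u p\<bar> \<le> 1"
      using smooth_diff_le[of "\<lambda>z. u (p - z)" "\<lambda>_. 0" 1] shift_integrable[OF u] u1 unfolding smooth_def by simp
  next
    fix p q
    have "dist (p - z) (q - z) = dist p q" for z :: 'a by (simp add: dist_norm)
    then show "\<bar>smooth u p - smooth u q\<bar> \<le> dist p q"
      unfolding smooth_def using u1(2)
      by (intro smooth_diff_le shift_integrable[OF u] AE_I2) metis
  qed
qed

lemma smooth_close: assumes u: "u \<in> bl_unit" shows "\<bar>u p - smooth u p\<bar> \<le> e"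
proof -
  have "AE z in m. \<bar>u p - u (p - z)\<bar> \<le> e"
    using m_supp
  proof (rule AE_mp, intro AE_I2 impI)
    fix z :: 'a assume "norm z \<le> e"
    moreover have "\<bar>u p - u (p - z)\<bar> \<le> dist p (p - z)" using u unfolding bl_unit_def by blast
    ultimately show "\<bar>u p - u (p - z)\<bar> \<le> e" by (simp add: dist_norm)
  qed
  then have "\<bar>(\<integral>z. u p \<partial>m) - (\<integral>z. u (p - z) \<partial>m)\<bar> \<le> e"
    by (intro smooth_diff_le shift_integrable[OF u]) auto
  then show ?thesis unfolding smooth_def by (simp add: m.prob_space)
qed

text \<open>Restricting the supremum to mollified functions costs at most \<open>2 * e\<close>, and
  in return every test function has a gradient and a quadratic remainder with the same constant
  \<open>C\<close>.\<close>

definition smooth_gap :: "real \<Rightarrow> real" where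
  "smooth_gap s = (SUP u\<in>bl_unit. gap (smooth u) s)"

lemma gap_le_smooth_gap: "u \<in> bl_unit \<Longrightarrow> s \<in> {0..T} \<Longrightarrow> gap (smooth u) s \<le> smooth_gap s"
  unfolding smooth_gap_def using gap_le_2 smooth_bl by (intro cSUP_upper bdd_aboveI2[where M=2]) auto

lemma smooth_gap_le: "(\<And>u. u \<in> bl_unit \<Longrightarrow> gap (smooth u) s \<le> c) \<Longrightarrow> smooth_gap s \<le> c"
  unfolding smooth_gap_def using bl_unit_zero by (intro cSUP_least) auto

lemma smooth_gap_le_bl_gap: assumes "s \<in> {0..T}" shows "smooth_gap s \<le> bl_gap s"
  by (rule smooth_gap_le) (rule gap_le_bl_gap[OF smooth_bl assms])

lemma bl_gap_le_smooth_gap: assumes s: "s \<in> {0..T}" shows "bl_gap s \<le> smooth_gap s + 2 * e"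
proof (rule bl_gap_le)
  fix u :: "'a \<Rightarrow> real" assume u: "u \<in> bl_unit"
  have i: "integrable M1 (\<lambda>w. u (x s w))" "integrable M1 (\<lambda>w. smooth u (x s w))"
    "integrable M2 (\<lambda>w. u (y s w))" "integrable M2 (\<lambda>w. smooth u (y s w))"
    using A.bl_int[OF _ A.x_meas[OF s]] B.bl_int[OF _ B.x_meas[OF s]] u smooth_bl by auto
  have "norm (\<integral>w. u (x s w) - smooth u (x s w) \<partial>M1) \<le> (\<integral>w. e \<partial>M1)"
    using smooth_close[OF u] i by (intro norm_integral_le(2)) auto
  moreover have "norm (\<integral>w. u (y s w) - smooth u (y s w) \<partial>M2) \<le> (\<integral>w. e \<partial>M2)"
    using smooth_close[OF u] i by (intro norm_integral_le(2)) auto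
  ultimately have "gap u s \<le> gap (smooth u) s + 2 * e"
    unfolding gap_def using i by (simp add: A.prob_space B.prob_space)
  then show "gap u s \<le> smooth_gap s + 2 * e" using gap_le_smooth_gap[OF u s] by simp
qed

text \<open>
  Commutator estimate: transporting by the Lipschitz field commutes with averaging over a ball of
  radius \<open>e\<close> up to an error that is linear in \<open>h * e\<close>, so smoothing costs nothing in the limit.
\<close>
lemma gap_transport:
  assumes u: "u \<in> bl_unit" and s: "s \<in> {0..T}" and h: "0 < h"
  shows "(\<integral>w. smooth u (x s w + h *\<^sub>R v s (x s w)) \<partial>M1) - (\<integral>w. smooth u (y s w + h *\<^sub>R v s (y s w)) \<partial>M2)
    \<le> (1 + h * k s) * smooth_gap s + 2 * h * k s * e"
proof -
  define c where "c = 1 + h * k s"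
  have k: "1 \<le> k s" by (rule A.k_ge_1[OF s])
  have c: "1 \<le> c" unfolding c_def using k h by simp
  \<comment> \<open>\<open>u\<close> is composed with the Euler map, whose Lipschitz constant is at
    most \<open>c\<close>; division by \<open>c\<close> brings the result back into
    \<open>bl_unit\<close>.\<close>
  define u' where "u' p = u (p + h *\<^sub>R v s p) / c" for p
  have u1: "\<bar>u p\<bar> \<le> 1" "\<bar>u p - u q\<bar> \<le> dist p q" for p q using u unfolding bl_unit_def by auto
  have u': "u' \<in> bl_unit" unfolding bl_unit_def
  proof (intro CollectI conjI allI)
    fix p show "\<bar>u' p\<bar> \<le> 1" using u1(1)[of "p + h *\<^sub>R v s p"] c unfolding u'_def by (simp add: divide_simps)
  next
    fix p q
    have "\<bar>u (p + h *\<^sub>R v s p) - u (q + h *\<^sub>R v s q)\<bar> \<le> norm ((p - q) + h *\<^sub>R (v s p - v s q))"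
      using u1(2)[of "p + h *\<^sub>R v s p" "q + h *\<^sub>R v s q"] by (simp add: dist_norm algebra_simps)
    also have "\<dots> \<le> norm (p - q) + h * norm (v s p - v s q)"
      using norm_triangle_ineq[of "p - q" "h *\<^sub>R (v s p - v s q)"] h by simp
    also have "\<dots> \<le> dist p q + h * (k s * dist p q)"
      using v_lip[OF s, of p q] h by (simp add: dist_norm)
    also have "\<dots> = c * dist p q" unfolding c_def by (simp add: algebra_simps)
    finally have "\<bar>u (p + h *\<^sub>R v s p) - u (q + h *\<^sub>R v s q)\<bar> \<le> c * dist p q" .
    then show "\<bar>u' p - u' q\<bar> \<le> dist p q"
      unfolding u'_def using c by (simp add: field_simps flip: diff_divide_distrib)
  qed
  \<comment> \<open>Moving p and then shifting by z, or shifting and then moving, gives points that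
    differ by h (v s p - v s (p - z)), hence by at most \<open>h * k s * e\<close>. The point p - z
    is arbitrary in the space, which is why \<open>v_lip\<close> is required everywhere.\<close>
  have close: "\<bar>smooth u (p + h *\<^sub>R v s p) - c * smooth u' p\<bar> \<le> h * k s * e" for p
  proof -
    have "AE z in m. \<bar>u (p + h *\<^sub>R v s p - z) - c * u' (p - z)\<bar> \<le> h * k s * e"
      using m_supp
    proof (rule AE_mp, intro AE_I2 impI)
      fix z :: 'a assume z: "norm z \<le> e"
      have "c * u' (p - z) = u (p - z + h *\<^sub>R v s (p - z))" unfolding u'_def using c by simp
      then have "\<bar>u (p + h *\<^sub>R v s p - z) - c * u' (p - z)\<bar> \<le> norm (h *\<^sub>R (v s p - v s (p - z)))"
        using u1(2)[of "p + h *\<^sub>R v s p - z" "p - z + h *\<^sub>R v s (p - z)"] by (simp add: dist_norm algebra_simps)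
      also have "\<dots> = h * norm (v s p - v s (p - z))" using h by simp
      also have "\<dots> \<le> h * (k s * norm z)"
        using v_lip[OF s, of p "p - z"] h by (intro mult_left_mono) (auto simp: dist_norm)
      also have "\<dots> \<le> h * (k s * e)" using z h k by (intro mult_left_mono) auto
      finally show "\<bar>u (p + h *\<^sub>R v s p - z) - c * u' (p - z)\<bar> \<le> h * k s * e" by (simp add: mult.assoc)
    qed
    then have "\<bar>(\<integral>z. u (p + h *\<^sub>R v s p - z) \<partial>m) - (\<integral>z. c * u' (p - z) \<partial>m)\<bar> \<le> h * k s * e"
      by (intro smooth_diff_le shift_integrable[OF u] integrable_mult_right shift_integrable[OF u'])
    then show ?thesis unfolding smooth_def by simp
  qed
  have m1: "(\<lambda>w. x s w + h *\<^sub>R v s (x s w)) \<in> borel_measurable M1"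
    using A.x_meas[OF s] A.v_x_meas[OF s] by measurable
  have m2: "(\<lambda>w. y s w + h *\<^sub>R v s (y s w)) \<in> borel_measurable M2"
    using B.x_meas[OF s] B.v_x_meas[OF s] by measurable
  have i: "integrable M1 (\<lambda>w. smooth u (x s w + h *\<^sub>R v s (x s w)))" "integrable M1 (\<lambda>w. smooth u' (x s w))"
    "integrable M2 (\<lambda>w. smooth u (y s w + h *\<^sub>R v s (y s w)))" "integrable M2 (\<lambda>w. smooth u' (y s w))"
    using A.bl_int[OF smooth_bl[OF u] m1] A.bl_int[OF smooth_bl[OF u'] A.x_meas[OF s]]
      B.bl_int[OF smooth_bl[OF u] m2] B.bl_int[OF smooth_bl[OF u'] B.x_meas[OF s]] by auto
  have "norm (\<integral>w. smooth u (x s w + h *\<^sub>R v s (x s w)) - c * smooth u' (x s w) \<partial>M1) \<le> (\<integral>w. h * k s * e \<partial>M1)"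
    by (rule norm_integral_le(2)) (use i close in auto)
  then have 1: "\<bar>(\<integral>w. smooth u (x s w + h *\<^sub>R v s (x s w)) \<partial>M1) - c * (\<integral>w. smooth u' (x s w) \<partial>M1)\<bar> \<le> h * k s * e"
    using i by (simp add: A.prob_space)
  have "norm (\<integral>w. smooth u (y s w + h *\<^sub>R v s (y s w)) - c * smooth u' (y s w) \<partial>M2) \<le> (\<integral>w. h * k s * e \<partial>M2)"
    by (rule norm_integral_le(2)) (use i close in auto)
  then have 2: "\<bar>(\<integral>w. smooth u (y s w + h *\<^sub>R v s (y s w)) \<partial>M2) - c * (\<integral>w. smooth u' (y s w) \<partial>M2)\<bar> \<le> h * k s * e"
    using i by (simp add: B.prob_space)
  have "c * gap (smooth u') s \<le> c * smooth_gap s"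
    using gap_le_smooth_gap[OF u' s] c by (intro mult_left_mono) auto
  then have 3: "c * (\<integral>w. smooth u' (x s w) \<partial>M1) - c * (\<integral>w. smooth u' (y s w) \<partial>M2) \<le> c * smooth_gap s"
    unfolding gap_def by (simp add: right_diff_distrib)
  show ?thesis using 1 2 3 unfolding c_def by linarith
qed

text \<open>The growth over one interval. The test function is nearly optimal at time
  \<open>t\<close> only; using it at earlier times costs \<open>2 * dom_const\<close> times the
  integral of \<open>k\<close>, which reappears divided by \<open>h\<close> in the last
  summand.\<close>

lemma smooth_gap_step:
  assumes rt: "0 \<le> r" "r \<le> t" "t \<le> T" and S: "\<And>s. s \<in> {r..t} \<Longrightarrow> smooth_gap s \<le> S"
    and h: "0 < h" "h \<le> 1"
  shows "smooth_gap t - smooth_gap r \<le> (S + 2 * e) * integral {r..t} k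
    + (2 + C) * dom_const * integral {r..t} (trunc h)
    + (2 * dom_const * (t - r) / h + 7 * C * dom_const * integral {r..t} k) * integral {r..t} k"
    (is "_ \<le> ?R")
proof (rule field_le_epsilon)
  fix d0 :: real assume d0: "0 < d0"
  \<comment> \<open>The slack \<open>d\<close> enters once at time \<open>t\<close> and once,
    divided by \<open>h\<close>, under the time integral; this choice makes the total exactly
    \<open>d0\<close>.\<close>
  define d where "d = d0 / (1 + (t - r) / h)"
  have "0 < 1 + (t - r) / h" using rt h by (intro add_pos_nonneg) auto
  then have d: "0 < d" and dd: "d * (1 + (t - r) / h) = d0" unfolding d_def using d0 by auto
  let ?I = "integral {r..t} k"
  have I0: "0 \<le> ?I" by (rule A.k_integral_nonneg[OF rt(1,3)])
  have "smooth_gap t - d < smooth_gap t" using d by simp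
  then obtain u where u: "u \<in> bl_unit" and ud: "smooth_gap t - d < gap (smooth u) t"
    unfolding smooth_gap_def[of t] by (subst (asm) less_cSUP_iff) (use bl_unit_zero gap_le_2 smooth_bl rt in \<open>auto intro!: bdd_aboveI2[where M=2]\<close>)
  obtain G where G: "\<And>p w. \<bar>smooth u (p + w) - smooth u p - G p \<bullet> w\<bar> \<le> C * (norm w)\<^sup>2"
    using m_smooth[OF u] unfolding smooth_def by blast
  note su = smooth_bl[OF u]
  define g1 where "g1 s = (\<integral>w. G (x s w) \<bullet> v s (x s w) \<partial>M1)" for s
  define g2 where "g2 s = (\<integral>w. G (y s w) \<bullet> v s (y s w) \<partial>M2)" for s
  have gi: "g1 integrable_on {r..t}" "g2 integrable_on {r..t}"
    unfolding g1_def g2_def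
    using A.weak_equation(1)[OF su C G rt] B.weak_equation(1)[OF su C G rt] by auto
  have w1: "\<bar>(\<integral>w. smooth u (x t w) \<partial>M1) - (\<integral>w. smooth u (x r w) \<partial>M1) - integral {r..t} g1\<bar> \<le> 7 * C * A.D * ?I\<^sup>2"
    unfolding g1_def using A.weak_equation(2)[OF su C G rt] .
  have w2: "\<bar>(\<integral>w. smooth u (y t w) \<partial>M2) - (\<integral>w. smooth u (y r w) \<partial>M2) - integral {r..t} g2\<bar> \<le> 7 * C * B.D * ?I\<^sup>2"
    unfolding g2_def using B.weak_equation(2)[OF su C G rt] .
  have gb: "g1 s - g2 s \<le> (2 * dom_const * ?I + d) / h + k s * (S + 2 * e) + (2 + C) * dom_const * trunc h s"
    if s: "s \<in> {r..t}" for s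
  proof -
    have sT: "s \<in> {0..T}" using s rt by auto
    have ks: "1 \<le> k s" by (rule A.k_ge_1[OF sT])
    have "integral {s..t} k \<le> ?I" using A.k_integral_mono[of r s t t] s rt by simp
    then have kI: "dom_const * integral {s..t} k \<le> dom_const * ?I"
      using dom_const_nonneg by (rule mult_left_mono)
    \<comment> \<open>For \<open>u\<close> this bounds the gap at time \<open>s\<close> from below
      by nearly \<open>smooth_gap t\<close>; over all test functions it bounds
      \<open>smooth_gap s\<close> from above.\<close>
    have inc: "\<bar>gap (smooth u') t - gap (smooth u') s\<bar> \<le> dom_const * ?I" if "u' \<in> bl_unit" for u'
      using gap_increment[OF _ _ rt(3) smooth_bl[OF that], of s] s rt kI by auto
    have lo: "smooth_gap t - d - dom_const * ?I \<le> gap (smooth u) s" using inc[OF u] ud by linarith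
    have hi: "smooth_gap s \<le> smooth_gap t + dom_const * ?I"
    proof (rule smooth_gap_le)
      fix u' :: "'a \<Rightarrow> real" assume u': "u' \<in> bl_unit"
      have "gap (smooth u') t \<le> smooth_gap t" using gap_le_smooth_gap[OF u'] rt by auto
      then show "gap (smooth u') s \<le> smooth_gap t + dom_const * ?I" using inc[OF u'] by linarith
    qed
    have f1: "\<bar>(\<integral>w. smooth u (x s w + h *\<^sub>R v s (x s w)) \<partial>M1) - (\<integral>w. smooth u (x s w) \<partial>M1) - h * g1 s\<bar>
        \<le> (2 + C) * (1 + A.D) * h * trunc h s"
      unfolding g1_def trunc_def using A.first_order[OF su C G sT h] .
    have f2: "\<bar>(\<integral>w. smooth u (y s w + h *\<^sub>R v s (y s w)) \<partial>M2) - (\<integral>w. smooth u (y s w) \<partial>M2) - h * g2 s\<bar>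
        \<le> (2 + C) * (1 + B.D) * h * trunc h s"
      unfolding g2_def trunc_def using B.first_order[OF su C G sT h] .
    have err: "(2 + C) * (1 + A.D) * h * trunc h s + (2 + C) * (1 + B.D) * h * trunc h s
        = (2 + C) * dom_const * h * trunc h s"
      unfolding dom_const_def by (simp add: algebra_simps)
    \<comment> \<open>The two expansions write h (g1 - g2), up to the Euler error, as the gap of
      \<open>smooth u\<close> after an Euler step minus the gap before it.
      \<open>gap_transport\<close> bounds the former; besides terms with a factor \<open>h\<close>,
      only \<open>smooth_gap s\<close> minus the gap of \<open>smooth u\<close> remains, which
      \<open>lo\<close> and \<open>hi\<close> make small.\<close>
    have "h * g1 s - h * g2 s \<le> (1 + h * k s) * smooth_gap s + 2 * h * k s * e - gap (smooth u) s
        + (2 + C) * dom_const * h * trunc h s"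
      using f1 f2 gap_transport[OF u sT h(1)] err unfolding gap_def by linarith
    also have "\<dots> = (smooth_gap s - gap (smooth u) s) + h * k s * smooth_gap s + 2 * h * k s * e
        + (2 + C) * dom_const * h * trunc h s" by (simp add: algebra_simps)
    also have "\<dots> \<le> (2 * dom_const * ?I + d) + h * k s * S + 2 * h * k s * e
        + (2 + C) * dom_const * h * trunc h s"
    proof -
      have "h * k s * smooth_gap s \<le> h * k s * S" using S[OF s] h ks by (intro mult_left_mono) auto
      then show ?thesis using lo hi by linarith
    qed
    also have "\<dots> = h * ((2 * dom_const * ?I + d) / h + k s * (S + 2 * e) + (2 + C) * dom_const * trunc h s)"
      using h by (simp add: field_simps)
    finally have "h * (g1 s - g2 s) \<le> h * ((2 * dom_const * ?I + d) / h + k s * (S + 2 * e) + (2 + C) * dom_const * trunc h s)"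
      by (simp add: right_diff_distrib)
    then show ?thesis using h(1) by (rule mult_left_le_imp_le)
  qed
  have ki: "k integrable_on {r..t}" by (rule A.k_integrable_on[OF rt(1,3)])
  have ti: "trunc h integrable_on {r..t}"
    by (rule abs_int_subinterval_on[OF trunc_abs_int[OF h(1)] rt(1,3)])
  let ?c = "(2 * dom_const * ?I + d) / h"
  have "integral {r..t} (\<lambda>s. g1 s - g2 s) \<le> integral {r..t} (\<lambda>s. ?c + k s * (S + 2 * e) + (2 + C) * dom_const * trunc h s)"
    using gi ki ti gb by (intro integral_le integrable_add integrable_diff integrable_on_mult_left integrable_on_mult_right) auto
  also have "\<dots> = (t - r) * ?c + (S + 2 * e) * ?I + (2 + C) * dom_const * integral {r..t} (trunc h)"
  proof (rule integral_unique)
    have "((\<lambda>s. ?c + k s * (S + 2 * e) + (2 + C) * dom_const * trunc h s) has_integral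
        measure lborel {r..t} *\<^sub>R ?c + ?I * (S + 2 * e) + (2 + C) * dom_const * integral {r..t} (trunc h)) {r..t}"
      by (intro has_integral_add has_integral_mult_left has_integral_mult_right
          integrable_integral[OF ki] integrable_integral[OF ti] has_integral_const_real)
    then show "((\<lambda>s. ?c + k s * (S + 2 * e) + (2 + C) * dom_const * trunc h s) has_integral
        (t - r) * ?c + (S + 2 * e) * ?I + (2 + C) * dom_const * integral {r..t} (trunc h)) {r..t}"
      using rt by (simp add: mult.commute)
  qed
  finally have ig: "integral {r..t} g1 - integral {r..t} g2
      \<le> (t - r) * ?c + (S + 2 * e) * ?I + (2 + C) * dom_const * integral {r..t} (trunc h)"
    using gi by (simp add: Henstock_Kurzweil_Integration.integral_diff)
  have cw: "7 * C * A.D * ?I\<^sup>2 + 7 * C * B.D * ?I\<^sup>2 \<le> 7 * C * dom_const * ?I\<^sup>2"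
    using C unfolding dom_const_def by (simp add: algebra_simps)
  have "smooth_gap t - smooth_gap r \<le> d + (gap (smooth u) t - gap (smooth u) r)"
    using ud gap_le_smooth_gap[OF u, of r] rt by auto
  also have "\<dots> \<le> d + ((t - r) * ?c + (S + 2 * e) * ?I + (2 + C) * dom_const * integral {r..t} (trunc h) + 7 * C * dom_const * ?I\<^sup>2)"
    using w1 w2 ig cw unfolding gap_def by linarith
  also have "\<dots> = ?R + d * (1 + (t - r) / h)"
    using h by (simp add: field_simps power2_eq_square)
  finally show "smooth_gap t - smooth_gap r \<le> ?R + d0" unfolding dd .
qed

text \<open>For fixed \<open>h\<close> the last summand of \<open>smooth_gap_step\<close> is a
  product of two small quantities and vanishes under subdivision. Afterwards \<open>h\<close> tends
  to 0 along 1 / (n + 1).\<close>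

lemma smooth_gap_growth:
  assumes rt: "0 \<le> r" "r \<le> t" "t \<le> T" and S: "\<And>s. s \<in> {r..t} \<Longrightarrow> smooth_gap s \<le> S"
  shows "smooth_gap t \<le> smooth_gap r + (S + 2 * e) * integral {r..t} k"
proof -
  have fixed_h: "smooth_gap t - smooth_gap r \<le> (S + 2 * e) * integral {r..t} k
      + (2 + C) * dom_const * integral {0..T} (trunc h)" if h: "0 < h" "h \<le> 1" for h
  proof -
    define I where "I q = integral {0..q} k" for q
    define J where "J q = integral {0..q} (trunc h)" for q
    \<comment> \<open>The expected growth is subtracted, so that the increments of \<open>Q\<close>
      contain only the second order error of a step.\<close>
    define Q where "Q q = smooth_gap q - (S + 2 * e) * I q - (2 + C) * dom_const * J q" for q
    note ta = trunc_abs_int[OF h(1)]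
    have dI: "integral {q..p} k = I p - I q" if "0 \<le> q" "q \<le> p" "p \<le> T" for p q
      unfolding I_def by (rule integral_combine_diff[OF A.k_int that])
    have dJ: "integral {q..p} (trunc h) = J p - J q" if "0 \<le> q" "q \<le> p" "p \<le> T" for p q
      unfolding J_def by (rule integral_combine_diff[OF ta that])
    have Jmono: "0 \<le> J p - J q" if "0 \<le> q" "q \<le> p" "p \<le> T" for p q
    proof -
      have "0 \<le> integral {q..p} (trunc h)"
        using abs_int_subinterval_on[OF ta that(1,3)] trunc_bounds[OF h(1)] that
        by (intro Henstock_Kurzweil_Integration.integral_nonneg) auto
      then show ?thesis using dJ[OF that] by simp
    qed
    have "Q t \<le> Q r"
    proof (rule nonincreasing_of_small_increments[where M=I, OF rt(2)])
      fix \<epsilon> :: real assume \<epsilon>: "0 < \<epsilon>"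
      define c1 where "c1 = 2 * dom_const / h + 1"
      define c2 where "c2 = 7 * C * dom_const + 1"
      have c: "0 < c1" "0 < c2" unfolding c1_def c2_def using dom_const_nonneg h C by (auto intro: add_nonneg_pos)
      obtain d where d: "d > 0" "\<And>r t. 0 \<le> r \<Longrightarrow> r \<le> t \<Longrightarrow> t \<le> T \<Longrightarrow> t - r < d \<Longrightarrow> integral {r..t} k < \<epsilon> / (2 * c2)"
        using small_integral_steps[OF A.k_int, of "\<epsilon> / (2 * c2)"] \<epsilon> c by auto
      show "\<exists>d>0. \<forall>q p. r \<le> q \<longrightarrow> q \<le> p \<longrightarrow> p \<le> t \<longrightarrow> p - q < d \<longrightarrow> Q p - Q q \<le> \<epsilon> * (I p - I q)"
      proof (intro exI[of _ "min d (\<epsilon> / (2 * c1))"] conjI allI impI)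
        fix q p assume qp: "r \<le> q" "q \<le> p" "p \<le> t" "p - q < min d (\<epsilon> / (2 * c1))"
        have qpT: "0 \<le> q" "q \<le> p" "p \<le> T" using qp rt by auto
        let ?I = "integral {q..p} k"
        have I0: "0 \<le> ?I" by (rule A.k_integral_nonneg[OF qpT(1,3)])
        have "smooth_gap p - smooth_gap q \<le> (S + 2 * e) * ?I + (2 + C) * dom_const * integral {q..p} (trunc h)
            + (2 * dom_const * (p - q) / h + 7 * C * dom_const * ?I) * ?I"
          by (rule smooth_gap_step[OF qpT _ h]) (use S qp in auto)
        then have "Q p - Q q \<le> (2 * dom_const * (p - q) / h + 7 * C * dom_const * ?I) * ?I"
          unfolding Q_def dI[OF qpT] dJ[OF qpT] by (simp add: algebra_simps)
        also have "\<dots> \<le> \<epsilon> * ?I"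
        proof (rule mult_right_mono[OF _ I0])
          have "2 * dom_const * (p - q) / h = (2 * dom_const / h) * (p - q)" by simp
          also have "\<dots> \<le> c1 * (p - q)" unfolding c1_def using qp by (intro mult_right_mono) auto
          also have "\<dots> \<le> c1 * (\<epsilon> / (2 * c1))" using qp c by (intro mult_left_mono) auto
          also have "\<dots> = \<epsilon> / 2" using c by simp
          finally have 1: "2 * dom_const * (p - q) / h \<le> \<epsilon> / 2" .
          have "7 * C * dom_const * ?I \<le> c2 * ?I" unfolding c2_def using I0 by (intro mult_right_mono) auto
          also have "\<dots> \<le> c2 * (\<epsilon> / (2 * c2))" using d(2)[OF qpT] qp c by (intro mult_left_mono) auto
          also have "\<dots> = \<epsilon> / 2" using c by simp
          finally show "2 * dom_const * (p - q) / h + 7 * C * dom_const * ?I \<le> \<epsilon>" using 1 by simp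
        qed
        finally show "Q p - Q q \<le> \<epsilon> * (I p - I q)" using dI[OF qpT] by simp
      qed (use d \<epsilon> c in auto)
    qed
    then have "smooth_gap t - smooth_gap r \<le> (S + 2 * e) * (I t - I r) + (2 + C) * dom_const * (J t - J r)"
      unfolding Q_def by (simp add: algebra_simps)
    \<comment> \<open>Monotonicity of \<open>J\<close> enlarges the increment to \<open>J T\<close>,
      the form in which \<open>trunc_integral_tendsto_0\<close> applies.\<close>
    also have "\<dots> \<le> (S + 2 * e) * (I t - I r) + (2 + C) * dom_const * J T"
    proof -
      have "J 0 = 0" unfolding J_def by simp
      then have "J t - J r \<le> J T" using Jmono[of 0 r] Jmono[of t T] rt by auto
      then show ?thesis using C dom_const_nonneg by (simp add: mult_left_mono)
    qed
    finally show ?thesis using dI[OF rt] unfolding J_def by simp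
  qed
  have "(\<lambda>n. (S + 2 * e) * integral {r..t} k + (2 + C) * dom_const * integral {0..T} (trunc (1 / real (Suc n))))
      \<longlonglongrightarrow> (S + 2 * e) * integral {r..t} k + (2 + C) * dom_const * 0"
    by (intro tendsto_intros trunc_integral_tendsto_0)
  moreover have "\<forall>n. smooth_gap t - smooth_gap r \<le> (S + 2 * e) * integral {r..t} k
      + (2 + C) * dom_const * integral {0..T} (trunc (1 / real (Suc n)))"
    using fixed_h by simp
  ultimately have "smooth_gap t - smooth_gap r \<le> (S + 2 * e) * integral {r..t} k + (2 + C) * dom_const * 0"
    by (intro LIMSEQ_le_const) auto
  then show ?thesis by simp
qed

lemma bl_gap_growth_approx:
  assumes rt: "0 \<le> r" "r \<le> t" "t \<le> T" and S: "\<And>s. s \<in> {r..t} \<Longrightarrow> bl_gap s \<le> S"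
  shows "bl_gap t \<le> bl_gap r + (S + 2 * e) * integral {r..t} k + 2 * e"
proof -
  have "smooth_gap s \<le> S" if "s \<in> {r..t}" for s
    using smooth_gap_le_bl_gap[of s] S[OF that] that rt by auto
  from smooth_gap_growth[OF rt this] show ?thesis
    using bl_gap_le_smooth_gap[of t] smooth_gap_le_bl_gap[of r] rt by auto
qed

end

text \<open>The mollifier and its constant \<open>C\<close> depend on \<open>e\<close>, but
  \<open>C\<close> has left the estimate with the limit in \<open>h\<close>; hence \<open>e\<close>
  can be sent to 0 last.\<close>

lemma bl_gap_growth:
  assumes rt: "0 \<le> r" "r \<le> t" "t \<le> T" and S: "\<And>s. s \<in> {r..t} \<Longrightarrow> bl_gap s \<le> S"
  shows "bl_gap t \<le> bl_gap r + S * integral {r..t} k"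
proof (rule field_le_epsilon)
  fix d :: real assume d: "0 < d"
  \<comment> \<open>Collects the two errors of size \<open>e\<close>: the commutator under the
    integral, and the return from \<open>smooth_gap\<close> to \<open>bl_gap\<close>.\<close>
  define c where "c = 2 * integral {r..t} k + 2"
  have c: "0 < c" unfolding c_def using A.k_integral_nonneg[OF rt(1,3)] by simp
  define e where "e = d / c"
  have e: "0 < e" and ec: "e * c = d" unfolding e_def using d c by auto
  obtain m :: "'a measure" and C where mC: "prob_space m" "sets m = sets borel" "AE z in m. norm z \<le> e" "0 \<le> C"
    "\<And>u. u \<in> bl_unit \<Longrightarrow> \<exists>G. \<forall>p w.
        \<bar>(\<integral>z. u (p + w - z) \<partial>m) - (\<integral>z. u (p - z) \<partial>m) - G p \<bullet> w\<bar> \<le> C * (norm w)\<^sup>2"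
    using mollifier_exists[OF e] by metis
  have "bl_gap t \<le> bl_gap r + (S + 2 * e) * integral {r..t} k + 2 * e"
    by (rule bl_gap_growth_approx[OF mC(1,2) e mC(3,4,5) rt S])
  also have "\<dots> = bl_gap r + S * integral {r..t} k + e * c" unfolding c_def by (simp add: algebra_simps)
  finally show "bl_gap t \<le> bl_gap r + S * integral {r..t} k + d" unfolding ec .
qed

text \<open>\<open>bl_gap\<close> is a supremum over an uncountable class without evident
  measurability in time, so Gronwall's inequality is applied in the form with bounds
  \<open>S\<close> on subintervals.\<close>

theorem laws_agree:
  assumes init: "\<And>u. u \<in> bl_unit \<Longrightarrow> (\<integral>w. u (x 0 w) \<partial>M1) = (\<integral>w. u (y 0 w) \<partial>M2)"
    and t: "t \<in> {0..T}"
  shows "distr M1 borel (x t) = distr M2 borel (y t)"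
proof -
  have k0: "0 \<le> k s" if "s \<in> {0..T}" for s using A.k_ge_1[OF that] by simp
  obtain C where C: "\<And>g t. (\<And>s. s \<in> {0..T} \<Longrightarrow> 0 \<le> g s) \<Longrightarrow> bdd_above (g ` {0..T}) \<Longrightarrow>
      (\<And>r t S. 0 \<le> r \<Longrightarrow> r \<le> t \<Longrightarrow> t \<le> T \<Longrightarrow> (\<And>s. s \<in> {r..t} \<Longrightarrow> g s \<le> S) \<Longrightarrow>
        g t \<le> g r + S * integral {r..t} k) \<Longrightarrow>
      t \<in> {0..T} \<Longrightarrow> g t \<le> C * g 0"
    using gronwall_sup[OF A.k_int k0] by metis
  have "bl_gap t \<le> C * bl_gap 0"
  proof (rule C[OF _ _ _ t])
    show "bdd_above (bl_gap ` {0..T})" using bl_gap_bounds(2) by (intro bdd_aboveI2[where M=2]) auto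
    show "0 \<le> bl_gap s" if "s \<in> {0..T}" for s by (rule bl_gap_bounds(1)[OF that])
  qed (rule bl_gap_growth)
  moreover have "bl_gap 0 = 0"
  proof (rule antisym)
    show "bl_gap 0 \<le> 0" by (rule bl_gap_le) (simp add: gap_def init)
    show "0 \<le> bl_gap 0" using bl_gap_bounds(1)[of 0] t by auto
  qed
  ultimately have z: "bl_gap t \<le> 0" by simp
  have le: "gap u t \<le> 0" if "u \<in> bl_unit" for u using gap_le_bl_gap[OF that t] z by simp
  have eq: "gap u t = 0" if u: "u \<in> bl_unit" for u
  proof -
    \<comment> \<open>Symmetry of the test class turns the one-sided bound into equality.\<close>
    have "(\<lambda>p. - u p) \<in> bl_unit" using u unfolding bl_unit_def by (auto simp: abs_minus_commute)
    from le[OF this] le[OF u] show ?thesis unfolding gap_def by simp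
  qed
  show ?thesis
  proof (rule measure_eq_of_bl_unit)
    fix u :: "'a \<Rightarrow> real" assume u: "u \<in> bl_unit"
    show "(\<integral>p. u p \<partial>distr M1 borel (x t)) = (\<integral>p. u p \<partial>distr M2 borel (y t))"
      using eq[OF u] bl_unit_measurable[OF u] A.x_meas[OF t] B.x_meas[OF t]
      by (simp add: integral_distr gap_def)
  qed (use A.x_meas[OF t] B.x_meas[OF t] in \<open>auto intro: A.prob_space_distr B.prob_space_distr\<close>)
qed

end

section \<open>Conditional laws\<close>

text \<open>The integrand varies with x as well as the measure. Pushing \<open>L x\<close> forward
  along \<open>Pair x\<close> moves this dependence into the measure and leaves one fixed integrand
  on the product.\<close>

lemma integral_measurable_kernel:
  fixes f :: "'x \<Rightarrow> 'z \<Rightarrow> 'b::{banach, second_countable_topology}"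
  assumes f: "(\<lambda>(x, y). f x y) \<in> borel_measurable (M \<Otimes>\<^sub>M N)" and L: "L \<in> M \<rightarrow>\<^sub>M subprob_algebra N"
  shows "(\<lambda>x. \<integral>y. f x y \<partial>L x) \<in> borel_measurable M"
proof -
  have d: "(\<lambda>x. distr (L x) (M \<Otimes>\<^sub>M N) (Pair x)) \<in> M \<rightarrow>\<^sub>M subprob_algebra (M \<Otimes>\<^sub>M N)"
    by (rule measurable_distr2[OF _ L]) simp
  have "(\<lambda>x. \<integral>q. (\<lambda>(x, y). f x y) q \<partial>distr (L x) (M \<Otimes>\<^sub>M N) (Pair x)) \<in> borel_measurable M"
    by (rule measurable_compose[OF d integral_measurable_subprob_algebra[OF f]])
  then show ?thesis
  proof (rule measurable_cong[THEN iffD1, rotated])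
    fix x assume x: "x \<in> space M"
    have "Pair x \<in> L x \<rightarrow>\<^sub>M M \<Otimes>\<^sub>M N"
      using x by (simp add: measurable_cong_sets[OF sets_kernel[OF L x] refl])
    then show "(\<integral>q. (\<lambda>(x, y). f x y) q \<partial>distr (L x) (M \<Otimes>\<^sub>M N) (Pair x)) = (\<integral>y. f x y \<partial>L x)"
      using f by (simp add: integral_distr)
  qed
qed

lemma conditional_laws_kernel:
  assumes "conditional_laws M f N \<kappa>"
  shows "\<kappa> \<in> N \<rightarrow>\<^sub>M subprob_algebra M"
    and "x \<in> space N \<Longrightarrow> prob_space (\<kappa> x)" "x \<in> space N \<Longrightarrow> sets (\<kappa> x) = sets M"
    "x \<in> space N \<Longrightarrow> space (\<kappa> x) = space M"
proof -
  have k: "\<kappa> \<in> N \<rightarrow>\<^sub>M prob_algebra M" using assms unfolding conditional_laws_def by simp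
  show "\<kappa> \<in> N \<rightarrow>\<^sub>M subprob_algebra M" by (rule measurable_prob_algebraD[OF k])
  assume "x \<in> space N"
  then have x: "\<kappa> x \<in> space (prob_algebra M)" using k by (rule measurable_space[rotated])
  then show "prob_space (\<kappa> x)" "sets (\<kappa> x) = sets M" unfolding space_prob_algebra by auto
  then show "space (\<kappa> x) = space M" by (intro sets_eq_imp_space_eq)
qed

text \<open>The disintegration identity says that the two measures agree on rectangles, which
  generate the product and are stable under intersection. Keeping the pair (f z, z) encodes that
  \<open>f\<close> takes the value x under \<open>\<kappa> x\<close>.\<close>

lemma conditional_laws_joint:
  assumes cl: "conditional_laws M f N \<kappa>" and M: "prob_space M" and f: "f \<in> M \<rightarrow>\<^sub>M N"
  shows "distr M (N \<Otimes>\<^sub>M M) (\<lambda>z. (f z, z))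
    = distr M N f \<bind> (\<lambda>x. distr (\<kappa> x) (N \<Otimes>\<^sub>M M) (Pair x))"
    and "(\<lambda>x. distr (\<kappa> x) (N \<Otimes>\<^sub>M M) (Pair x)) \<in> N \<rightarrow>\<^sub>M subprob_algebra (N \<Otimes>\<^sub>M M)"
proof -
  note k = conditional_laws_kernel[OF cl]
  interpret M: prob_space M by fact
  interpret D: prob_space "distr M N f" by (rule M.prob_space_distr[OF f])
  show km: "(\<lambda>x. distr (\<kappa> x) (N \<Otimes>\<^sub>M M) (Pair x)) \<in> N \<rightarrow>\<^sub>M subprob_algebra (N \<Otimes>\<^sub>M M)"
    by (rule measurable_distr2[OF _ k(1)]) simp
  then have kmD: "(\<lambda>x. distr (\<kappa> x) (N \<Otimes>\<^sub>M M) (Pair x)) \<in> distr M N f \<rightarrow>\<^sub>M subprob_algebra (N \<Otimes>\<^sub>M M)"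
    by simp
  have spN: "space N \<noteq> {}" using D.not_empty by simp
  have pm: "(\<lambda>z. (f z, z)) \<in> M \<rightarrow>\<^sub>M N \<Otimes>\<^sub>M M" using f by measurable
  show "distr M (N \<Otimes>\<^sub>M M) (\<lambda>z. (f z, z)) = distr M N f \<bind> (\<lambda>x. distr (\<kappa> x) (N \<Otimes>\<^sub>M M) (Pair x))"
    (is "?L = ?R")
  proof (rule measure_eqI_generator_eq[OF Int_stable_pair_measure_generator, where \<Omega>="space N \<times> space M"
        and A="\<lambda>_. space N \<times> space M"])
    show "{a \<times> b |a b. a \<in> sets N \<and> b \<in> sets M} \<subseteq> Pow (space N \<times> space M)" by (rule pair_measure_closed)
    show "sets ?L = sigma_sets (space N \<times> space M) {a \<times> b |a b. a \<in> sets N \<and> b \<in> sets M}"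
      by (simp add: sets_pair_measure)
    show "sets ?R = sigma_sets (space N \<times> space M) {a \<times> b |a b. a \<in> sets N \<and> b \<in> sets M}"
      using sets_bind_measurable[OF kmD] spN by (simp add: sets_pair_measure)
    show "range (\<lambda>_::nat. space N \<times> space M) \<subseteq> {a \<times> b |a b. a \<in> sets N \<and> b \<in> sets M}" by blast
    show "emeasure ?L (space N \<times> space M) \<noteq> \<infinity>"
      using prob_space.prob_space_distr[OF M pm] by (simp add: prob_space_def finite_measure.emeasure_finite)
  next
    fix U assume "U \<in> {a \<times> b |a b. a \<in> sets N \<and> b \<in> sets M}"
    then obtain B A where U: "U = B \<times> A" and B: "B \<in> sets N" and A: "A \<in> sets M" by blast
    have "emeasure ?L U = emeasure M (A \<inter> {z \<in> space M. f z \<in> B})"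
      unfolding U using pm B A sets.sets_into_space[OF A] by (subst emeasure_distr) (auto intro!: arg_cong[where f="emeasure M"])
    also have "\<dots> = (\<integral>\<^sup>+x\<in>B. emeasure (\<kappa> x) A \<partial>distr M N f)"
      using cl A B unfolding conditional_laws_def by blast
    also have "\<dots> = (\<integral>\<^sup>+x. emeasure (distr (\<kappa> x) (N \<Otimes>\<^sub>M M) (Pair x)) U \<partial>distr M N f)"
    proof (rule nn_integral_cong)
      fix x assume "x \<in> space (distr M N f)"
      then have x: "x \<in> space N" by simp
      have Px: "Pair x \<in> \<kappa> x \<rightarrow>\<^sub>M N \<Otimes>\<^sub>M M"
        using x by (simp add: measurable_cong_sets[OF k(3)[OF x] refl])
      have "emeasure (distr (\<kappa> x) (N \<Otimes>\<^sub>M M) (Pair x)) U = emeasure (\<kappa> x) (Pair x -` (B \<times> A) \<inter> space (\<kappa> x))"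
        unfolding U using Px B A by (intro emeasure_distr) auto
      also have "Pair x -` (B \<times> A) \<inter> space (\<kappa> x) = (if x \<in> B then A else {})"
        using sets.sets_into_space[OF A] k(4)[OF x] by auto
      finally show "emeasure (\<kappa> x) A * indicator B x = emeasure (distr (\<kappa> x) (N \<Otimes>\<^sub>M M) (Pair x)) U"
        by (simp split: split_indicator)
    qed
    also have "\<dots> = emeasure ?R U"
      using B A spN unfolding U by (intro emeasure_bind[symmetric, OF _ kmD]) auto
    finally show "emeasure ?L U = emeasure ?R U" .
  qed auto
qed

lemma conditional_laws_nn_integral:
  assumes cl: "conditional_laws M f N \<kappa>" and M: "prob_space M" and f: "f \<in> M \<rightarrow>\<^sub>M N"
    and H: "H \<in> borel_measurable (N \<Otimes>\<^sub>M M)"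
  shows "(\<integral>\<^sup>+z. H (f z, z) \<partial>M) = (\<integral>\<^sup>+x. (\<integral>\<^sup>+z. H (x, z) \<partial>\<kappa> x) \<partial>distr M N f)"
proof -
  note k = conditional_laws_kernel[OF cl]
  have pm: "(\<lambda>z. (f z, z)) \<in> M \<rightarrow>\<^sub>M N \<Otimes>\<^sub>M M" using f by measurable
  have "(\<integral>\<^sup>+z. H (f z, z) \<partial>M) = (\<integral>\<^sup>+q. H q \<partial>distr M (N \<Otimes>\<^sub>M M) (\<lambda>z. (f z, z)))"
    using H by (simp add: nn_integral_distr[OF pm])
  also have "\<dots> = (\<integral>\<^sup>+x. (\<integral>\<^sup>+q. H q \<partial>distr (\<kappa> x) (N \<Otimes>\<^sub>M M) (Pair x)) \<partial>distr M N f)"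
    unfolding conditional_laws_joint(1)[OF cl M f]
    using conditional_laws_joint(2)[OF cl M f] by (intro nn_integral_bind[OF H]) simp
  also have "\<dots> = (\<integral>\<^sup>+x. (\<integral>\<^sup>+z. H (x, z) \<partial>\<kappa> x) \<partial>distr M N f)"
  proof (rule nn_integral_cong)
    fix x assume "x \<in> space (distr M N f)"
    then have x: "x \<in> space N" by simp
    have "Pair x \<in> \<kappa> x \<rightarrow>\<^sub>M N \<Otimes>\<^sub>M M" using x by (simp add: measurable_cong_sets[OF k(3)[OF x] refl])
    then show "(\<integral>\<^sup>+q. H q \<partial>distr (\<kappa> x) (N \<Otimes>\<^sub>M M) (Pair x)) = (\<integral>\<^sup>+z. H (x, z) \<partial>\<kappa> x)"
      using H by (simp add: nn_integral_distr)
  qed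
  finally show ?thesis .
qed

lemma conditional_laws_AE_finite:
  assumes cl: "conditional_laws M f N \<kappa>" and M: "prob_space M" and f: "f \<in> M \<rightarrow>\<^sub>M N"
    and H: "H \<in> borel_measurable (N \<Otimes>\<^sub>M M)" and fin: "(\<integral>\<^sup>+z. H (f z, z) \<partial>M) < \<infinity>"
  shows "(\<lambda>x. \<integral>\<^sup>+z. H (x, z) \<partial>\<kappa> x) \<in> borel_measurable N"
    "AE x in distr M N f. (\<integral>\<^sup>+z. H (x, z) \<partial>\<kappa> x) < \<infinity>"
proof -
  show m: "(\<lambda>x. \<integral>\<^sup>+z. H (x, z) \<partial>\<kappa> x) \<in> borel_measurable N"
    using nn_integral_measurable_subprob_algebra2[of "\<lambda>x z. H (x, z)" N M \<kappa>] H conditional_laws_kernel(1)[OF cl]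
    by simp
  have "AE x in distr M N f. (\<integral>\<^sup>+z. H (x, z) \<partial>\<kappa> x) \<noteq> \<infinity>"
    using m fin unfolding conditional_laws_nn_integral[OF cl M f H] by (intro nn_integral_noteq_infinite) auto
  then show "AE x in distr M N f. (\<integral>\<^sup>+z. H (x, z) \<partial>\<kappa> x) < \<infinity>"
    by eventually_elim (simp add: top.not_eq_extremum)
qed

text \<open>Positive and negative part are disintegrated separately. Each has a finite integral,
  hence a finite conditional integral for almost every x, and there the difference of the two is the
  conditional integral of \<open>H\<close>.\<close>

lemma conditional_laws_integral:
  fixes H :: "'x \<times> 'z \<Rightarrow> real"
  assumes cl: "conditional_laws M f N \<kappa>" and M: "prob_space M" and f: "f \<in> M \<rightarrow>\<^sub>M N"
    and H: "H \<in> borel_measurable (N \<Otimes>\<^sub>M M)" and int: "integrable M (\<lambda>z. H (f z, z))"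
  shows "AE x in distr M N f. integrable (\<kappa> x) (\<lambda>z. H (x, z))"
    "(\<integral>z. H (f z, z) \<partial>M) = (\<integral>x. (\<integral>z. H (x, z) \<partial>\<kappa> x) \<partial>distr M N f)"
proof -
  note k = conditional_laws_kernel[OF cl]
  let ?N = "distr M N f"
  have m: "(\<lambda>q. ennreal (H q)) \<in> borel_measurable (N \<Otimes>\<^sub>M M)" "(\<lambda>q. ennreal (- H q)) \<in> borel_measurable (N \<Otimes>\<^sub>M M)"
    using H by measurable
  have Hx: "(\<lambda>z. H (x, z)) \<in> borel_measurable (\<kappa> x)" if "x \<in> space N" for x
    using measurable_Pair2[OF H that] by (simp add: measurable_cong_sets[OF k(3)[OF that] refl])
  define p where "p x = (\<integral>\<^sup>+z. ennreal (H (x, z)) \<partial>\<kappa> x)" for x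
  define n where "n x = (\<integral>\<^sup>+z. ennreal (- H (x, z)) \<partial>\<kappa> x)" for x
  have fp: "(\<integral>\<^sup>+z. ennreal (H (f z, z)) \<partial>M) < \<infinity>" "(\<integral>\<^sup>+z. ennreal (- H (f z, z)) \<partial>M) < \<infinity>"
    using int unfolding real_integrable_def by (auto simp: top.not_eq_extremum)
  have pm: "p \<in> borel_measurable ?N" "AE x in ?N. p x < \<infinity>"
    unfolding p_def using conditional_laws_AE_finite[OF cl M f m(1) fp(1)] by simp_all
  have nm: "n \<in> borel_measurable ?N" "AE x in ?N. n x < \<infinity>"
    unfolding n_def using conditional_laws_AE_finite[OF cl M f m(2) fp(2)] by simp_all
  show "AE x in ?N. integrable (\<kappa> x) (\<lambda>z. H (x, z))"
    using pm(2) nm(2) AE_space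
    by eventually_elim (auto simp: real_integrable_def p_def n_def Hx)
  then have eq: "AE x in ?N. (\<integral>z. H (x, z) \<partial>\<kappa> x) = enn2real (p x) - enn2real (n x)"
    by eventually_elim (simp add: real_lebesgue_integral_def p_def n_def)
  have ip: "integrable ?N (\<lambda>x. enn2real (q x))" "(\<integral>x. enn2real (q x) \<partial>?N) = enn2real (\<integral>\<^sup>+x. q x \<partial>?N)"
    if q: "q \<in> borel_measurable ?N" "AE x in ?N. q x < \<infinity>" "(\<integral>\<^sup>+x. q x \<partial>?N) < \<infinity>" for q
  proof -
    have e: "(\<integral>\<^sup>+x. ennreal (enn2real (q x)) \<partial>?N) = (\<integral>\<^sup>+x. q x \<partial>?N)"
      by (rule nn_integral_cong_AE) (use q(2) in eventually_elim, simp)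
    show "integrable ?N (\<lambda>x. enn2real (q x))"
      by (rule integrableI_nonneg) (use q e in auto)
    show "(\<integral>x. enn2real (q x) \<partial>?N) = enn2real (\<integral>\<^sup>+x. q x \<partial>?N)"
      by (subst integral_eq_nn_integral) (use q e in auto)
  qed
  have nnp: "(\<integral>\<^sup>+x. p x \<partial>?N) = (\<integral>\<^sup>+z. ennreal (H (f z, z)) \<partial>M)"
    unfolding p_def using conditional_laws_nn_integral[OF cl M f m(1)] by simp
  have nnn: "(\<integral>\<^sup>+x. n x \<partial>?N) = (\<integral>\<^sup>+z. ennreal (- H (f z, z)) \<partial>M)"
    unfolding n_def using conditional_laws_nn_integral[OF cl M f m(2)] by simp
  note P = ip[OF pm fp(1)[folded nnp]] and Ng = ip[OF nm fp(2)[folded nnn]]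
  have "(\<lambda>x. \<integral>z. H (x, z) \<partial>\<kappa> x) \<in> borel_measurable N"
    using integral_measurable_kernel[of "\<lambda>x z. H (x, z)" N M \<kappa>] H k(1) by simp
  then have "(\<integral>x. (\<integral>z. H (x, z) \<partial>\<kappa> x) \<partial>?N) = (\<integral>x. enn2real (p x) - enn2real (n x) \<partial>?N)"
    using eq pm(1) nm(1) by (intro integral_cong_AE) auto
  also have "\<dots> = enn2real (\<integral>\<^sup>+z. ennreal (H (f z, z)) \<partial>M) - enn2real (\<integral>\<^sup>+z. ennreal (- H (f z, z)) \<partial>M)"
    using P Ng nnp nnn by simp
  also have "\<dots> = (\<integral>z. H (f z, z) \<partial>M)" by (rule real_lebesgue_integral_def[OF int, symmetric])
  finally show "(\<integral>z. H (f z, z) \<partial>M) = (\<integral>x. (\<integral>z. H (x, z) \<partial>\<kappa> x) \<partial>?N)" ..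
qed

text \<open>Nonnegativity of the variance; \<open>h\<close> itself is integrable because |h| \<le> 1
  + |h|^2.\<close>

lemma (in prob_space) norm_mean_sq_le:
  fixes h :: "'a \<Rightarrow> 'b::euclidean_space"
  assumes h: "h \<in> borel_measurable M" and sq: "integrable M (\<lambda>z. (norm (h z))\<^sup>2)"
  shows "integrable M h" "(norm (expectation h))\<^sup>2 \<le> expectation (\<lambda>z. (norm (h z))\<^sup>2)"
proof -
  have i1: "integrable M (\<lambda>z. 1 + (norm (h z))\<^sup>2)" using sq by simp
  have b: "norm (h z) \<le> 1 + (norm (h z))\<^sup>2" for z
    by (rule le_one_plus_sq)
  show ih: "integrable M h" by (rule norm_integral_le(1)[OF h i1 b])
  define c where "c = expectation h"
  have "0 \<le> expectation (\<lambda>z. (norm (h z - c))\<^sup>2)" by simp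
  also have "\<dots> = expectation (\<lambda>z. (norm (h z))\<^sup>2 - 2 * (h z \<bullet> c) + (norm c)\<^sup>2)"
    by (simp add: power2_norm_eq_inner inner_diff_left inner_diff_right inner_commute algebra_simps)
  also have "\<dots> = expectation (\<lambda>z. (norm (h z))\<^sup>2) - 2 * (c \<bullet> c) + (norm c)\<^sup>2"
    using sq ih unfolding c_def by (simp add: prob_space)
  finally show "(norm (expectation h))\<^sup>2 \<le> expectation (\<lambda>z. (norm (h z))\<^sup>2)"
    unfolding c_def by (simp add: power2_norm_eq_inner)
qed

section \<open>Conditional means of square-integrable functions\<close>

context
  fixes M :: "'z measure" and f :: "'z \<Rightarrow> 'x" and N :: "'x measure" and \<kappa> :: "'x \<Rightarrow> 'z measure"
    and h :: "'z \<Rightarrow> 'b::euclidean_space"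
  assumes cl: "conditional_laws M f N \<kappa>" and M: "prob_space M" and f: "f \<in> M \<rightarrow>\<^sub>M N"
    and h: "h \<in> borel_measurable M" and h_sq: "integrable M (\<lambda>z. (norm (h z))\<^sup>2)"
begin

interpretation M: prob_space M by (rule M)

lemma cond_mean_meas: "(\<lambda>x. \<integral>z. h z \<partial>\<kappa> x) \<in> borel_measurable N"
  using integral_measurable_kernel[of "\<lambda>x z. h z" N M \<kappa>] h conditional_laws_kernel(1)[OF cl]
  by simp

lemma cond_sq_AE: "AE x in distr M N f. integrable (\<kappa> x) (\<lambda>z. (norm (h z))\<^sup>2)"
  using conditional_laws_integral(1)[OF cl M f, of "\<lambda>q. (norm (h (snd q)))\<^sup>2"] h h_sq by simp

lemma cond_int_AE: "AE x in distr M N f. integrable (\<kappa> x) h"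
  using cond_sq_AE AE_space
proof eventually_elim
  case (elim x)
  then have x: "x \<in> space N" by simp
  have "h \<in> borel_measurable (\<kappa> x)" using h by (simp add: measurable_cong_sets[OF conditional_laws_kernel(3)[OF cl x] refl])
  then show ?case
    using prob_space.norm_mean_sq_le(1)[OF conditional_laws_kernel(2)[OF cl x]] elim by blast
qed

lemma cond_mean_sq_AE:
  "AE x in distr M N f. (norm (\<integral>z. h z \<partial>\<kappa> x))\<^sup>2 \<le> (\<integral>z. (norm (h z))\<^sup>2 \<partial>\<kappa> x)"
  using cond_sq_AE AE_space
proof eventually_elim
  case (elim x)
  then have x: "x \<in> space N" by simp
  have "h \<in> borel_measurable (\<kappa> x)" using h by (simp add: measurable_cong_sets[OF conditional_laws_kernel(3)[OF cl x] refl])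
  then show ?case
    using prob_space.norm_mean_sq_le(2)[OF conditional_laws_kernel(2)[OF cl x]] elim by blast
qed

text \<open>Conditional expectation is a contraction in L2: the variance inequality under
  \<open>\<kappa> x\<close>, averaged over x. Nonnegative integrals come first, as integrability is
  part of the claim.\<close>

lemma cond_mean_sq:
  "integrable (distr M N f) (\<lambda>x. (norm (\<integral>z. h z \<partial>\<kappa> x))\<^sup>2)"
  "(\<integral>x. (norm (\<integral>z. h z \<partial>\<kappa> x))\<^sup>2 \<partial>distr M N f) \<le> (\<integral>z. (norm (h z))\<^sup>2 \<partial>M)"
proof -
  let ?N = "distr M N f"
  let ?e = "\<lambda>x. (norm (\<integral>z. h z \<partial>\<kappa> x))\<^sup>2"
  have m: "?e \<in> borel_measurable ?N" using cond_mean_meas by measurable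
  have "(\<integral>\<^sup>+x. ennreal (?e x) \<partial>?N) \<le> (\<integral>\<^sup>+x. (\<integral>\<^sup>+z. ennreal ((norm (h z))\<^sup>2) \<partial>\<kappa> x) \<partial>?N)"
  proof (rule nn_integral_mono_AE)
    show "AE x in ?N. ennreal (?e x) \<le> (\<integral>\<^sup>+z. ennreal ((norm (h z))\<^sup>2) \<partial>\<kappa> x)"
      using cond_sq_AE cond_mean_sq_AE
      by eventually_elim (simp add: nn_integral_eq_integral)
  qed
  also have "\<dots> = (\<integral>\<^sup>+z. ennreal ((norm (h z))\<^sup>2) \<partial>M)"
    using conditional_laws_nn_integral[OF cl M f, of "\<lambda>q. ennreal ((norm (h (snd q)))\<^sup>2)"] h by simp
  also have "\<dots> = ennreal (\<integral>z. (norm (h z))\<^sup>2 \<partial>M)" by (rule nn_integral_eq_integral[OF h_sq]) simp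
  finally have le: "(\<integral>\<^sup>+x. ennreal (?e x) \<partial>?N) \<le> ennreal (\<integral>z. (norm (h z))\<^sup>2 \<partial>M)" .
  show i: "integrable ?N ?e"
    using m le by (intro integrableI_nonneg) (auto intro: le_less_trans)
  have "ennreal (\<integral>x. ?e x \<partial>?N) \<le> ennreal (\<integral>z. (norm (h z))\<^sup>2 \<partial>M)"
    using le nn_integral_eq_integral[OF i] by simp
  then show "(\<integral>x. ?e x \<partial>?N) \<le> (\<integral>z. (norm (h z))\<^sup>2 \<partial>M)" by (simp add: ennreal_le_iff)
qed

text \<open>Pulling out what is known: the integrand
  \<open>\<psi> (fst q) \<bullet> h (snd q)\<close> on pairs turns the factor \<psi> (f z) into the
  constant \<psi> x under \<open>\<kappa> x\<close>.\<close>

lemma cond_mean_inner: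
  assumes ps: "\<psi> \<in> borel_measurable N" and int: "integrable M (\<lambda>z. \<psi> (f z) \<bullet> h z)"
  shows "(\<integral>z. \<psi> (f z) \<bullet> h z \<partial>M) = (\<integral>z. \<psi> (f z) \<bullet> (\<integral>z'. h z' \<partial>\<kappa> (f z)) \<partial>M)"
proof -
  have "(\<integral>z. \<psi> (f z) \<bullet> h z \<partial>M) = (\<integral>x. (\<integral>z. \<psi> x \<bullet> h z \<partial>\<kappa> x) \<partial>distr M N f)"
    using conditional_laws_integral(2)[OF cl M f, of "\<lambda>q. \<psi> (fst q) \<bullet> h (snd q)"] ps h int by simp
  also have "\<dots> = (\<integral>x. \<psi> x \<bullet> (\<integral>z. h z \<partial>\<kappa> x) \<partial>distr M N f)"
  proof (rule integral_cong_AE)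
    show "AE x in distr M N f. (\<integral>z. \<psi> x \<bullet> h z \<partial>\<kappa> x) = \<psi> x \<bullet> (\<integral>z. h z \<partial>\<kappa> x)"
      using cond_int_AE by eventually_elim simp
    show "(\<lambda>x. \<integral>z. \<psi> x \<bullet> h z \<partial>\<kappa> x) \<in> borel_measurable (distr M N f)"
      using integral_measurable_kernel[of "\<lambda>x z. \<psi> x \<bullet> h z" N M \<kappa>] ps h conditional_laws_kernel(1)[OF cl]
      by simp
    show "(\<lambda>x. \<psi> x \<bullet> (\<integral>z. h z \<partial>\<kappa> x)) \<in> borel_measurable (distr M N f)"
      using ps cond_mean_meas by simp
  qed
  also have "\<dots> = (\<integral>z. \<psi> (f z) \<bullet> (\<integral>z'. h z' \<partial>\<kappa> (f z)) \<partial>M)"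
    using ps cond_mean_meas by (intro integral_distr[OF f]) simp
  finally show ?thesis .
qed

lemma integrable_inner_sq:
  fixes p q :: "'z \<Rightarrow> 'b"
  assumes "p \<in> borel_measurable M" "q \<in> borel_measurable M"
    and "integrable M (\<lambda>z. (norm (p z))\<^sup>2)" "integrable M (\<lambda>z. (norm (q z))\<^sup>2)"
  shows "integrable M (\<lambda>z. p z \<bullet> q z)"
proof (rule norm_integral_le(1)[where g="\<lambda>z. (norm (p z))\<^sup>2 + (norm (q z))\<^sup>2"])
  show "norm (p z \<bullet> q z) \<le> (norm (p z))\<^sup>2 + (norm (q z))\<^sup>2" for z
  proof -
    have "norm (p z \<bullet> q z) \<le> norm (p z) * norm (q z)" using Cauchy_Schwarz_ineq2 by simp
    moreover have "2 * (norm (p z) * norm (q z)) \<le> (norm (p z))\<^sup>2 + (norm (q z))\<^sup>2"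
      using sum_squares_bound[of "norm (p z)" "norm (q z)"] by (simp add: mult.assoc)
    moreover have "0 \<le> norm (p z) * norm (q z)" by simp
    ultimately show ?thesis by linarith
  qed
qed (use assms in auto)

lemma integrable_diff_sq:
  fixes p q :: "'z \<Rightarrow> 'b"
  assumes "p \<in> borel_measurable M" "q \<in> borel_measurable M"
    and "integrable M (\<lambda>z. (norm (p z))\<^sup>2)" "integrable M (\<lambda>z. (norm (q z))\<^sup>2)"
  shows "integrable M (\<lambda>z. (norm (p z - q z))\<^sup>2)"
proof -
  have "(norm (p z - q z))\<^sup>2 = (norm (p z))\<^sup>2 - 2 * (p z \<bullet> q z) + (norm (q z))\<^sup>2" for z
    by (simp add: power2_norm_eq_inner inner_diff_left inner_diff_right inner_commute algebra_simps)
  then show ?thesis using assms integrable_inner_sq[OF assms] by simp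
qed

text \<open>Pythagoras: the residual \<open>h z - E (f z)\<close> is orthogonal to \<open>d\<close>,
  which depends on z through f only, so the error of the competitor exceeds the optimal one by the
  squared norm of \<open>d\<close>.\<close>

lemma cond_mean_projection:
  assumes g: "g \<in> borel_measurable N" and g_sq: "integrable (distr M N f) (\<lambda>x. (norm (g x))\<^sup>2)"
  shows "(\<integral>z. (norm (h z - (\<integral>z'. h z' \<partial>\<kappa> (f z))))\<^sup>2 \<partial>M) \<le> (\<integral>z. (norm (h z - g (f z)))\<^sup>2 \<partial>M)"
proof -
  define E where "E x = (\<integral>z. h z \<partial>\<kappa> x)" for x
  have Em: "E \<in> borel_measurable N" unfolding E_def by (rule cond_mean_meas)
  have m: "(\<lambda>z. E (f z)) \<in> borel_measurable M" "(\<lambda>z. g (f z)) \<in> borel_measurable M"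
    using measurable_compose[OF f] Em g by auto
  have sq: "integrable M (\<lambda>z. (norm (E (f z)))\<^sup>2)" "integrable M (\<lambda>z. (norm (g (f z)))\<^sup>2)"
    using cond_mean_sq(1) g_sq integrable_distr_eq[OF f, of "\<lambda>x. (norm (E x))\<^sup>2"]
      integrable_distr_eq[OF f, of "\<lambda>x. (norm (g x))\<^sup>2"] Em g unfolding E_def by auto
  define d where "d z = E (f z) - g (f z)" for z
  have dm: "d \<in> borel_measurable M" unfolding d_def using m by measurable
  have dsq: "integrable M (\<lambda>z. (norm (d z))\<^sup>2)" unfolding d_def by (rule integrable_diff_sq[OF m sq])
  have rsq: "integrable M (\<lambda>z. (norm (h z - E (f z)))\<^sup>2)" by (rule integrable_diff_sq[OF h m(1) h_sq sq(1)])
  have i1: "integrable M (\<lambda>z. d z \<bullet> h z)" by (rule integrable_inner_sq[OF dm h dsq h_sq])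
  have i2: "integrable M (\<lambda>z. d z \<bullet> E (f z))" by (rule integrable_inner_sq[OF dm m(1) dsq sq(1)])
  have orth: "(\<integral>z. d z \<bullet> h z \<partial>M) = (\<integral>z. d z \<bullet> E (f z) \<partial>M)"
    using cond_mean_inner[of "\<lambda>x. E x - g x"] i1 Em g unfolding d_def E_def by simp
  have "(norm (h z - g (f z)))\<^sup>2 = (norm (h z - E (f z)))\<^sup>2 + (norm (d z))\<^sup>2 + 2 * (d z \<bullet> h z - d z \<bullet> E (f z))" for z
    unfolding d_def by (simp add: power2_norm_eq_inner inner_diff_left inner_diff_right inner_commute algebra_simps)
  then have "(\<integral>z. (norm (h z - g (f z)))\<^sup>2 \<partial>M)
      = (\<integral>z. (norm (h z - E (f z)))\<^sup>2 \<partial>M) + (\<integral>z. (norm (d z))\<^sup>2 \<partial>M)"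
    using rsq dsq i1 i2 orth by simp
  moreover have "0 \<le> (\<integral>z. (norm (d z))\<^sup>2 \<partial>M)" by simp
  ultimately show ?thesis unfolding E_def by simp
qed

end

text \<open>The elementary half of Kantorovich duality, for vector-valued \<open>h\<close>.
  Integrability under \<open>N\<close> is a conclusion, because a coupling of finite cost transfers
  it from \<open>M\<close>.\<close>

lemma wasserstein1_lipschitz_mean:
  fixes h :: "'c::{metric_space, second_countable_topology} \<Rightarrow> 'b::euclidean_space"
  assumes M: "prob_space M" "sets M = sets (subspace_borel G)"
    and N: "prob_space N" "sets N = sets (subspace_borel G)"
    and h: "h \<in> borel_measurable (subspace_borel G)"
    and lip: "\<And>z z'. z \<in> G \<Longrightarrow> z' \<in> G \<Longrightarrow> norm (h z - h z') \<le> L * dist z z'" and L: "0 \<le> L"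
    and int: "integrable M h" and W: "wasserstein1 M N \<le> ennreal c" and c: "0 \<le> c"
  shows "integrable N h" "norm ((\<integral>z. h z \<partial>M) - (\<integral>z. h z \<partial>N)) \<le> L * c"
proof -
  have hM: "h \<in> borel_measurable M" "h \<in> borel_measurable N"
    using h by (simp_all add: measurable_cong_sets[OF M(2) refl] measurable_cong_sets[OF N(2) refl])
  have main: "integrable N h \<and> norm ((\<integral>z. h z \<partial>M) - (\<integral>z. h z \<partial>N)) \<le> L * (c + d)" if d: "0 < d" for d
  proof -
    \<comment> \<open>The infimum over couplings may not be attained, so a coupling of cost below
      \<open>c + d\<close> is taken.\<close>
    have "ennreal c < ennreal (c + d)" using c d by (intro ennreal_lessI) auto
    with W have "wasserstein1 M N < ennreal (c + d)" by (rule le_less_trans)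
    then obtain \<pi> where pi: "\<pi> \<in> couplings M N" and cost: "(\<integral>\<^sup>+p. ennreal (dist (fst p) (snd p)) \<partial>\<pi>) < ennreal (c + d)"
      unfolding wasserstein1_def by (auto simp: INF_less_iff)
    have sp: "sets \<pi> = sets (M \<Otimes>\<^sub>M N)" and d1: "distr \<pi> M fst = M" and d2: "distr \<pi> N snd = N"
      using pi unfolding couplings_def by auto
    have space: "space \<pi> = G \<times> G"
      using sets_eq_imp_space_eq[OF sp] sets_eq_imp_space_eq[OF M(2)] sets_eq_imp_space_eq[OF N(2)]
      by (simp add: space_pair_measure subspace_borel_def space_restrict_space)
    have f1: "fst \<in> \<pi> \<rightarrow>\<^sub>M M" and f2: "snd \<in> \<pi> \<rightarrow>\<^sub>M N" by (simp_all add: measurable_cong_sets[OF sp refl])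
    have idG: "(\<lambda>z. z) \<in> borel_measurable (subspace_borel G)"
      unfolding subspace_borel_def by (intro measurable_restrict_space1) simp
    have b1: "fst \<in> borel_measurable \<pi>" "snd \<in> borel_measurable \<pi>"
      using measurable_compose[OF f1, of "\<lambda>z. z" borel] measurable_compose[OF f2, of "\<lambda>z. z" borel] idG
      by (simp_all add: measurable_cong_sets[OF M(2) refl] measurable_cong_sets[OF N(2) refl])
    have dm: "(\<lambda>p. dist (fst p) (snd p)) \<in> borel_measurable \<pi>" using b1 by (intro borel_measurable_dist)
    have di: "integrable \<pi> (\<lambda>p. dist (fst p) (snd p))"
      using dm cost by (intro integrableI_nonneg) (auto intro: less_trans)
    have dc: "(\<integral>p. dist (fst p) (snd p) \<partial>\<pi>) \<le> c + d"
    proof -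
      have "ennreal (\<integral>p. dist (fst p) (snd p) \<partial>\<pi>) < ennreal (c + d)"
        using cost nn_integral_eq_integral[OF di] by simp
      then show ?thesis by (subst (asm) ennreal_less_iff) auto
    qed
    have i1: "integrable \<pi> (\<lambda>p. h (fst p))"
      using integrable_distr_eq[OF f1 hM(1)] int d1 by simp
    have m2: "(\<lambda>p. h (snd p)) \<in> borel_measurable \<pi>" using measurable_compose[OF f2 hM(2)] .
    have dmeas: "(\<lambda>p. h (fst p) - h (snd p)) \<in> borel_measurable \<pi>" using i1 m2 by simp
    have dL: "integrable \<pi> (\<lambda>p. L * dist (fst p) (snd p))" using di by simp
    have db: "norm (h (fst p) - h (snd p)) \<le> L * dist (fst p) (snd p)" if "p \<in> space \<pi>" for p
      using that lip[of "fst p" "snd p"] unfolding space by auto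
    note diff = norm_integral_le[OF dmeas dL db]
    have i2: "integrable \<pi> (\<lambda>p. h (snd p))"
      using Bochner_Integration.integrable_diff[OF i1 diff(1)] by simp
    then have iN: "integrable N h" using integrable_distr_eq[OF f2 hM(2)] d2 by simp
    have "(\<integral>z. h z \<partial>M) = (\<integral>p. h (fst p) \<partial>\<pi>)" "(\<integral>z. h z \<partial>N) = (\<integral>p. h (snd p) \<partial>\<pi>)"
      using integral_distr[OF f1 hM(1)] integral_distr[OF f2 hM(2)] d1 d2 by simp_all
    then have "norm ((\<integral>z. h z \<partial>M) - (\<integral>z. h z \<partial>N)) \<le> L * (\<integral>p. dist (fst p) (snd p) \<partial>\<pi>)"
      using diff(2) i1 i2 by simp
    also have "\<dots> \<le> L * (c + d)" using dc L by (intro mult_left_mono)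
    finally show ?thesis using iN by simp
  qed
  show "integrable N h" using main[of 1] by simp
  show "norm ((\<integral>z. h z \<partial>M) - (\<integral>z. h z \<partial>N)) \<le> L * c"
  proof (rule field_le_epsilon)
    fix e :: real assume e: "0 < e"
    \<comment> \<open>The denominator \<open>L + 1\<close> covers L = 0 as well.\<close>
    have "norm ((\<integral>z. h z \<partial>M) - (\<integral>z. h z \<partial>N)) \<le> L * (c + e / (L + 1))" using main[of "e / (L + 1)"] e L by simp
    also have "\<dots> \<le> L * c + e" using e L by (simp add: field_simps)
    finally show "norm ((\<integral>z. h z \<partial>M) - (\<integral>z. h z \<partial>N)) \<le> L * c + e" .
  qed
qed

section \<open>Lipschitz flows\<close>

text \<open>The offset \<delta> serves two purposes: 1 for the growth of one trajectory, 0 for the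
  distance of two. \<open>C\<close> comes from \<kappa> and \<open>T\<close> alone and is therefore
  uniform over all initial values.\<close>

lemma linear_growth_bound:
  fixes \<kappa> :: "real \<Rightarrow> real"
  assumes \<kappa>: "\<kappa> absolutely_integrable_on {0..T}" and \<kappa>0: "\<And>s. s \<in> {0..T} \<Longrightarrow> 0 \<le> \<kappa> s"
  obtains C where "1 \<le> C"
    "\<And>(w :: real \<Rightarrow> 'b::euclidean_space) c \<delta> t. 0 \<le> \<delta> \<Longrightarrow> c absolutely_integrable_on {0..T} \<Longrightarrow>
      (\<And>t. t \<in> {0..T} \<Longrightarrow> w t = w 0 + integral {0..t} c) \<Longrightarrow>
      (\<And>s. s \<in> {0..T} \<Longrightarrow> norm (c s) \<le> \<kappa> s * (\<delta> + norm (w s))) \<Longrightarrow>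
      t \<in> {0..T} \<Longrightarrow> \<delta> + norm (w t) \<le> C * (\<delta> + norm (w 0))"
proof -
  obtain C where C1: "1 \<le> C" and C: "\<And>g t. (\<And>s. s \<in> {0..T} \<Longrightarrow> 0 \<le> g s) \<Longrightarrow> bdd_above (g ` {0..T}) \<Longrightarrow>
      (\<And>r t S. 0 \<le> r \<Longrightarrow> r \<le> t \<Longrightarrow> t \<le> T \<Longrightarrow> (\<And>s. s \<in> {r..t} \<Longrightarrow> g s \<le> S) \<Longrightarrow>
        g t \<le> g r + S * integral {r..t} \<kappa>) \<Longrightarrow>
      t \<in> {0..T} \<Longrightarrow> g t \<le> C * g 0"
    using gronwall_sup[OF \<kappa> \<kappa>0] by metis
  show ?thesis
  proof (rule that[OF C1])
    fix w :: "real \<Rightarrow> 'b" and c \<delta> t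
    assume \<delta>: "0 \<le> \<delta>" and c: "c absolutely_integrable_on {0..T}"
      and w: "\<And>t. t \<in> {0..T} \<Longrightarrow> w t = w 0 + integral {0..t} c"
      and le: "\<And>s. s \<in> {0..T} \<Longrightarrow> norm (c s) \<le> \<kappa> s * (\<delta> + norm (w s))"
      and t: "t \<in> {0..T}"
    show "\<delta> + norm (w t) \<le> C * (\<delta> + norm (w 0))"
    proof (rule C[OF _ _ _ t])
      have "c integrable_on {0..T}" using abs_int_subinterval_on[OF c] by simp
      then have "continuous_on {0..T} (\<lambda>t. \<delta> + norm (w 0 + integral {0..t} c))"
        by (intro continuous_intros indefinite_integral_continuous_1)
      then have "continuous_on {0..T} (\<lambda>t. \<delta> + norm (w t))"
      proof (rule continuous_on_eq)
        fix q assume "q \<in> {0..T}"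
        from w[OF this] show "\<delta> + norm (w 0 + integral {0..q} c) = \<delta> + norm (w q)" by simp
      qed
      then show "bdd_above ((\<lambda>t. \<delta> + norm (w t)) ` {0..T})"
        by (intro bounded_imp_bdd_above compact_imp_bounded compact_continuous_image) auto
    next
      fix r t S assume rt: "0 \<le> r" "r \<le> t" "t \<le> T" and S: "\<And>s. s \<in> {r..t} \<Longrightarrow> \<delta> + norm (w s) \<le> S"
      have ci: "c integrable_on {r..t}" "\<kappa> integrable_on {r..t}"
        using abs_int_subinterval_on[OF _ rt(1,3)] c \<kappa> by auto
      have "norm (integral {r..t} c) \<le> integral {r..t} (\<lambda>s. S * \<kappa> s)"
      proof (rule Henstock_Kurzweil_Integration.integral_norm_bound_integral[OF ci(1)])
        show "(\<lambda>s. S * \<kappa> s) integrable_on {r..t}" using ci(2) by (rule integrable_on_mult_right)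
        fix s assume s: "s \<in> {r..t}"
        have sT: "s \<in> {0..T}" using s rt by auto
        have "norm (c s) \<le> \<kappa> s * (\<delta> + norm (w s))" by (rule le[OF sT])
        also have "\<dots> \<le> \<kappa> s * S" using S[OF s] \<kappa>0[OF sT] by (rule mult_left_mono)
        finally show "norm (c s) \<le> S * \<kappa> s" by (simp add: mult.commute)
      qed
      also have "\<dots> = S * integral {r..t} \<kappa>" by simp
      finally have I: "norm (integral {r..t} c) \<le> S * integral {r..t} \<kappa>" .
      have "w t = w r + integral {r..t} c"
        using w[of t] w[of r] integral_combine_diff[OF c rt] rt by simp
      then have "norm (w t) \<le> norm (w r) + norm (integral {r..t} c)" by (simp add: norm_triangle_ineq)
      then show "\<delta> + norm (w t) \<le> \<delta> + norm (w r) + S * integral {r..t} \<kappa>" using I by simp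
    qed (use \<delta> in auto)
  qed
qed

text \<open>
  Only measurability in \<open>s\<close> along each single path is known. The Lipschitz dependence on the
  parameter \<open>p\<close> transfers it to joint measurability through a countable dense family of paths.
\<close>
lemma joint_measurable_of_lipschitz_parameter:
  fixes c :: "real \<Rightarrow> 'w \<Rightarrow> 'b::euclidean_space" and p :: "'w \<Rightarrow> 'a::euclidean_space"
  assumes W: "W \<in> sets M" and p: "p \<in> borel_measurable M"
    and c: "\<And>w. w \<in> W \<Longrightarrow> (\<lambda>s. c s w) \<in> borel_measurable (lebesgue_on {0..T})"
    and lip: "\<And>s w w'. s \<in> {0..T} \<Longrightarrow> w \<in> W \<Longrightarrow> w' \<in> W \<Longrightarrow> norm (c s w - c s w') \<le> C s * norm (p w - p w')"
  shows "(\<lambda>(s,w). if w \<in> W then c s w else 0) \<in> borel_measurable (lebesgue_on {0..T} \<Otimes>\<^sub>M M)"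
proof (cases "W = {}")
  case False
  \<comment> \<open>The dense set lies in the image of \<open>W\<close>, so every approximating
    parameter belongs to an actual path and \<open>lip\<close> applies to it.\<close>
  obtain E where E: "countable E" "E \<subseteq> p ` W" "p ` W \<subseteq> closure E" using separable by metis
  have "E \<noteq> {}" using E(3) False by auto
  define e where "e = from_nat_into E"
  have range_e: "range e = E" unfolding e_def using \<open>E \<noteq> {}\<close> E(1) by (rule range_from_nat_into)
  have "\<exists>w\<in>W. p w = e j" for j using range_e E(2) by (metis imageE range_eqI subsetD)
  then obtain q where q: "\<And>j. q j \<in> W" "\<And>j. p (q j) = e j" by metis
  \<comment> \<open>Taking the least admissible index makes the choice of the nearby path
    measurable, with countably many values.\<close>
  define J where "J n w = (LEAST j. dist (e j) (p w) < 1 / real (Suc n))" for n w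
  have J: "dist (e (J n w)) (p w) < 1 / real (Suc n)" if "w \<in> W" for n w
  proof -
    have "p w \<in> closure E" using E(3) that by blast
    then have "\<exists>y\<in>E. dist y (p w) < 1 / real (Suc n)"
      unfolding closure_approachable by (rule spec[of _ "1 / real (Suc n)", THEN mp]) simp
    then have "\<exists>j. dist (e j) (p w) < 1 / real (Suc n)" using range_e by blast
    then show ?thesis unfolding J_def by (rule LeastI_ex)
  qed
  have Jm: "J n \<in> M \<rightarrow>\<^sub>M count_space UNIV" for n
    unfolding J_def using p by measurable
  define f where "f n = (\<lambda>z :: real \<times> 'w. if snd z \<in> W then c (fst z) (q (J n (snd z))) else 0)" for n
  show ?thesis
  proof (rule borel_measurable_LIMSEQ_metric[where f=f])
    fix n
    show "f n \<in> borel_measurable (lebesgue_on {0..T} \<Otimes>\<^sub>M M)"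
      unfolding f_def
    proof (rule measurable_compose_countable[where f="\<lambda>j z. if snd z \<in> W then c (fst z) (q j) else 0"
          and g="\<lambda>z. J n (snd z)"])
      show "(\<lambda>z. if snd z \<in> W then c (fst z) (q j) else 0) \<in> borel_measurable (lebesgue_on {0..T} \<Otimes>\<^sub>M M)" for j
      proof (rule measurable_If)
        show "(\<lambda>z. c (fst z) (q j)) \<in> borel_measurable (lebesgue_on {0..T} \<Otimes>\<^sub>M M)"
          using measurable_compose[OF measurable_fst c[OF q(1)]] .
        have "{z \<in> space (lebesgue_on {0..T} \<Otimes>\<^sub>M M). snd z \<in> W} = {0..T} \<times> W"
          using sets.sets_into_space[OF W] by (auto simp: space_pair_measure)
        moreover have "{0..T} \<times> W \<in> sets (lebesgue_on {0..T} \<Otimes>\<^sub>M M)"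
          using W by (intro pair_measureI) auto
        ultimately show "{z \<in> space (lebesgue_on {0..T} \<Otimes>\<^sub>M M). snd z \<in> W} \<in> sets (lebesgue_on {0..T} \<Otimes>\<^sub>M M)"
          by simp
      qed simp
      show "(\<lambda>z. J n (snd z)) \<in> lebesgue_on {0..T} \<Otimes>\<^sub>M M \<rightarrow>\<^sub>M count_space UNIV"
        using measurable_compose[OF measurable_snd Jm] .
    qed
  next
    fix z assume "z \<in> space (lebesgue_on {0..T} \<Otimes>\<^sub>M M)"
    then have s: "fst z \<in> {0..T}" by (auto simp: space_pair_measure)
    show "(\<lambda>n. f n z) \<longlonglongrightarrow> (case z of (s, w) \<Rightarrow> if w \<in> W then c s w else 0)"
    proof (cases "snd z \<in> W")
      case True
      have "(\<lambda>n. c (fst z) (q (J n (snd z)))) \<longlonglongrightarrow> c (fst z) (snd z)"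
      proof (rule LIM_zero_cancel, rule Lim_null_comparison)
        show "\<forall>\<^sub>F n in sequentially. norm (c (fst z) (q (J n (snd z))) - c (fst z) (snd z)) \<le> \<bar>C (fst z)\<bar> / real (Suc n)"
        proof (intro always_eventually allI)
          fix n
          have "norm (c (fst z) (q (J n (snd z))) - c (fst z) (snd z)) \<le> C (fst z) * norm (e (J n (snd z)) - p (snd z))"
            using lip[OF s q(1) True, of "J n (snd z)"] q(2) by simp
          also have "\<dots> \<le> \<bar>C (fst z)\<bar> * (1 / real (Suc n))"
            using J[OF True, of n] by (intro mult_mono) (auto simp: dist_norm)
          finally show "norm (c (fst z) (q (J n (snd z))) - c (fst z) (snd z)) \<le> \<bar>C (fst z)\<bar> / real (Suc n)" by simp
        qed
        show "(\<lambda>n. \<bar>C (fst z)\<bar> / real (Suc n)) \<longlonglongrightarrow> 0" by (rule LIMSEQ_Suc[OF lim_const_over_n])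
      qed
      then show ?thesis unfolding f_def using True by (simp add: split_beta)
    qed (simp add: f_def split_beta)
  qed
qed simp

text \<open>Gronwall makes trajectories Lipschitz in their initial value. With \<open>U 0\<close> as
  parameter, measurability in time along single trajectories then becomes joint measurability of
  position and velocity. It is applied to the full system and to the surrogate.\<close>

lemma lipschitz_flow:
  fixes U :: "real \<Rightarrow> 'w \<Rightarrow> 'c::euclidean_space" and F :: "real \<Rightarrow> 'c \<Rightarrow> 'c"
  assumes \<kappa>: "\<kappa> absolutely_integrable_on {0..T}" and \<kappa>0: "\<And>s. s \<in> {0..T} \<Longrightarrow> 0 \<le> \<kappa> s"
    and W: "W \<in> sets M" and U0: "U 0 \<in> borel_measurable M"
    and inS: "\<And>s w. s \<in> {0..T} \<Longrightarrow> w \<in> W \<Longrightarrow> U s w \<in> S"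
    and lip: "\<And>s p q. s \<in> {0..T} \<Longrightarrow> p \<in> S \<Longrightarrow> q \<in> S \<Longrightarrow> norm (F s p - F s q) \<le> \<kappa> s * norm (p - q)"
    and grow: "\<And>s p. s \<in> {0..T} \<Longrightarrow> p \<in> S \<Longrightarrow> norm (F s p) \<le> \<kappa> s * (1 + norm p)"
    and int: "\<And>w. w \<in> W \<Longrightarrow> (\<lambda>s. F s (U s w)) absolutely_integrable_on {0..T}"
    and eq: "\<And>w t. w \<in> W \<Longrightarrow> t \<in> {0..T} \<Longrightarrow> U t w = U 0 w + integral {0..t} (\<lambda>s. F s (U s w))"
  obtains C where "1 \<le> C" "\<And>t w. t \<in> {0..T} \<Longrightarrow> w \<in> W \<Longrightarrow> 1 + norm (U t w) \<le> C * (1 + norm (U 0 w))"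
    "(\<lambda>(s,w). if w \<in> W then U s w else 0) \<in> borel_measurable (lebesgue_on {0..T} \<Otimes>\<^sub>M M)"
    "(\<lambda>(s,w). if w \<in> W then F s (U s w) else 0) \<in> borel_measurable (lebesgue_on {0..T} \<Otimes>\<^sub>M M)"
proof -
  obtain C where C1: "1 \<le> C" and C:
    "\<And>(w :: real \<Rightarrow> 'c) c \<delta> t. 0 \<le> \<delta> \<Longrightarrow> c absolutely_integrable_on {0..T} \<Longrightarrow>
      (\<And>t. t \<in> {0..T} \<Longrightarrow> w t = w 0 + integral {0..t} c) \<Longrightarrow>
      (\<And>s. s \<in> {0..T} \<Longrightarrow> norm (c s) \<le> \<kappa> s * (\<delta> + norm (w s))) \<Longrightarrow>
      t \<in> {0..T} \<Longrightarrow> \<delta> + norm (w t) \<le> C * (\<delta> + norm (w 0))"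
    using linear_growth_bound[OF \<kappa> \<kappa>0, where 'b='c] by metis
  have stable: "norm (U t w - U t w') \<le> C * norm (U 0 w - U 0 w')"
    if t: "t \<in> {0..T}" and w: "w \<in> W" "w' \<in> W" for t w w'
  proof -
    \<comment> \<open>The difference of two trajectories solves a linear inequality without
      inhomogeneity, hence \<delta> = 0.\<close>
    have "0 + norm (U t w - U t w') \<le> C * (0 + norm (U 0 w - U 0 w'))"
    proof (rule C[where c="\<lambda>s. F s (U s w) - F s (U s w')", OF _ _ _ _ t])
      show "(\<lambda>s. F s (U s w) - F s (U s w')) absolutely_integrable_on {0..T}"
        using int[OF w(1)] int[OF w(2)] by (rule set_integral_diff(1))
      fix q assume q: "q \<in> {0..T}"
      have "(\<lambda>s. F s (U s w)) integrable_on {0..q}" "(\<lambda>s. F s (U s w')) integrable_on {0..q}"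
        using abs_int_subinterval_on[OF int] w q by auto
      then show "U q w - U q w' = U 0 w - U 0 w' + integral {0..q} (\<lambda>s. F s (U s w) - F s (U s w'))"
        using eq[OF w(1) q] eq[OF w(2) q] by (simp add: Henstock_Kurzweil_Integration.integral_diff)
    qed (use lip inS w in auto)
    then show ?thesis by simp
  qed
  show ?thesis
  proof (rule that[OF C1])
    show "1 + norm (U t w) \<le> C * (1 + norm (U 0 w))" if t: "t \<in> {0..T}" and w: "w \<in> W" for t w
    proof (rule C[OF _ int[OF w] _ _ t])
      show "U q w = U 0 w + integral {0..q} (\<lambda>s. F s (U s w))" if "q \<in> {0..T}" for q
        by (rule eq[OF w that])
      show "norm (F s (U s w)) \<le> \<kappa> s * (1 + norm (U s w))" if "s \<in> {0..T}" for s
        by (rule grow[OF that inS[OF that w]])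
    qed simp
    show "(\<lambda>(s,w). if w \<in> W then U s w else 0) \<in> borel_measurable (lebesgue_on {0..T} \<Otimes>\<^sub>M M)"
    proof (rule joint_measurable_of_lipschitz_parameter[OF W U0, where C="\<lambda>_. C"])
      fix w assume w: "w \<in> W"
      have "(\<lambda>s. F s (U s w)) integrable_on {0..T}" using abs_int_subinterval_on[OF int[OF w]] by simp
      then have "continuous_on {0..T} (\<lambda>t. U 0 w + integral {0..t} (\<lambda>s. F s (U s w)))"
        by (intro continuous_intros indefinite_integral_continuous_1)
      then have "continuous_on {0..T} (\<lambda>t. U t w)"
      proof (rule continuous_on_eq)
        fix q assume "q \<in> {0..T}"
        from eq[OF w this] show "U 0 w + integral {0..q} (\<lambda>s. F s (U s w)) = U q w" by simp
      qed
      then show "(\<lambda>s. U s w) \<in> borel_measurable (lebesgue_on {0..T})"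
        by (rule continuous_imp_measurable_on_sets_lebesgue) simp
    qed (rule stable)
    show "(\<lambda>(s,w). if w \<in> W then F s (U s w) else 0) \<in> borel_measurable (lebesgue_on {0..T} \<Otimes>\<^sub>M M)"
    proof (rule joint_measurable_of_lipschitz_parameter[OF W U0, where C="\<lambda>s. \<kappa> s * C"])
      fix w assume w: "w \<in> W"
      show "(\<lambda>s. F s (U s w)) \<in> borel_measurable (lebesgue_on {0..T})"
        using absolutely_integrable_imp_integrable[OF int[OF w]] by auto
    next
      fix s w w' assume s: "s \<in> {0..T}" and w: "w \<in> W" "w' \<in> W"
      have "norm (F s (U s w) - F s (U s w')) \<le> \<kappa> s * norm (U s w - U s w')"
        using lip inS s w by auto
      also have "\<dots> \<le> \<kappa> s * (C * norm (U 0 w - U 0 w'))"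
        using stable[OF s w] \<kappa>0[OF s] by (rule mult_left_mono)
      finally show "norm (F s (U s w) - F s (U s w')) \<le> \<kappa> s * C * norm (U 0 w - U 0 w')" by simp
    qed
  qed
qed

text \<open>With a measurable set of full measure at hand, a process can be set to 0 off it, so that
  its path identities hold for every outcome and measurability is kept.\<close>

lemma (in prob_space) AE_full_set:
  assumes "AE w in M. R w"
  obtains W where "W \<in> sets M" "W \<subseteq> space M" "AE w in M. w \<in> W" "\<And>w. w \<in> W \<Longrightarrow> R w"
proof -
  obtain N where N: "N \<in> null_sets M" "{w \<in> space M. \<not> R w} \<subseteq> N"
    using assms unfolding eventually_ae_filter by blast
  show ?thesis
  proof (rule that[of "space M - N"])
    show "AE w in M. w \<in> space M - N" using AE_not_in[OF N(1)] AE_space by eventually_elim auto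
  qed (use N in auto)
qed

section \<open>The reduced dynamics\<close>

lemma space_subspace_borel [simp]: "space (subspace_borel G) = G"
  unfolding subspace_borel_def by (simp add: space_restrict_space)

lemma subspace_borel_incl: "(\<lambda>z. z) \<in> subspace_borel G \<rightarrow>\<^sub>M borel"
  unfolding subspace_borel_def by (intro measurable_restrict_space1) simp

text \<open>Sets of the subspace algebra are traces of Borel sets, so equality of laws in the
  ambient space descends to the subspace.\<close>

lemma subspace_borel_eqI:
  assumes "sets M = sets (subspace_borel G)" "sets N = sets (subspace_borel G)"
    and eq: "distr M borel (\<lambda>z. z) = distr N borel (\<lambda>z. z)"
  shows "M = N"
proof (rule measure_eqI)
  fix A assume "A \<in> sets M"
  then obtain B where A: "A = G \<inter> B" and B: "B \<in> sets borel"
    using assms(1) unfolding subspace_borel_def by (auto simp: sets_restrict_space)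
  have m: "(\<lambda>z. z) \<in> borel_measurable M" "(\<lambda>z. z) \<in> borel_measurable N"
    using subspace_borel_incl[of G] measurable_cong_sets[OF assms(1) refl] measurable_cong_sets[OF assms(2) refl] by auto
  have sp: "space M = G" "space N = G"
    using sets_eq_imp_space_eq[OF assms(1)] sets_eq_imp_space_eq[OF assms(2)] by simp_all
  have "emeasure M A = emeasure (distr M borel (\<lambda>z. z)) B"
    using emeasure_distr[OF m(1) B] sp A by (simp add: Int_commute)
  also have "\<dots> = emeasure N A"
    unfolding eq using emeasure_distr[OF m(2) B] sp A by (simp add: Int_commute)
  finally show "emeasure M A = emeasure N A" .
qed (simp add: assms)

lemma norm_fst: "norm (fst z) \<le> norm z"
  using norm_fst_le[of "fst z" "snd z"] by simp

lemma norm_fst_sq_le: "(norm (fst z))\<^sup>2 \<le> (norm z)\<^sup>2"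
  by (intro power_mono norm_fst) simp

lemma fst_borel: "fst \<in> borel_measurable borel"
  by (intro borel_measurable_continuous_onI continuous_intros)

locale reduced_dynamics =
  fixes \<Gamma> :: "('a::euclidean_space \<times> 'c::euclidean_space) set"
    and \<Gamma>h :: "'a set" and \<Gamma>o :: "'c set"
    and b :: "'a \<times> 'c \<Rightarrow> 'a \<times> 'c"
    and P :: "'w measure" and X :: "real \<Rightarrow> 'w \<Rightarrow> 'a \<times> 'c"
    and \<mu> :: "real \<Rightarrow> ('a \<times> 'c) measure" and \<mu>h :: "real \<Rightarrow> 'a measure"
    and \<kappa> :: "real \<Rightarrow> 'a \<Rightarrow> ('a \<times> 'c) measure" and K :: "real \<Rightarrow> real"
    and Q :: "'v measure" and Y :: "real \<Rightarrow> 'v \<Rightarrow> 'a"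
  assumes Gamma: "\<Gamma> = \<Gamma>h \<times> \<Gamma>o"
    and b_Lipschitz: "\<exists>L. L-lipschitz_on \<Gamma> b"
    and P: "prob_space P"
    and X_rv: "\<And>t. t \<ge> 0 \<Longrightarrow> X t \<in> P \<rightarrow>\<^sub>M subspace_borel \<Gamma>"
    and X_solves: "AE \<omega> in P. is_trajectory b (\<lambda>t. X t \<omega>)"
    and mu: "\<And>t. t \<ge> 0 \<Longrightarrow> \<mu> t = distr P (subspace_borel \<Gamma>) (X t)"
    and mu0_second_moment: "integrable (\<mu> 0) (\<lambda>z. (norm z)\<^sup>2)"
    and b_L2: "\<And>t. t \<ge> 0 \<Longrightarrow> square_integrable (\<mu> t) b"
    and mu_hat: "\<And>t. t \<ge> 0 \<Longrightarrow> \<mu>h t = distr (\<mu> t) (subspace_borel \<Gamma>h) fst"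
    and kappa: "\<And>t. t \<ge> 0 \<Longrightarrow> conditional_laws (\<mu> t) fst (subspace_borel \<Gamma>h) (\<kappa> t)"
    and K_nonneg: "\<And>t. t \<ge> 0 \<Longrightarrow> K t \<ge> 0"
    and kappa_Lipschitz: "\<And>t y z. t \<ge> 0 \<Longrightarrow> y \<in> \<Gamma>h \<Longrightarrow> z \<in> \<Gamma>h \<Longrightarrow>
           wasserstein1 (\<kappa> t y) (\<kappa> t z) \<le> ennreal (K t * norm (y - z))"
    and Q: "prob_space Q"
    and Y_rv: "\<And>t. t \<ge> 0 \<Longrightarrow> Y t \<in> Q \<rightarrow>\<^sub>M subspace_borel \<Gamma>h"
    and Y_solves: "AE \<omega> in Q. is_caratheodory_trajectory (reduced_field b \<kappa>) (\<lambda>t. Y t \<omega>)"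
    and Y_initial: "distr Q (subspace_borel \<Gamma>h) (Y 0) = \<mu>h 0"
begin

sublocale P: prob_space P by (rule P)
sublocale Q: prob_space Q by (rule Q)

lemma mu_prob: assumes "0 \<le> t" shows "prob_space (\<mu> t)"
  unfolding mu[OF assms] by (rule P.prob_space_distr[OF X_rv[OF assms]])

lemma mu_sets: assumes "0 \<le> t" shows "sets (\<mu> t) = sets (subspace_borel \<Gamma>)" "space (\<mu> t) = \<Gamma>"
  unfolding mu[OF assms] by simp_all

lemma fst_Gamma: "z \<in> \<Gamma> \<Longrightarrow> fst z \<in> \<Gamma>h"
  using Gamma by auto

lemma fst_subspace: "fst \<in> subspace_borel \<Gamma> \<rightarrow>\<^sub>M subspace_borel \<Gamma>h"
  unfolding subspace_borel_def
  by (rule measurable_restrict_space3) (use fst_Gamma fst_borel in auto)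

lemma fst_meas: assumes "0 \<le> t" shows "fst \<in> \<mu> t \<rightarrow>\<^sub>M subspace_borel \<Gamma>h"
  using fst_subspace by (simp add: measurable_cong_sets[OF mu_sets(1)[OF assms] refl])

lemma fst_X_subspace: "0 \<le> t \<Longrightarrow> (\<lambda>w. fst (X t w)) \<in> P \<rightarrow>\<^sub>M subspace_borel \<Gamma>h"
  using measurable_compose[OF X_rv fst_subspace] .

lemma b_meas: "b \<in> borel_measurable (subspace_borel \<Gamma>)"
  using b_L2[of 0] unfolding square_integrable_def by (simp add: measurable_cong_sets[OF mu_sets(1) refl])

abbreviation h :: "'a \<times> 'c \<Rightarrow> 'a" where "h z \<equiv> fst (b z)"

lemma h_meas: "h \<in> borel_measurable (subspace_borel \<Gamma>)"
  using measurable_compose[OF b_meas fst_borel] .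

lemma h_sq_meas: "(\<lambda>z. (norm (h z))\<^sup>2) \<in> borel_measurable (subspace_borel \<Gamma>)"
  by (intro borel_measurable_power measurable_compose[OF h_meas borel_measurable_norm])

lemma h_mu: assumes "0 \<le> t" shows "h \<in> borel_measurable (\<mu> t)" "integrable (\<mu> t) (\<lambda>z. (norm (h z))\<^sup>2)"
proof -
  show m: "h \<in> borel_measurable (\<mu> t)" using h_meas by (simp add: measurable_cong_sets[OF mu_sets(1)[OF assms] refl])
  show "integrable (\<mu> t) (\<lambda>z. (norm (h z))\<^sup>2)"
  proof (rule norm_integral_le(1))
    show "integrable (\<mu> t) (\<lambda>z. (norm (b z))\<^sup>2)" using b_L2[OF assms] unfolding square_integrable_def by simp
    show "norm ((norm (h z))\<^sup>2) \<le> (norm (b z))\<^sup>2" for z using norm_fst_sq_le by simp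
  qed (use m in measurable)
qed

abbreviation v :: "real \<Rightarrow> 'a \<Rightarrow> 'a" where "v \<equiv> reduced_field b \<kappa>"

lemma v_L2: assumes t: "0 \<le> t" shows "square_integrable (\<mu>h t) (v t)"
  using cond_mean_meas[OF kappa[OF t] mu_prob[OF t] fst_meas[OF t] h_mu[OF t]]
    cond_mean_sq(1)[OF kappa[OF t] mu_prob[OF t] fst_meas[OF t] h_mu[OF t]]
  unfolding square_integrable_def mu_hat[OF t] reduced_field_def by simp

lemma v_projection:
  assumes t: "0 \<le> t" and g: "square_integrable (\<mu>h t) g"
  shows "(\<integral>z. (norm (h z - v t (fst z)))\<^sup>2 \<partial>\<mu> t) \<le> (\<integral>z. (norm (h z - g (fst z)))\<^sup>2 \<partial>\<mu> t)"
proof -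
  have "g \<in> borel_measurable (subspace_borel \<Gamma>h)"
    "integrable (distr (\<mu> t) (subspace_borel \<Gamma>h) fst) (\<lambda>x. (norm (g x))\<^sup>2)"
    using g unfolding square_integrable_def mu_hat[OF t] by simp_all
  from cond_mean_projection[OF kappa[OF t] mu_prob[OF t] fst_meas[OF t] h_mu[OF t] this]
  show ?thesis unfolding reduced_field_def .
qed

definition L :: real where "L = (SOME L. L-lipschitz_on \<Gamma> b)"

lemma L_nonneg: "0 \<le> L" and b_lip: "z \<in> \<Gamma> \<Longrightarrow> z' \<in> \<Gamma> \<Longrightarrow> norm (b z - b z') \<le> L * norm (z - z')"
proof -
  have "L-lipschitz_on \<Gamma> b" unfolding L_def using b_Lipschitz by (rule someI_ex)
  then show "0 \<le> L" "z \<in> \<Gamma> \<Longrightarrow> z' \<in> \<Gamma> \<Longrightarrow> norm (b z - b z') \<le> L * norm (z - z')"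
    by (auto simp: lipschitz_on_def dist_norm)
qed

lemma h_lip: "z \<in> \<Gamma> \<Longrightarrow> z' \<in> \<Gamma> \<Longrightarrow> norm (h z - h z') \<le> L * dist z z'"
  using norm_fst[of "b z - b z'"] b_lip[of z z'] by (simp add: dist_norm)

text \<open>Disintegration gives integrability of \<open>h\<close> under \<open>\<kappa> t x\<close>
  for almost every x only. The marginal is a probability measure, so some such \<open>x0\<close>
  exists, and the Wasserstein bound carries integrability from \<open>x0\<close> to every point of
  \<open>\<Gamma>h\<close>.\<close>

lemma v_lip:
  assumes t: "0 \<le> t" and yz: "y \<in> \<Gamma>h" "z \<in> \<Gamma>h"
  shows "norm (v t y - v t z) \<le> L * K t * norm (y - z)"
proof -
  note cl = kappa[OF t]
  have kp: "prob_space (\<kappa> t x)" "sets (\<kappa> t x) = sets (subspace_borel \<Gamma>)" if "x \<in> \<Gamma>h" for x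
    using conditional_laws_kernel(2,3)[OF cl, of x] that mu_sets(1)[OF t] by simp_all
  interpret N: prob_space "distr (\<mu> t) (subspace_borel \<Gamma>h) fst"
    by (rule prob_space.prob_space_distr[OF mu_prob[OF t] fst_meas[OF t]])
  have ae: "AE x in distr (\<mu> t) (subspace_borel \<Gamma>h) fst. x \<in> \<Gamma>h \<and> integrable (\<kappa> t x) h"
    using cond_int_AE[OF cl mu_prob[OF t] fst_meas[OF t] h_mu[OF t]] AE_space by eventually_elim simp
  obtain x0 where x0: "x0 \<in> \<Gamma>h" "integrable (\<kappa> t x0) h"
  proof (rule ccontr)
    assume "\<not> thesis"
    with that have no: "\<not> (x \<in> \<Gamma>h \<and> integrable (\<kappa> t x) h)" for x by blast
    have "AE x in distr (\<mu> t) (subspace_borel \<Gamma>h) fst. False"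
      using ae by eventually_elim (use no in blast)
    then show False by (simp add: N.AE_False)
  qed
  have Kc: "0 \<le> K t * norm (p - q)" for p q :: 'a using K_nonneg[OF t] by simp
  have int: "integrable (\<kappa> t y) h"
    using wasserstein1_lipschitz_mean(1)[OF kp[OF x0(1)] kp[OF yz(1)] h_meas h_lip L_nonneg x0(2)
        kappa_Lipschitz[OF t x0(1) yz(1)] Kc] .
  show ?thesis
    using wasserstein1_lipschitz_mean(2)[OF kp[OF yz(1)] kp[OF yz(2)] h_meas h_lip L_nonneg int
        kappa_Lipschitz[OF t yz] Kc]
    unfolding reduced_field_def by (simp add: mult.assoc)
qed

section \<open>Growth bounds and transfer of integrals to the laws\<close>

lemma X_in: "0 \<le> s \<Longrightarrow> w \<in> space P \<Longrightarrow> X s w \<in> \<Gamma>"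
  using measurable_space[OF X_rv] by force

lemma Y_in: "0 \<le> s \<Longrightarrow> w \<in> space Q \<Longrightarrow> Y s w \<in> \<Gamma>h"
  using measurable_space[OF Y_rv] by force

lemma linear_growth: obtains B where "0 \<le> B" "L \<le> B" "\<And>z. z \<in> \<Gamma> \<Longrightarrow> norm (b z) \<le> B * (1 + norm z)"
proof -
  obtain w where "w \<in> space P" using P.not_empty by blast
  then have z0: "X 0 w \<in> \<Gamma>" by (rule X_in[OF order_refl])
  let ?z = "X 0 w"
  \<comment> \<open>Any value of \<open>X 0\<close> serves as base point of the growth bound. The
    summand \<open>L\<close> makes \<open>B\<close> a Lipschitz constant too.\<close>
  define B where "B = L + norm (b ?z) + L * norm ?z"
  have "norm (b z) \<le> B * (1 + norm z)" if "z \<in> \<Gamma>" for z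
  proof -
    have "norm (b z) \<le> norm (b ?z) + norm (b z - b ?z)" using norm_triangle_sub by blast
    also have "norm (b z - b ?z) \<le> L * norm (z - ?z)" by (rule b_lip[OF that z0])
    also have "\<dots> \<le> L * (norm z + norm ?z)" using L_nonneg norm_triangle_ineq4 by (intro mult_left_mono)
    finally have "norm (b z) \<le> norm (b ?z) + L * norm z + L * norm ?z" by (simp add: distrib_left)
    moreover have "0 \<le> norm (b ?z) * norm z" "0 \<le> L * norm ?z * norm z" using L_nonneg by simp_all
    moreover have "B * (1 + norm z) = L + norm (b ?z) + L * norm ?z + L * norm z + norm (b ?z) * norm z + L * norm ?z * norm z"
      unfolding B_def by (simp add: algebra_simps)
    ultimately show ?thesis using L_nonneg by linarith
  qed
  moreover have "0 \<le> B" "L \<le> B" unfolding B_def using L_nonneg by auto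
  ultimately show ?thesis using that by blast
qed

lemma X0_sq: "integrable P (\<lambda>w. (norm (X 0 w))\<^sup>2)"
proof -
  have "(\<lambda>z. (norm z)\<^sup>2) \<in> borel_measurable (subspace_borel \<Gamma>)" using subspace_borel_incl[of \<Gamma>] by measurable
  then show ?thesis
    using mu0_second_moment integrable_distr_eq[OF X_rv[of 0], of "\<lambda>z. (norm z)\<^sup>2"] mu[of 0] by simp
qed

lemma one_plus_norm_sq:
  fixes f :: "'u \<Rightarrow> 'b::euclidean_space"
  assumes "prob_space M" "f \<in> borel_measurable M" "integrable M (\<lambda>w. (norm (f w))\<^sup>2)"
  shows "integrable M (\<lambda>w. (c * (1 + norm (f w)))\<^sup>2)"
proof -
  interpret prob_space M by fact
  show ?thesis
  proof (rule norm_integral_le(1))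
    show "integrable M (\<lambda>w. c\<^sup>2 * (2 + 2 * (norm (f w))\<^sup>2))" using assms(3) by simp
    show "(\<lambda>w. (c * (1 + norm (f w)))\<^sup>2) \<in> borel_measurable M" using assms(2) by measurable
    fix w
    have "0 \<le> (norm (f w) - 1)\<^sup>2" by simp
    then have "(1 + norm (f w))\<^sup>2 \<le> 2 + 2 * (norm (f w))\<^sup>2" by (simp add: power2_eq_square algebra_simps)
    then show "norm ((c * (1 + norm (f w)))\<^sup>2) \<le> c\<^sup>2 * (2 + 2 * (norm (f w))\<^sup>2)"
      by (simp add: power_mult_distrib mult_left_mono)
  qed
qed

lemma integral_X:
  fixes g :: "'a \<times> 'c \<Rightarrow> 'b::euclidean_space"
  assumes "0 \<le> s" "g \<in> borel_measurable (subspace_borel \<Gamma>)"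
  shows "(\<integral>w. g (X s w) \<partial>P) = (\<integral>z. g z \<partial>\<mu> s)" "integrable P (\<lambda>w. g (X s w)) \<longleftrightarrow> integrable (\<mu> s) g"
  using integral_distr[OF X_rv[OF assms(1)] assms(2)] integrable_distr_eq[OF X_rv[OF assms(1)] assms(2)]
  unfolding mu[OF assms(1)] by simp_all

lemma marginal_mean:
  fixes u :: "'a \<Rightarrow> 'b::euclidean_space"
  assumes s: "0 \<le> s" and u: "u \<in> borel_measurable (subspace_borel \<Gamma>h)"
  shows "(\<integral>w. u (fst (X s w)) \<partial>P) = (\<integral>y. u y \<partial>\<mu>h s)"
    "integrable P (\<lambda>w. u (fst (X s w))) \<longleftrightarrow> integrable (\<mu>h s) u"
proof -
  have m: "(\<lambda>z. u (fst z)) \<in> borel_measurable (subspace_borel \<Gamma>)"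
    using measurable_compose[OF fst_meas[OF s] u] by (simp add: measurable_cong_sets[OF mu_sets(1)[OF s] refl])
  show "(\<integral>w. u (fst (X s w)) \<partial>P) = (\<integral>y. u y \<partial>\<mu>h s)"
    "integrable P (\<lambda>w. u (fst (X s w))) \<longleftrightarrow> integrable (\<mu>h s) u"
    using integral_X[OF s m] integral_distr[OF fst_meas[OF s] u] integrable_distr_eq[OF fst_meas[OF s] u]
    unfolding mu_hat[OF s] by simp_all
qed

lemma fst_X_meas: "0 \<le> s \<Longrightarrow> (\<lambda>w. fst (X s w)) \<in> borel_measurable P"
  using measurable_compose[OF fst_X_subspace subspace_borel_incl] .

text \<open>Both processes are brought into the setting of \<open>laws_agree\<close>: redefined on
  null sets, and with the field extended, they share the bound \<open>k\<close> and the field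
  \<open>vv\<close>. Equality of laws in the ambient space is finally restricted to
  \<open>\<Gamma>h\<close>.\<close>

theorem marginal_law_preserved:
  assumes T: "0 \<le> T" and K_int: "K integrable_on {0..T}"
  shows "distr Q (subspace_borel \<Gamma>h) (Y T) = \<mu>h T"
proof -
  obtain B where B: "0 \<le> B" "L \<le> B" "\<And>z. z \<in> \<Gamma> \<Longrightarrow> norm (b z) \<le> B * (1 + norm z)"
    using linear_growth by metis
  obtain W1 where W1: "W1 \<in> sets P" "W1 \<subseteq> space P" "AE w in P. w \<in> W1"
    "\<And>w. w \<in> W1 \<Longrightarrow> is_trajectory b (\<lambda>t. X t w)"
    using P.AE_full_set[OF X_solves] by metis
  obtain W2 where W2: "W2 \<in> sets Q" "W2 \<subseteq> space Q" "AE w in Q. w \<in> W2"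
    "\<And>w. w \<in> W2 \<Longrightarrow> is_caratheodory_trajectory v (\<lambda>t. Y t w)"
    using Q.AE_full_set[OF Y_solves] by metis
  have X0m: "X 0 \<in> borel_measurable P" using measurable_compose[OF X_rv subspace_borel_incl, of 0] by simp
  have Y0m: "Y 0 \<in> borel_measurable Q" using measurable_compose[OF Y_rv subspace_borel_incl, of 0] by simp
  have X_in1: "X s w \<in> \<Gamma>" if "s \<in> {0..T}" "w \<in> W1" for s w using X_in[of s w] that W1(2) by auto
  have Y_in2: "Y s w \<in> \<Gamma>h" if "s \<in> {0..T}" "w \<in> W2" for s w using Y_in[of s w] that W2(2) by auto

  have X_int: "(\<lambda>s. b (X s w)) absolutely_integrable_on {0..T}"
    and X_eq: "t \<in> {0..T} \<Longrightarrow> X t w = X 0 w + integral {0..t} (\<lambda>s. b (X s w))" if w: "w \<in> W1" for w t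
  proof -
    have d: "((\<lambda>t. X t w) has_vector_derivative b (X s w)) (at s within {0..t})" if "s \<in> {0..t}" for s t
    proof -
      have "((\<lambda>t. X t w) has_vector_derivative b (X s w)) (at s within {0..})"
        using W1(4)[OF w] that unfolding is_trajectory_def by auto
      then show ?thesis by (rule has_vector_derivative_within_subset) auto
    qed
    have cX: "continuous_on {0..T} (\<lambda>s. X s w)"
      unfolding continuous_on_eq_continuous_within
      using d has_vector_derivative_continuous by blast
    have "L-lipschitz_on \<Gamma> b" unfolding L_def using b_Lipschitz by (rule someI_ex)
    then have "continuous_on \<Gamma> b" by (rule lipschitz_on_continuous_on)
    from continuous_on_compose2[OF this cX] have "continuous_on {0..T} (\<lambda>s. b (X s w))"
      using X_in1[OF _ w] by blast
    then show "(\<lambda>s. b (X s w)) absolutely_integrable_on {0..T}" by (rule absolutely_integrable_continuous_real)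
    assume "t \<in> {0..T}"
    then have "((\<lambda>s. b (X s w)) has_integral X t w - X 0 w) {0..t}"
      by (intro fundamental_theorem_of_calculus d) auto
    then show "X t w = X 0 w + integral {0..t} (\<lambda>s. b (X s w))" by (simp add: integral_unique)
  qed
  have B_int: "(\<lambda>_. B) absolutely_integrable_on {0..T}" by (rule absolutely_integrable_continuous_real) simp
  obtain C1 where C1: "1 \<le> C1" "\<And>t w. t \<in> {0..T} \<Longrightarrow> w \<in> W1 \<Longrightarrow> 1 + norm (X t w) \<le> C1 * (1 + norm (X 0 w))"
    "(\<lambda>(s,w). if w \<in> W1 then X s w else 0) \<in> borel_measurable (lebesgue_on {0..T} \<Otimes>\<^sub>M P)"
    "(\<lambda>(s,w). if w \<in> W1 then b (X s w) else 0) \<in> borel_measurable (lebesgue_on {0..T} \<Otimes>\<^sub>M P)"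
  proof (rule lipschitz_flow[where U=X and W=W1 and S=\<Gamma> and F="\<lambda>_. b" and \<kappa>="\<lambda>_. B", OF B_int _ W1(1) X0m])
    show "norm (b p - b q) \<le> B * norm (p - q)" if "p \<in> \<Gamma>" "q \<in> \<Gamma>" for p q
      using b_lip[OF that] mult_right_mono[OF B(2) norm_ge_zero[of "p - q"]] by linarith
    show "norm (b p) \<le> B * (1 + norm p)" if "p \<in> \<Gamma>" for p by (rule B(3)[OF that])
    show "(\<lambda>s. b (X s w)) absolutely_integrable_on {0..T}" if "w \<in> W1" for w by (rule X_int[OF that])
    show "X t w = X 0 w + integral {0..t} (\<lambda>s. b (X s w))" if "w \<in> W1" "t \<in> {0..T}" for t w
      by (rule X_eq[OF that])
    show "0 \<le> B" by (rule B(1))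
    show "X s w \<in> \<Gamma>" if "s \<in> {0..T}" "w \<in> W1" for s w by (rule X_in1[OF that])
  qed (rule that)

  \<comment> \<open>The factor \<open>B + 1\<close> lets \<open>Z1\<close> dominate both the
    position and the velocity over the whole time interval.\<close>
  define Z1 where "Z1 w = (B + 1) * C1 * (1 + norm (X 0 w))" for w
  have Z1m: "Z1 \<in> borel_measurable P" unfolding Z1_def using X0m by measurable
  have Z1sq: "integrable P (\<lambda>w. (Z1 w)\<^sup>2)" unfolding Z1_def by (rule one_plus_norm_sq[OF P X0m X0_sq])
  have Z1_0: "0 \<le> Z1 w" for w unfolding Z1_def using B(1) C1(1) by simp
  have Z1_ge: "(B + 1) * (1 + norm (X s w)) \<le> Z1 w" if "s \<in> {0..T}" "w \<in> W1" for s w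
    using mult_left_mono[OF C1(2)[OF that], of "B + 1"] B(1) unfolding Z1_def by (simp add: mult.assoc)
  have X_Z1: "norm (X s w) \<le> Z1 w" and bX_Z1: "norm (b (X s w)) \<le> Z1 w" if sw: "s \<in> {0..T}" "w \<in> W1" for s w
  proof -
    have "0 \<le> B * (1 + norm (X s w))" using B(1) by simp
    then have 1: "norm (X s w) \<le> (B + 1) * (1 + norm (X s w))" "B * (1 + norm (X s w)) \<le> (B + 1) * (1 + norm (X s w))"
      by (simp_all add: distrib_right)
    show "norm (X s w) \<le> Z1 w" "norm (b (X s w)) \<le> Z1 w"
      using 1 Z1_ge[OF sw] B(3)[OF X_in1[OF sw]] by linarith+
  qed
  define D1 where "D1 = P.expectation (\<lambda>w. (Z1 w)\<^sup>2)"
  have D1: "0 \<le> D1" unfolding D1_def by simp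

  \<comment> \<open>The Lipschitz constant of the extended field, with the dimension factor of
    \<open>lipschitz_extension_euclidean\<close>.\<close>
  define \<Lambda> where "\<Lambda> s = DIM('a) * (L * K s)" for s
  have \<Lambda>0: "0 \<le> \<Lambda> s" if "s \<in> {0..T}" for s unfolding \<Lambda>_def using L_nonneg K_nonneg[of s] that by auto
  \<comment> \<open>Besides k \<ge> 1 and k \<ge> \<Lambda>, this product is what the growth bound
    \<open>v_grow\<close> below comes out with.\<close>
  define k where "k s = (1 + D1) * (1 + \<Lambda> s)" for s
  have k1: "1 \<le> k s" "\<Lambda> s \<le> k s" if "s \<in> {0..T}" for s
  proof -
    have "1 * (1 + \<Lambda> s) \<le> k s" unfolding k_def using D1 \<Lambda>0[OF that] by (intro mult_right_mono) auto
    then have "1 + \<Lambda> s \<le> k s" by simp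
    then show "1 \<le> k s" "\<Lambda> s \<le> k s" using \<Lambda>0[OF that] by linarith+
  qed
  have K_abs: "K absolutely_integrable_on {0..T}"
    using K_int K_nonneg by (intro nonnegative_absolutely_integrable_1) auto
  have one_int: "(\<lambda>_. 1 :: real) absolutely_integrable_on {0..T}" by (rule absolutely_integrable_continuous_real) simp
  have "(\<lambda>s. (1 + D1) * (1 + DIM('a) * (L * K s))) absolutely_integrable_on {0..T}"
    by (intro set_integrable_mult_right set_integral_add(1) K_abs one_int)
  then have k_int: "k absolutely_integrable_on {0..T}" unfolding k_def \<Lambda>_def .

  \<comment> \<open>The extension is chosen at each time separately. Along both processes it agrees
    with the reduced field almost surely, since they stay in \<open>\<Gamma>h\<close>, and this is
    where measurability in time is inherited from.\<close>
  have "\<exists>g. (\<forall>p\<in>\<Gamma>h. g p = v s p) \<and> (\<forall>p q. norm (g p - g q) \<le> \<Lambda> s * dist p q)" if s: "s \<in> {0..T}" for s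
  proof -
    have LK: "0 \<le> L * K s" using L_nonneg K_nonneg[of s] s by simp
    have lips: "norm (v s p - v s q) \<le> (L * K s) * dist p q" if "p \<in> \<Gamma>h" "q \<in> \<Gamma>h" for p q
      using v_lip[OF _ that, of s] s by (simp add: dist_norm)
    obtain g where "\<And>p. p \<in> \<Gamma>h \<Longrightarrow> g p = v s p" "\<And>p q. norm (g p - g q) \<le> (DIM('a) * (L * K s)) * dist p q"
      using lipschitz_extension_euclidean[OF lips LK] by metis
    then show ?thesis unfolding \<Lambda>_def by blast
  qed
  then obtain vv where vv: "\<And>s p. s \<in> {0..T} \<Longrightarrow> p \<in> \<Gamma>h \<Longrightarrow> vv s p = v s p"
    and vv_lip: "\<And>s p q. s \<in> {0..T} \<Longrightarrow> norm (vv s p - vv s q) \<le> \<Lambda> s * dist p q" by metis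
  have vv_lip_k: "norm (vv s p - vv s q) \<le> k s * dist p q" if "s \<in> {0..T}" for s p q
    using vv_lip[OF that, of p q] mult_right_mono[OF k1(2)[OF that] zero_le_dist[of p q]] by linarith
  have vv_meas: "vv s \<in> borel_measurable borel" if s: "s \<in> {0..T}" for s
    using vv_lip[OF s] \<Lambda>0[OF s]
    by (intro borel_measurable_continuous_onI lipschitz_on_continuous_on[of "\<Lambda> s"] lipschitz_onI) (auto simp: dist_norm)

  \<comment> \<open>Setting position and velocity to 0 off \<open>W1\<close> keeps the path identity
    for every outcome and changes nothing almost surely.\<close>
  define x where "x s w = (if w \<in> W1 then fst (X s w) else 0)" for s w
  define a where "a s w = (if w \<in> W1 then h (X s w) else 0)" for s w
  have x_AE: "AE w in P. x s w = fst (X s w) \<and> a s w = h (X s w)" for s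
    using W1(3) by eventually_elim (simp add: x_def a_def)
  have x_joint: "(\<lambda>(s,w). x s w) \<in> borel_measurable (lebesgue_on {0..T} \<Otimes>\<^sub>M P)"
    using measurable_compose[OF C1(3) fst_borel] by (simp add: x_def split_beta' if_distrib cong: if_cong)
  have a_joint: "(\<lambda>(s,w). a s w) \<in> borel_measurable (lebesgue_on {0..T} \<Otimes>\<^sub>M P)"
    using measurable_compose[OF C1(4) fst_borel] by (simp add: a_def split_beta' if_distrib cong: if_cong)
  have x_meas: "x s \<in> borel_measurable P" if "s \<in> {0..T}" for s
    using measurable_Pair2[OF x_joint, of s] that by simp
  have a_meas: "a s \<in> borel_measurable P" if "s \<in> {0..T}" for s
    using measurable_Pair2[OF a_joint, of s] that by simp
  have a_le: "norm (a s w) \<le> Z1 w" if "s \<in> {0..T}" for s w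
    using bX_Z1[OF that, of w] norm_fst[of "b (X s w)"] Z1_0[of w] unfolding a_def by auto
  have x_le: "norm (x s w) \<le> Z1 w" if "s \<in> {0..T}" for s w
    using X_Z1[OF that, of w] norm_fst[of "X s w"] Z1_0[of w] unfolding x_def by auto
  have v_meas: "v s \<in> borel_measurable (subspace_borel \<Gamma>h)" if "s \<in> {0..T}" for s
    using v_L2[of s] that mu_hat[of s] unfolding square_integrable_def by simp
  have vvx_AE: "AE w in P. vv s (x s w) = v s (fst (X s w))" if s: "s \<in> {0..T}" for s
    using x_AE[of s] AE_space by eventually_elim (use vv[OF s] X_in fst_Gamma s in auto)
  have vvx_meas: "(\<lambda>w. vv s (x s w)) \<in> borel_measurable P" if s: "s \<in> {0..T}" for s
    using measurable_compose[OF x_meas[OF s] vv_meas[OF s]] .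
  have vX_meas: "(\<lambda>w. v s (fst (X s w))) \<in> borel_measurable P" if s: "s \<in> {0..T}" for s
    using measurable_compose[OF fst_X_subspace v_meas[OF s]] s by simp
  have vvx_sq: "integrable P (\<lambda>w. (norm (vv s (x s w)))\<^sup>2)" "P.expectation (\<lambda>w. (norm (vv s (x s w)))\<^sup>2) \<le> D1"
    if s: "s \<in> {0..T}" for s
  proof -
    have s0: "0 \<le> s" using s by simp
    have m: "(\<lambda>y. (norm (v s y))\<^sup>2) \<in> borel_measurable (subspace_borel \<Gamma>h)" using v_meas[OF s] by measurable
    have ae: "AE w in P. (norm (vv s (x s w)))\<^sup>2 = (norm (v s (fst (X s w))))\<^sup>2"
      using vvx_AE[OF s] by eventually_elim simp
    have m1: "(\<lambda>w. (norm (vv s (x s w)))\<^sup>2) \<in> borel_measurable P" using vvx_meas[OF s] by measurable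
    have m2: "(\<lambda>w. (norm (v s (fst (X s w))))\<^sup>2) \<in> borel_measurable P" using vX_meas[OF s] by measurable
    have "integrable P (\<lambda>w. (norm (v s (fst (X s w))))\<^sup>2)"
      using marginal_mean(2)[OF s0 m] v_L2[OF s0] unfolding square_integrable_def by simp
    then show "integrable P (\<lambda>w. (norm (vv s (x s w)))\<^sup>2)"
      using integrable_cong_AE[OF m1 m2 ae] by simp
    have "P.expectation (\<lambda>w. (norm (vv s (x s w)))\<^sup>2) = P.expectation (\<lambda>w. (norm (v s (fst (X s w))))\<^sup>2)"
      by (rule integral_cong_AE[OF m1 m2 ae])
    also have "\<dots> = (\<integral>y. (norm (v s y))\<^sup>2 \<partial>\<mu>h s)" by (rule marginal_mean(1)[OF s0 m])
    \<comment> \<open>Contraction of the conditional mean; the bound of \<open>h (X s w)\<close> by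
      \<open>Z1\<close> then makes the estimate uniform in \<open>s\<close>.\<close>
    also have "\<dots> \<le> (\<integral>z. (norm (h z))\<^sup>2 \<partial>\<mu> s)"
      using cond_mean_sq(2)[OF kappa[OF s0] mu_prob[OF s0] fst_meas[OF s0] h_mu[OF s0]]
      unfolding mu_hat[OF s0] reduced_field_def .
    also have "\<dots> = P.expectation (\<lambda>w. (norm (h (X s w)))\<^sup>2)"
      by (rule integral_X(1)[OF s0 h_sq_meas, symmetric])
    also have "\<dots> \<le> D1" unfolding D1_def
    proof (rule integral_mono_AE[OF _ Z1sq])
      show "integrable P (\<lambda>w. (norm (h (X s w)))\<^sup>2)"
        using integral_X(2)[OF s0 h_sq_meas] h_mu(2)[OF s0] by simp
      show "AE w in P. (norm (h (X s w)))\<^sup>2 \<le> (Z1 w)\<^sup>2"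
        using x_AE[of s] by eventually_elim (use a_le[OF s] in \<open>metis norm_ge_zero power_mono\<close>)
    qed
    finally show "P.expectation (\<lambda>w. (norm (vv s (x s w)))\<^sup>2) \<le> D1" .
  qed
  have k_sq: "D \<le> (k s)\<^sup>2 * D" if "0 \<le> D" "s \<in> {0..T}" for D s
  proof -
    have "1\<^sup>2 \<le> (k s)\<^sup>2" using k1(1)[OF that(2)] by (intro power_mono) auto
    then show ?thesis using mult_right_mono[of 1 "(k s)\<^sup>2" D] that(1) by simp
  qed
  have ka: "norm (a s w) \<le> k s * Z1 w" if "s \<in> {0..T}" for s w
    using a_le[OF that, of w] mult_right_mono[OF k1(1)[OF that] Z1_0[of w]] by simp

  have procX: "dominated_process P T k Z1 x a vv"
  proof (unfold_locales)
    show "x t w = x r w + integral {r..t} (\<lambda>s. a s w)" if rt: "0 \<le> r" "r \<le> t" "t \<le> T" for r t w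
    proof (cases "w \<in> W1")
      case True
      note i = X_int[OF True]
      have "(\<lambda>s. b (X s w)) integrable_on {r..t}"
        by (rule abs_int_subinterval_on[OF i rt(1,3)])
      from integral_linear[OF this bounded_linear_fst]
      have l: "integral {r..t} (\<lambda>s. h (X s w)) = fst (integral {r..t} (\<lambda>s. b (X s w)))" by (simp add: o_def)
      have "X t w = X r w + integral {r..t} (\<lambda>s. b (X s w))"
        using X_eq[OF True, of t] X_eq[OF True, of r] integral_combine_diff[OF i rt] rt by simp
      from arg_cong[OF this, of fst] show ?thesis unfolding x_def a_def using True l by simp
    qed (simp add: x_def a_def)
    show "P.expectation (\<lambda>w. (norm (vv s (x s w)))\<^sup>2) \<le> (k s)\<^sup>2 * P.expectation (\<lambda>w. (Z1 w)\<^sup>2)"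
      if s: "s \<in> {0..T}" for s
      using vvx_sq(2)[OF s] k_sq[OF D1 s] unfolding D1_def by linarith
    fix s and \<psi> :: "'a \<Rightarrow> 'a" and Bd assume s: "s \<in> {0..T}" and psm: "\<psi> \<in> borel_measurable borel" and psb: "\<And>y. norm (\<psi> y) \<le> Bd"
    have s0: "0 \<le> s" using s by simp
    have psh: "\<psi> \<in> borel_measurable (subspace_borel \<Gamma>h)" using measurable_compose[OF subspace_borel_incl psm] .
    have ps_mu: "(\<lambda>z. \<psi> (fst z)) \<in> borel_measurable (\<mu> s)" using measurable_compose[OF fst_meas[OF s0] psh] .
    have "integrable (\<mu> s) (\<lambda>z. \<psi> (fst z) \<bullet> h z)"
    proof (rule norm_integral_le(1))
      show "integrable (\<mu> s) (\<lambda>z. Bd * norm (h z))"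
        using prob_space.norm_mean_sq_le(1)[OF mu_prob[OF s0] h_mu[OF s0]] by simp
      show "(\<lambda>z. \<psi> (fst z) \<bullet> h z) \<in> borel_measurable (\<mu> s)" by (rule borel_measurable_inner[OF ps_mu h_mu(1)[OF s0]])
      show "norm (\<psi> (fst z) \<bullet> h z) \<le> Bd * norm (h z)" for z
        using Cauchy_Schwarz_ineq2[of "\<psi> (fst z)" "h z"] mult_right_mono[OF psb[of "fst z"] norm_ge_zero[of "h z"]]
        by simp
    qed
    \<comment> \<open>This is where the reduced field enters as a conditional mean: against bounded
      functions of the resolved position it cannot be told apart from \<open>h\<close>.\<close>
    from cond_mean_inner[OF kappa[OF s0] mu_prob[OF s0] fst_meas[OF s0] h_mu[OF s0] psh this]
    have ci: "(\<integral>z. \<psi> (fst z) \<bullet> h z \<partial>\<mu> s) = (\<integral>z. \<psi> (fst z) \<bullet> v s (fst z) \<partial>\<mu> s)" unfolding reduced_field_def .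
    have pxm: "(\<lambda>w. \<psi> (x s w)) \<in> borel_measurable P" using measurable_compose[OF x_meas[OF s] psm] .
    have pXm: "(\<lambda>w. \<psi> (fst (X s w))) \<in> borel_measurable P" using measurable_compose[OF fst_X_meas[OF s0] psm] .
    have hXm: "(\<lambda>w. h (X s w)) \<in> borel_measurable P" using measurable_compose[OF X_rv[OF s0] h_meas] .
    have "P.expectation (\<lambda>w. \<psi> (x s w) \<bullet> a s w) = P.expectation (\<lambda>w. \<psi> (fst (X s w)) \<bullet> h (X s w))"
    proof (rule integral_cong_AE)
      show "AE w in P. \<psi> (x s w) \<bullet> a s w = \<psi> (fst (X s w)) \<bullet> h (X s w)" using x_AE[of s] by eventually_elim simp
    qed (intro borel_measurable_inner pxm pXm hXm a_meas[OF s])+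
    also have "\<dots> = (\<integral>z. \<psi> (fst z) \<bullet> h z \<partial>\<mu> s)"
      using measurable_compose[OF fst_subspace psh] h_meas by (intro integral_X(1)[OF s0] borel_measurable_inner)
    also have "\<dots> = (\<integral>z. \<psi> (fst z) \<bullet> v s (fst z) \<partial>\<mu> s)" by (rule ci)
    also have "\<dots> = P.expectation (\<lambda>w. \<psi> (fst (X s w)) \<bullet> v s (fst (X s w)))"
    proof (rule integral_X(1)[OF s0, symmetric])
      show "(\<lambda>z. \<psi> (fst z) \<bullet> v s (fst z)) \<in> borel_measurable (subspace_borel \<Gamma>)"
        by (intro borel_measurable_inner measurable_compose[OF fst_subspace psh] measurable_compose[OF fst_subspace v_meas[OF s]])
    qed
    also have "\<dots> = P.expectation (\<lambda>w. \<psi> (x s w) \<bullet> vv s (x s w))"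
    proof (rule integral_cong_AE)
      show "AE w in P. \<psi> (fst (X s w)) \<bullet> v s (fst (X s w)) = \<psi> (x s w) \<bullet> vv s (x s w)"
        using x_AE[of s] vvx_AE[OF s] by eventually_elim simp
    qed (intro borel_measurable_inner pxm pXm vX_meas[OF s] vvx_meas[OF s])+
    finally show "P.expectation (\<lambda>w. \<psi> (x s w) \<bullet> a s w) = P.expectation (\<lambda>w. \<psi> (x s w) \<bullet> vv s (x s w))" .
  qed (use k_int k1(1) Z1m Z1sq Z1_0 x_joint a_joint ka vv_meas vvx_sq(1) in auto)
  interpret A: dominated_process P T k Z1 x a vv by (rule procX)

  \<comment> \<open>A base point with a bound uniform in time is replaced by the random point
    \<open>x s w\<close>: the Lipschitz estimate is averaged over w, and the mean of |vv s (x s w)|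
    is at most \<open>1 + D1\<close> at every time.\<close>
  have v_grow: "norm (vv s y) \<le> k s * (1 + norm y)" if s: "s \<in> {0..T}" and y: "y \<in> \<Gamma>h" for s y
  proof -
    have le: "norm (vv s y) \<le> norm (vv s (x s w)) + \<Lambda> s * (norm y + Z1 w)" for w
    proof -
      have "norm (vv s y) \<le> norm (vv s (x s w)) + norm (vv s y - vv s (x s w))" using norm_triangle_sub by blast
      also have "norm (vv s y - vv s (x s w)) \<le> \<Lambda> s * dist y (x s w)" by (rule vv_lip[OF s])
      also have "\<dots> \<le> \<Lambda> s * (norm y + Z1 w)"
        using norm_triangle_ineq4[of y "x s w"] x_le[OF s, of w] \<Lambda>0[OF s] by (intro mult_left_mono) (auto simp: dist_norm)
      finally show ?thesis by simp
    qed
    have n_int: "integrable P (\<lambda>w. norm (vv s (x s w)))" by (rule A.v_int(1)[OF s])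
    have n_le: "P.expectation (\<lambda>w. norm (vv s (x s w))) \<le> 1 + D1"
    proof -
      have "P.expectation (\<lambda>w. norm (vv s (x s w))) \<le> P.expectation (\<lambda>w. 1 + (norm (vv s (x s w)))\<^sup>2)"
      proof (rule integral_mono[OF n_int])
        show "norm (vv s (x s w)) \<le> 1 + (norm (vv s (x s w)))\<^sup>2" for w
          by (rule le_one_plus_sq)
      qed (use vvx_sq(1)[OF s] in simp)
      also have "\<dots> = 1 + P.expectation (\<lambda>w. (norm (vv s (x s w)))\<^sup>2)" using vvx_sq(1)[OF s] by (simp add: P.prob_space)
      finally show ?thesis using vvx_sq(2)[OF s] by simp
    qed
    have "norm (vv s y) = P.expectation (\<lambda>w. norm (vv s y))" by (simp add: P.prob_space)
    also have "\<dots> \<le> P.expectation (\<lambda>w. norm (vv s (x s w)) + \<Lambda> s * (norm y + Z1 w))"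
      using n_int A.Z_int le by (intro integral_mono) auto
    also have "\<dots> = P.expectation (\<lambda>w. norm (vv s (x s w))) + \<Lambda> s * (norm y + P.expectation Z1)"
      using n_int A.Z_int by (simp add: P.prob_space)
    also have "\<dots> \<le> (1 + D1) + \<Lambda> s * (norm y + (1 + D1))"
      using n_le A.Z_mean_le \<Lambda>0[OF s] unfolding D1_def by (intro add_mono mult_left_mono) auto
    also have "\<dots> \<le> (1 + D1) * (1 + \<Lambda> s) * (1 + norm y)"
    proof -
      have "0 \<le> D1 * norm y" "0 \<le> D1 * (\<Lambda> s * norm y)" "0 \<le> \<Lambda> s * norm y"
        using D1 \<Lambda>0[OF s] by simp_all
      then show ?thesis by (simp add: algebra_simps)
    qed
    finally show ?thesis unfolding k_def .
  qed

  have vvY: "vv s (Y s w) = v s (Y s w)" if "s \<in> {0..T}" "w \<in> W2" for s w by (rule vv[OF that(1) Y_in2[OF that]])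
  have Y_int: "(\<lambda>s. vv s (Y s w)) absolutely_integrable_on {0..T}"
    and Y_eq: "t \<in> {0..T} \<Longrightarrow> Y t w = Y 0 w + integral {0..t} (\<lambda>s. vv s (Y s w))" if w: "w \<in> W2" for w t
  proof -
    have c: "\<And>t. 0 \<le> t \<Longrightarrow> (\<lambda>s. v s (Y s w)) absolutely_integrable_on {0..t} \<and>
            Y t w = Y 0 w + integral {0..t} (\<lambda>s. v s (Y s w))"
      using W2(4)[OF w] unfolding is_caratheodory_trajectory_def by blast
    show "(\<lambda>s. vv s (Y s w)) absolutely_integrable_on {0..T}"
      using c[OF T] vvY[OF _ w] by (subst set_integrable_cong[OF refl refl, where f'="\<lambda>s. v s (Y s w)"]) auto
    assume t: "t \<in> {0..T}"
    then have "integral {0..t} (\<lambda>s. vv s (Y s w)) = integral {0..t} (\<lambda>s. v s (Y s w))"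
      using vvY[OF _ w] by (intro Henstock_Kurzweil_Integration.integral_cong) auto
    then show "Y t w = Y 0 w + integral {0..t} (\<lambda>s. vv s (Y s w))" using c[of t] t by simp
  qed
  obtain C2 where C2: "1 \<le> C2" "\<And>t w. t \<in> {0..T} \<Longrightarrow> w \<in> W2 \<Longrightarrow> 1 + norm (Y t w) \<le> C2 * (1 + norm (Y 0 w))"
    "(\<lambda>(s,w). if w \<in> W2 then Y s w else 0) \<in> borel_measurable (lebesgue_on {0..T} \<Otimes>\<^sub>M Q)"
    "(\<lambda>(s,w). if w \<in> W2 then vv s (Y s w) else 0) \<in> borel_measurable (lebesgue_on {0..T} \<Otimes>\<^sub>M Q)"
  proof (rule lipschitz_flow[where U=Y and W=W2 and S=\<Gamma>h and F=vv and \<kappa>=k, OF k_int _ W2(1) Y0m])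
    show "norm (vv s p - vv s q) \<le> k s * norm (p - q)" if "s \<in> {0..T}" for s p q
      using vv_lip_k[OF that, of p q] by (simp add: dist_norm)
    show "Y s w \<in> \<Gamma>h" if "s \<in> {0..T}" "w \<in> W2" for s w by (rule Y_in2[OF that])
    show "0 \<le> k s" if "s \<in> {0..T}" for s using k1(1)[OF that] by simp
    show "norm (vv s p) \<le> k s * (1 + norm p)" if "s \<in> {0..T}" "p \<in> \<Gamma>h" for s p by (rule v_grow[OF that])
    show "(\<lambda>s. vv s (Y s w)) absolutely_integrable_on {0..T}" if "w \<in> W2" for w by (rule Y_int[OF that])
    show "Y t w = Y 0 w + integral {0..t} (\<lambda>s. vv s (Y s w))" if "w \<in> W2" "t \<in> {0..T}" for t w
      by (rule Y_eq[OF that])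
  qed (rule that)
  define y where "y s w = (if w \<in> W2 then Y s w else 0)" for s w
  define c where "c s w = (if w \<in> W2 then vv s (Y s w) else 0)" for s w
  \<comment> \<open>\<open>v_grow\<close> already carries the factor \<open>k s\<close>, so
    \<open>Z2\<close> has to control the position only.\<close>
  define Z2 where "Z2 w = C2 * (1 + norm (Y 0 w))" for w
  have Z2m: "Z2 \<in> borel_measurable Q" unfolding Z2_def using Y0m by measurable
  have nm: "(\<lambda>p. (norm p)\<^sup>2) \<in> borel_measurable (subspace_borel \<Gamma>h)" using subspace_borel_incl[of \<Gamma>h] by measurable
  \<comment> \<open>The second moment of \<open>Y 0\<close> is that of the resolved part of
    \<open>X 0\<close>, through the common initial marginal.\<close>
  have "integrable P (\<lambda>w. (norm (fst (X 0 w)))\<^sup>2)"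
  proof (rule norm_integral_le(1)[OF _ X0_sq])
    show "(\<lambda>w. (norm (fst (X 0 w)))\<^sup>2) \<in> borel_measurable P" using fst_X_meas[of 0] by simp
  qed (simp add: norm_fst_sq_le)
  then have "integrable (\<mu>h 0) (\<lambda>p. (norm p)\<^sup>2)" using marginal_mean(2)[OF order_refl nm] by simp
  then have "integrable (distr Q (subspace_borel \<Gamma>h) (Y 0)) (\<lambda>p. (norm p)\<^sup>2)" unfolding Y_initial .
  then have Y0_sq: "integrable Q (\<lambda>w. (norm (Y 0 w))\<^sup>2)" using integrable_distr_eq[OF Y_rv[of 0] nm] by simp
  have Z2sq: "integrable Q (\<lambda>w. (Z2 w)\<^sup>2)" unfolding Z2_def by (rule one_plus_norm_sq[OF Q Y0m Y0_sq])
  have Z2_0: "0 \<le> Z2 w" for w unfolding Z2_def using C2(1) by simp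
  have c_le: "norm (c s w) \<le> k s * Z2 w" if s: "s \<in> {0..T}" for s w
  proof (cases "w \<in> W2")
    case True
    have "norm (vv s (Y s w)) \<le> k s * (1 + norm (Y s w))" by (rule v_grow[OF s Y_in2[OF s True]])
    also have "\<dots> \<le> k s * Z2 w" unfolding Z2_def using C2(2)[OF s True] k1(1)[OF s] by (intro mult_left_mono) auto
    finally show ?thesis unfolding c_def using True by simp
  next
    case False
    then show ?thesis unfolding c_def using Z2_0[of w] k1(1)[OF s] by simp
  qed
  have y_joint: "(\<lambda>(s,w). y s w) \<in> borel_measurable (lebesgue_on {0..T} \<Otimes>\<^sub>M Q)" unfolding y_def by (rule C2(3))
  have c_joint: "(\<lambda>(s,w). c s w) \<in> borel_measurable (lebesgue_on {0..T} \<Otimes>\<^sub>M Q)" unfolding c_def by (rule C2(4))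
  have y_meas: "y s \<in> borel_measurable Q" if "s \<in> {0..T}" for s
    using measurable_Pair2[OF y_joint, of s] that by simp
  have c_meas: "c s \<in> borel_measurable Q" if "s \<in> {0..T}" for s
    using measurable_Pair2[OF c_joint, of s] that by simp
  \<comment> \<open>The velocity of the surrogate is almost surely \<open>vv\<close> at its
    position, so \<open>v_mean\<close> holds without any conditioning.\<close>
  have vvy_AE: "AE w in Q. vv s (y s w) = c s w" for s
    using W2(3) by eventually_elim (simp add: y_def c_def)
  have vvy_meas: "(\<lambda>w. vv s (y s w)) \<in> borel_measurable Q" if s: "s \<in> {0..T}" for s
    using measurable_compose[OF y_meas[OF s] vv_meas[OF s]] .
  have procY: "dominated_process Q T k Z2 y c vv"
  proof (unfold_locales)
    show "y t w = y r w + integral {r..t} (\<lambda>s. c s w)" if rt: "0 \<le> r" "r \<le> t" "t \<le> T" for r t w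
    proof (cases "w \<in> W2")
      case True
      then show ?thesis
        using Y_eq[OF True, of t] Y_eq[OF True, of r] integral_combine_diff[OF Y_int[OF True] rt] rt
        by (simp add: y_def c_def)
    qed (simp add: y_def c_def)
    fix s assume s: "s \<in> {0..T}"
    have m: "(\<lambda>w. (norm (vv s (y s w)))\<^sup>2) \<in> borel_measurable Q" "(\<lambda>w. (norm (c s w))\<^sup>2) \<in> borel_measurable Q"
      using vvy_meas[OF s] c_meas[OF s] by measurable
    have ae: "AE w in Q. (norm (vv s (y s w)))\<^sup>2 = (norm (c s w))\<^sup>2" using vvy_AE[of s] by eventually_elim simp
    have kz: "integrable Q (\<lambda>w. (k s)\<^sup>2 * (Z2 w)\<^sup>2)" using Z2sq by simp
    have cb: "norm ((norm (c s w))\<^sup>2) \<le> (k s)\<^sup>2 * (Z2 w)\<^sup>2" for w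
      using power_mono[OF c_le[OF s, of w], of 2] by (simp add: power_mult_distrib)
    show "integrable Q (\<lambda>w. (norm (vv s (y s w)))\<^sup>2)"
      using integrable_cong_AE[OF m ae] norm_integral_le(1)[OF m(2) kz cb] by simp
    have "Q.expectation (\<lambda>w. (norm (vv s (y s w)))\<^sup>2) = Q.expectation (\<lambda>w. (norm (c s w))\<^sup>2)"
      by (rule integral_cong_AE[OF m ae])
    also have "\<dots> \<le> norm (Q.expectation (\<lambda>w. (norm (c s w))\<^sup>2))" by simp
    also have "\<dots> \<le> Q.expectation (\<lambda>w. (k s)\<^sup>2 * (Z2 w)\<^sup>2)" by (rule norm_integral_le(2)[OF m(2) kz cb])
    finally show "Q.expectation (\<lambda>w. (norm (vv s (y s w)))\<^sup>2) \<le> (k s)\<^sup>2 * Q.expectation (\<lambda>w. (Z2 w)\<^sup>2)" by simp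
    fix \<psi> :: "'a \<Rightarrow> 'a" assume psm: "\<psi> \<in> borel_measurable borel"
    have pm: "(\<lambda>w. \<psi> (y s w)) \<in> borel_measurable Q" using measurable_compose[OF y_meas[OF s] psm] .
    show "Q.expectation (\<lambda>w. \<psi> (y s w) \<bullet> c s w) = Q.expectation (\<lambda>w. \<psi> (y s w) \<bullet> vv s (y s w))"
    proof (rule integral_cong_AE)
      show "AE w in Q. \<psi> (y s w) \<bullet> c s w = \<psi> (y s w) \<bullet> vv s (y s w)" using vvy_AE[of s] by eventually_elim simp
    qed (intro borel_measurable_inner pm c_meas[OF s] vvy_meas[OF s])+
  qed (use k_int k1(1) Z2m Z2sq Z2_0 y_joint c_joint c_le vv_meas in auto)
  interpret AB: two_dominated_processes P Q T k Z1 Z2 x a y c vv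
    using procX procY vv_lip_k
    by (intro two_dominated_processes.intro two_dominated_processes_axioms.intro)

  have T_in: "T \<in> {0..T}" and z_in: "0 \<in> {0..T}" using T by simp_all
  have y_AE: "AE w in Q. y s w = Y s w" for s using W2(3) by eventually_elim (simp add: y_def)
  have Yb: "Y s \<in> borel_measurable Q" if "0 \<le> s" for s using measurable_compose[OF Y_rv[OF that] subspace_borel_incl] .
  have "distr P borel (x T) = distr Q borel (y T)"
  proof (rule AB.laws_agree[OF _ T_in])
    fix u :: "'a \<Rightarrow> real" assume u: "u \<in> bl_unit"
    have um: "u \<in> borel_measurable borel" by (rule bl_unit_measurable[OF u])
    have uh: "u \<in> borel_measurable (subspace_borel \<Gamma>h)" using measurable_compose[OF subspace_borel_incl um] .
    have "(\<integral>w. u (x 0 w) \<partial>P) = (\<integral>w. u (fst (X 0 w)) \<partial>P)"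
    proof (rule integral_cong_AE)
      show "AE w in P. u (x 0 w) = u (fst (X 0 w))" using x_AE[of 0] by eventually_elim simp
    qed (use measurable_compose[OF x_meas[OF z_in] um] measurable_compose[OF fst_X_meas[of 0] um] in auto)
    also have "\<dots> = (\<integral>p. u p \<partial>\<mu>h 0)" by (rule marginal_mean(1)[OF order_refl uh])
    also have "\<dots> = (\<integral>w. u (Y 0 w) \<partial>Q)"
      unfolding Y_initial[symmetric] by (rule integral_distr[OF Y_rv[OF order_refl] uh])
    also have "\<dots> = (\<integral>w. u (y 0 w) \<partial>Q)"
    proof (rule integral_cong_AE)
      show "AE w in Q. u (Y 0 w) = u (y 0 w)" using y_AE[of 0] by eventually_elim simp
    qed (use measurable_compose[OF y_meas[OF z_in] um] measurable_compose[OF Y0m um] in auto)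
    finally show "(\<integral>w. u (x 0 w) \<partial>P) = (\<integral>w. u (y 0 w) \<partial>Q)" .
  qed
  also have "distr Q borel (y T) = distr Q borel (Y T)"
    using y_AE[of T] y_meas[OF T_in] Yb[OF T] by (intro distr_cong_AE) auto
  also have "distr Q borel (Y T) = distr (distr Q (subspace_borel \<Gamma>h) (Y T)) borel (\<lambda>p. p)"
    using distr_distr[OF subspace_borel_incl Y_rv[OF T]] by (simp add: o_def)
  also have "distr P borel (x T) = distr P borel (\<lambda>w. fst (X T w))"
    using x_AE[of T] x_meas[OF T_in] fst_X_meas[OF T] by (intro distr_cong_AE) auto
  also have "\<dots> = distr (\<mu>h T) borel (\<lambda>p. p)"
  proof -
    have "\<mu>h T = distr P (subspace_borel \<Gamma>h) (\<lambda>w. fst (X T w))"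
      unfolding mu_hat[OF T] mu[OF T] using X_rv[OF T] fst_subspace by (simp add: distr_distr o_def)
    then show ?thesis using distr_distr[OF subspace_borel_incl fst_X_subspace[OF T]] by (simp add: o_def)
  qed
  finally have "distr (\<mu>h T) borel (\<lambda>p. p) = distr (distr Q (subspace_borel \<Gamma>h) (Y T)) borel (\<lambda>p. p)" .
  from subspace_borel_eqI[OF _ _ this[symmetric], of \<Gamma>h] show ?thesis
    unfolding mu_hat[OF T] by simp
qed

end

text \<open>The claim on laws rests on integrability of \<open>K\<close> in time, which makes the
  Lipschitz constants of the reduced field admissible in Gronwall's inequality. Square integrability
  of the reduced field places the conditional mean itself among the competitors
  \<open>g\<close>.\<close>

theorem proposition5p4:
  fixes \<Gamma> :: "((real^'m) \<times> (real^'p)) set"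
    and \<Gamma>h :: "(real^'m) set" and \<Gamma>o :: "(real^'p) set"
    and b :: "(real^'m) \<times> (real^'p) \<Rightarrow> (real^'m) \<times> (real^'p)"
    and P :: "'w measure" and X :: "real \<Rightarrow> 'w \<Rightarrow> (real^'m) \<times> (real^'p)"
    and \<mu> :: "real \<Rightarrow> ((real^'m) \<times> (real^'p)) measure"
    and \<mu>h :: "real \<Rightarrow> (real^'m) measure"
    and \<kappa> :: "real \<Rightarrow> real^'m \<Rightarrow> ((real^'m) \<times> (real^'p)) measure"
    and K :: "real \<Rightarrow> real"
    and Q :: "'v measure" and Y :: "real \<Rightarrow> 'v \<Rightarrow> real^'m"
  assumes Gamma: "\<Gamma> = \<Gamma>h \<times> \<Gamma>o"
    and b_Lipschitz: "\<exists>L. L-lipschitz_on \<Gamma> b"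
    and invariant: "invariant_under b \<Gamma>"
    and P: "prob_space P"
    and X_rv: "\<And>t. t \<ge> 0 \<Longrightarrow> X t \<in> P \<rightarrow>\<^sub>M subspace_borel \<Gamma>"
    and X_solves: "AE \<omega> in P. is_trajectory b (\<lambda>t. X t \<omega>)"
    and mu: "\<And>t. t \<ge> 0 \<Longrightarrow> \<mu> t = distr P (subspace_borel \<Gamma>) (X t)"
    and mu0_second_moment: "integrable (\<mu> 0) (\<lambda>z. (norm z)\<^sup>2)"
    and mu0_abs_cont: "absolutely_continuous lborel (distr (\<mu> 0) borel (\<lambda>z. z))"
    and b_L2: "\<And>t. t \<ge> 0 \<Longrightarrow> square_integrable (\<mu> t) b"
    and mu_hat: "\<And>t. t \<ge> 0 \<Longrightarrow> \<mu>h t = distr (\<mu> t) (subspace_borel \<Gamma>h) fst"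
    and kappa: "\<And>t. t \<ge> 0 \<Longrightarrow> conditional_laws (\<mu> t) fst (subspace_borel \<Gamma>h) (\<kappa> t)"
    and K_nonneg: "\<And>t. t \<ge> 0 \<Longrightarrow> K t \<ge> 0"
    and kappa_Lipschitz: "\<And>t y z. t \<ge> 0 \<Longrightarrow> y \<in> \<Gamma>h \<Longrightarrow> z \<in> \<Gamma>h \<Longrightarrow>
           wasserstein1 (\<kappa> t y) (\<kappa> t z) \<le> ennreal (K t * norm (y - z))"
    and Q: "prob_space Q"
    and Y_rv: "\<And>t. t \<ge> 0 \<Longrightarrow> Y t \<in> Q \<rightarrow>\<^sub>M subspace_borel \<Gamma>h"
    and Y_solves: "AE \<omega> in Q. is_caratheodory_trajectory (reduced_field b \<kappa>) (\<lambda>t. Y t \<omega>)"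
    and Y_initial: "distr Q (subspace_borel \<Gamma>h) (Y 0) = \<mu>h 0"
  shows "((\<forall>T\<ge>0. K integrable_on {0..T}) \<longrightarrow>
            (\<forall>t\<ge>0. distr Q (subspace_borel \<Gamma>h) (Y t) = \<mu>h t))
       \<and> (\<forall>t\<ge>0. square_integrable (\<mu>h t) (reduced_field b \<kappa> t) \<and>
            (\<forall>g :: real^'m \<Rightarrow> real^'m. square_integrable (\<mu>h t) g \<longrightarrow>
               (\<integral>z. (norm (fst (b z) - reduced_field b \<kappa> t (fst z)))\<^sup>2 \<partial>\<mu> t)
                 \<le> (\<integral>z. (norm (fst (b z) - g (fst z)))\<^sup>2 \<partial>\<mu> t)))"
proof -
  interpret reduced_dynamics \<Gamma> \<Gamma>h \<Gamma>o b P X \<mu> \<mu>h \<kappa> K Q Y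
    by (rule reduced_dynamics.intro; fact)
  show ?thesis
    using marginal_law_preserved v_L2 v_projection by blast
qed

end
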